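(* Let $V$ be the ground model, let $\mathbb{P}\in V$ be a notion of forcing adding a random real over $V$, and let $\mathcal{A}\in V$ be an infinite Boolean algebra. Let $G$ be a $\mathbb{P}$-generic filter over $V$. Then, in $V[G]$, $\mathcal{A}$ has neither the Nikodym property nor the Grothendieck property.
   Context: A real $r\in2^\omega\cap V[G]$ is random over $V$ if it does not belong to (the reinterpretation of) any Borel set $B\subseteq2^\omega$ coded in $V$ which has product (Lebesgue) measure zero in $V$. A measure on a Boolean algebra $\mathcal{A}$ is a finitely additive $\mu\colon\mathcal{A}\to\mathbb{R}$ of bounded total variation; it extends uniquely to a signed Radon measure on $St(\mathcal{A})$. A sequence $(\mu_n)$ is pointwise null if $\mu_n(A)\to0$ for all $A\in\mathcal{A}$; weak* null if $\int f\,d\mu_n\to0$ for every continuous $f$ on $St(\mathcal{A})$; weakly null if $\mu_n(B)\to0$ for all Borel $B\subseteq St(\mathcal{A})$. $\mathcal{A}$ has the Nikodym property if every pointwise null sequence of measures is weak* null, and the Grothendieck property if every weak* null sequence of measures is weakly null. *)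

theory Defs
  imports "HOL-Probability.Probability"
begin

text \<open>
  The universe of HOL plays the role of the ground model \<open>V\<close>, and a notion of forcing is a
  preordered type \<open>'p\<close> (smaller conditions are stronger). Statements about \<open>V[G]\<close> are expressed in
  the forcing language: a formula \<open>\<phi>\<close> is identified with the predicate ``\<open>p\<close> forces \<open>\<phi>\<close>'' on
  conditions, given by the usual recursive clauses. By the forcing theorem, ``\<open>\<phi>\<close> holds in \<open>V[G]\<close>
  for every \<open>'p\<close>-generic filter \<open>G\<close> over \<open>V\<close>'' means that every condition forces \<open>\<phi>\<close>.
\<close>

section \<open>The forcing language\<close>

type_synonym 'p fm = "'p \<Rightarrow> bool"

definition forced :: "'p::preorder fm \<Rightarrow> bool"
  where "forced \<phi> \<longleftrightarrow> (\<forall>p. \<phi> p)"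

text \<open>\<open>fgnd b\<close> is an absolute statement \<open>b\<close> about elements of \<open>V\<close>.\<close>

definition fgnd :: "bool \<Rightarrow> 'p::preorder fm"
  where "fgnd b = (\<lambda>p. b)"

definition fnot :: "'p::preorder fm \<Rightarrow> 'p fm"  (\<open>\<^bold>\<not> _\<close> [40] 40)
  where "(\<^bold>\<not> \<phi>) = (\<lambda>p. \<forall>q\<le>p. \<not> \<phi> q)"

definition fand :: "'p::preorder fm \<Rightarrow> 'p fm \<Rightarrow> 'p fm"  (infixr \<open>\<^bold>\<and>\<close> 35)
  where "(\<phi> \<^bold>\<and> \<psi>) = (\<lambda>p. \<phi> p \<and> \<psi> p)"

definition fdisj :: "'p::preorder fm \<Rightarrow> 'p fm \<Rightarrow> 'p fm"  (infixr \<open>\<^bold>\<or>\<close> 30)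
  where "(\<phi> \<^bold>\<or> \<psi>) = (\<lambda>p. \<forall>q\<le>p. \<exists>r\<le>q. \<phi> r \<or> \<psi> r)"

definition fimp :: "'p::preorder fm \<Rightarrow> 'p fm \<Rightarrow> 'p fm"  (infixr \<open>\<^bold>\<longrightarrow>\<close> 25)
  where "(\<phi> \<^bold>\<longrightarrow> \<psi>) = (\<lambda>p. \<forall>q\<le>p. \<phi> q \<longrightarrow> \<psi> q)"

definition fiff :: "'p::preorder fm \<Rightarrow> 'p fm \<Rightarrow> 'p fm"  (infixr \<open>\<^bold>\<longleftrightarrow>\<close> 25)
  where "(\<phi> \<^bold>\<longleftrightarrow> \<psi>) = ((\<phi> \<^bold>\<longrightarrow> \<psi>) \<^bold>\<and> (\<psi> \<^bold>\<longrightarrow> \<phi>))"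

definition fall :: "('x \<Rightarrow> 'p::preorder fm) \<Rightarrow> 'p fm"  (binder \<open>\<^bold>\<forall>\<close> 10)
  where "(\<^bold>\<forall>x. \<phi> x) = (\<lambda>p. \<forall>x. \<phi> x p)"

definition fex :: "('x \<Rightarrow> 'p::preorder fm) \<Rightarrow> 'p fm"  (binder \<open>\<^bold>\<exists>\<close> 10)
  where "(\<^bold>\<exists>x. \<phi> x) = (\<lambda>p. \<forall>q\<le>p. \<exists>r\<le>q. \<exists>x. \<phi> x r)"

section \<open>Names\<close>

text \<open>
  An element of \<open>('x, 'p) nm\<close> is a name for a subset of a set of \<open>V[G]\<close> whose elements are denoted
  by the elements of \<open>'x\<close>. If \<open>'x\<close> is a type of ground model objects, these are the names for subsets
  of the check name of \<open>'x\<close>; if \<open>'x\<close> is itself a type of names, they are names for sets of such sets.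
  Every element of \<open>V[G]\<close> of the corresponding type has a name of this form. The argument \<open>eq\<close> is
  forced equality of elements.

  By the maximum principle, a function of \<open>V[G]\<close> whose domain is a ground model set is denoted by a
  HOL function into names, and a function of \<open>V[G]\<close> on a set of named objects by a HOL function
  from names to names which is forced to respect equality. Likewise finite and infinite sequences of
  elements of \<open>V[G]\<close> are denoted by lists and by \<open>nat\<close>-sequences of names.
\<close>

type_synonym ('x, 'p) nm = "('x \<times> 'p) set"

definition mem_by :: "('x \<Rightarrow> 'x \<Rightarrow> 'p::preorder fm) \<Rightarrow> 'x \<Rightarrow> ('x, 'p) nm \<Rightarrow> 'p fm"
  where "mem_by eq x T = (\<lambda>p. \<forall>q\<le>p. \<exists>r\<le>q. \<exists>(y, s)\<in>T. r \<le> s \<and> eq x y r)"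

definition eq_by :: "('x \<Rightarrow> 'x \<Rightarrow> 'p::preorder fm) \<Rightarrow> ('x, 'p) nm \<Rightarrow> ('x, 'p) nm \<Rightarrow> 'p fm"
  where "eq_by eq S T = (\<^bold>\<forall>x. mem_by eq x S \<^bold>\<longleftrightarrow> mem_by eq x T)"

definition compr :: "('x \<Rightarrow> 'p::preorder fm) \<Rightarrow> ('x, 'p) nm"
  where "compr \<phi> = {(x, p). \<phi> x p}"

abbreviation mem0 :: "'x \<Rightarrow> ('x, 'p::preorder) nm \<Rightarrow> 'p fm"  (infix \<open>\<in>\<^sub>0\<close> 50)
  where "x \<in>\<^sub>0 S \<equiv> mem_by (\<lambda>x y. fgnd (x = y)) x S"

abbreviation eq0 :: "('x, 'p::preorder) nm \<Rightarrow> ('x, 'p) nm \<Rightarrow> 'p fm"  (infix \<open>=\<^sub>0\<close> 50)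
  where "S =\<^sub>0 T \<equiv> eq_by (\<lambda>x y. fgnd (x = y)) S T"

abbreviation mem1 :: "('x, 'p::preorder) nm \<Rightarrow> (('x, 'p) nm, 'p) nm \<Rightarrow> 'p fm"  (infix \<open>\<in>\<^sub>1\<close> 50)
  where "x \<in>\<^sub>1 S \<equiv> mem_by (=\<^sub>0) x S"

abbreviation eq1 :: "(('x, 'p::preorder) nm, 'p) nm \<Rightarrow> (('x, 'p) nm, 'p) nm \<Rightarrow> 'p fm"  (infix \<open>=\<^sub>1\<close> 50)
  where "S =\<^sub>1 T \<equiv> eq_by (=\<^sub>0) S T"

abbreviation mem2 :: "(('x, 'p::preorder) nm, 'p) nm \<Rightarrow> ((('x, 'p) nm, 'p) nm, 'p) nm \<Rightarrow> 'p fm"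
    (infix \<open>\<in>\<^sub>2\<close> 50)
  where "S \<in>\<^sub>2 F \<equiv> mem_by (=\<^sub>1) S F"

definition sub1 :: "(('x, 'p::preorder) nm, 'p) nm \<Rightarrow> (('x, 'p) nm, 'p) nm \<Rightarrow> 'p fm"  (infix \<open>\<subseteq>\<^sub>1\<close> 50)
  where "S \<subseteq>\<^sub>1 T = (\<^bold>\<forall>x. x \<in>\<^sub>1 S \<^bold>\<longrightarrow> x \<in>\<^sub>1 T)"

definition diff1 :: "(('x, 'p::preorder) nm, 'p) nm \<Rightarrow> (('x, 'p) nm, 'p) nm \<Rightarrow> (('x, 'p) nm, 'p) nm"
  where "diff1 S T = compr (\<lambda>x. x \<in>\<^sub>1 S \<^bold>\<and> (\<^bold>\<not> x \<in>\<^sub>1 T))"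

definition Union1 :: "(nat \<Rightarrow> (('x, 'p::preorder) nm, 'p) nm) \<Rightarrow> (('x, 'p) nm, 'p) nm"
  where "Union1 S = compr (\<lambda>x. \<^bold>\<exists>n. x \<in>\<^sub>1 S n)"

definition disj1 :: "(('x, 'p::preorder) nm, 'p) nm \<Rightarrow> (('x, 'p) nm, 'p) nm \<Rightarrow> 'p fm"
  where "disj1 S T = (\<^bold>\<not> (\<^bold>\<exists>x. x \<in>\<^sub>1 S \<^bold>\<and> x \<in>\<^sub>1 T))"

section \<open>Random reals\<close>

text \<open>
  Codes for the Borel subsets of the Cantor space, their interpretation \<open>bset\<close> in \<open>V\<close> and their
  reinterpretation \<open>in_code\<close> in \<open>V[G]\<close>; points of the Cantor space of \<open>V[G]\<close> are identified with
  subsets of the natural numbers.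
\<close>

datatype bcode = Cyl nat | Compl bcode | CUnion "nat \<Rightarrow> bcode"

primrec bset :: "bcode \<Rightarrow> (nat \<Rightarrow> bool) set" where
  "bset (Cyl n) = {s. s n}"
| "bset (Compl c) = - bset c"
| "bset (CUnion F) = (\<Union>n. bset (F n))"

primrec in_code :: "(nat, 'p::preorder) nm \<Rightarrow> bcode \<Rightarrow> 'p fm" where
  "in_code r (Cyl n) = (n \<in>\<^sub>0 r)"
| "in_code r (Compl c) = (\<^bold>\<not> in_code r c)"
| "in_code r (CUnion F) = (\<^bold>\<exists>n. in_code r (F n))"

definition cantor_measure :: "(nat \<Rightarrow> bool) measure"
  where "cantor_measure = PiM UNIV (\<lambda>_. measure_pmf (bernoulli_pmf (1/2)))"

definition random_over_V :: "(nat, 'p::preorder) nm \<Rightarrow> 'p fm"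
  where "random_over_V r =
    (\<^bold>\<forall>c. fgnd (bset c \<in> null_sets cantor_measure) \<^bold>\<longrightarrow> (\<^bold>\<not> in_code r c))"

definition adds_random_real :: "'p::preorder itself \<Rightarrow> bool"
  where "adds_random_real _ \<longleftrightarrow> forced (\<^bold>\<exists>r :: (nat, 'p) nm. random_over_V r)"

lemma range_bset: "range bset = sets cantor_measure"
proof
  have sp: "space cantor_measure = UNIV"
    by (simp add: cantor_measure_def space_PiM)
  have cyl: "{s. s n} \<in> sets cantor_measure" for n
  proof -
    have "(\<lambda>s. s n) -` {True} \<inter> space cantor_measure \<in> sets cantor_measure"
      unfolding cantor_measure_def
      by (rule measurable_sets[OF measurable_component_singleton]) auto
    moreover have "(\<lambda>s. s n) -` {True} \<inter> space cantor_measure = {s. s n}"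
      using sp by auto
    ultimately show ?thesis by simp
  qed
  have "bset c \<in> sets cantor_measure" for c
  proof (induction c)
    case (Compl c)
    then show ?case using sets.compl_sets[OF Compl] sp by (simp add: Compl_eq_Diff_UNIV)
  qed (auto simp: cyl intro: sets.countable_UN)
  then show "range bset \<subseteq> sets cantor_measure" by auto
next
  have un: "(\<Union>n. A n) \<in> range bset" if "\<And>n::nat. A n \<in> range bset" for A
  proof -
    have "\<forall>n. \<exists>c. A n = bset c" using that by auto
    then obtain F where "\<And>n. A n = bset (F n)" by metis
    then have "(\<Union>n. A n) = bset (CUnion F)" by simp
    then show ?thesis by (rule range_eqI)
  qed
  have co: "UNIV - A \<in> range bset" if A: "A \<in> range bset" for A
  proof -
    from A obtain c where "A = bset c" by blast
    then have "UNIV - A = bset (Compl c)" by auto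
    then show ?thesis by (rule range_eqI)
  qed
  have em: "{} \<in> range bset"
  proof -
    let ?c = "CUnion (\<lambda>n. if n = 0 then Cyl 0 else Compl (Cyl 0))"
    have "s \<in> bset ?c" for s
    proof (cases "s 0")
      case True
      then have "s \<in> bset (if (0::nat) = 0 then Cyl 0 else Compl (Cyl 0))" by simp
      then show ?thesis unfolding bset.simps by (rule UN_I[OF UNIV_I])
    next
      case False
      then have "s \<in> bset (if (1::nat) = 0 then Cyl 0 else Compl (Cyl 0))" by simp
      then show ?thesis unfolding bset.simps by (rule UN_I[OF UNIV_I])
    qed
    then have "bset ?c = UNIV" by blast
    then have "{} = bset (Compl ?c)" unfolding bset.simps(2) by (simp only: Compl_UNIV_eq)
    then show ?thesis by (rule range_eqI)
  qed
  have "sigma_algebra UNIV (range bset)"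
    unfolding sigma_algebra_iff2 
  proof (intro conjI ballI allI impI)
    fix A :: "nat \<Rightarrow> (nat \<Rightarrow> bool) set" assume "range A \<subseteq> range bset"
    then show "(\<Union>i. A i) \<in> range bset" by (intro un) blast
  next
    show "UNIV - A \<in> range bset" if "A \<in> range bset" for A
      using that by (rule co)
  qed (use em in simp_all)
  then have sa: "sigma_sets UNIV (range bset) = range bset"
    by (rule sigma_algebra.sigma_sets_eq)
  have S: "sets cantor_measure = sigma_sets UNIV {{f. f i \<in> A} |i A. True}"
    by (simp add: cantor_measure_def sets_PiM_single)
  have "{f. f i \<in> A} \<in> range bset" for i and A :: "bool set"
  proof -
    consider "A = {}" | "A = {True}" | "A = {False}" | "A = UNIV"
    proof -
      have "A \<in> Pow {False, True}" using UNIV_bool by auto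
      then have "A = {} \<or> A = {True} \<or> A = {False} \<or> A = UNIV"
        unfolding UNIV_bool by (simp add: Pow_insert) blast
      then show ?thesis using that by blast
    qed
    then show ?thesis
    proof cases
      case 1 then show ?thesis using em by simp
    next
      case 2
      then have "{f. f i \<in> A} = bset (Cyl i)" by auto
      then show ?thesis by (rule range_eqI)
    next
      case 3
      then have "{f. f i \<in> A} = bset (Compl (Cyl i))" by auto
      then show ?thesis by (rule range_eqI)
    next
      case 4 then show ?thesis using co[OF em] by simp
    qed
  qed
  then have "{{f. f i \<in> A} |i A. True} \<subseteq> range bset" by blast
  then show "sets cantor_measure \<subseteq> range bset"
    unfolding S by (subst sa[symmetric]) (rule sigma_sets_mono')
qed

section \<open>Real numbers in the extension\<close>

text \<open>The reals of \<open>V[G]\<close> are the lower Dedekind cuts of rationals without largest element.\<close>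

type_synonym 'p rnm = "(rat, 'p) nm"

definition is_real :: "'p::preorder rnm \<Rightarrow> 'p fm"
  where "is_real x =
    ((\<^bold>\<exists>q. q \<in>\<^sub>0 x) \<^bold>\<and> (\<^bold>\<exists>q. \<^bold>\<not> q \<in>\<^sub>0 x) \<^bold>\<and>
     (\<^bold>\<forall>q s. fgnd (s < q) \<^bold>\<and> q \<in>\<^sub>0 x \<^bold>\<longrightarrow> s \<in>\<^sub>0 x) \<^bold>\<and>
     (\<^bold>\<forall>q. q \<in>\<^sub>0 x \<^bold>\<longrightarrow> (\<^bold>\<exists>s. fgnd (q < s) \<^bold>\<and> s \<in>\<^sub>0 x)))"

definition rrat :: "rat \<Rightarrow> 'p::preorder rnm"
  where "rrat c = compr (\<lambda>q. fgnd (q < c))"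

definition rle :: "'p::preorder rnm \<Rightarrow> 'p rnm \<Rightarrow> 'p fm"
  where "rle x y = (\<^bold>\<forall>q. q \<in>\<^sub>0 x \<^bold>\<longrightarrow> q \<in>\<^sub>0 y)"

definition radd :: "'p::preorder rnm \<Rightarrow> 'p rnm \<Rightarrow> 'p rnm"
  where "radd x y = compr (\<lambda>q. \<^bold>\<exists>a b. a \<in>\<^sub>0 x \<^bold>\<and> b \<in>\<^sub>0 y \<^bold>\<and> fgnd (q = a + b))"

definition rneg :: "'p::preorder rnm \<Rightarrow> 'p rnm"
  where "rneg x = compr (\<lambda>q. \<^bold>\<exists>s. fgnd (q < s) \<^bold>\<and> (\<^bold>\<not> (- s) \<in>\<^sub>0 x))"

definition rabs :: "'p::preorder rnm \<Rightarrow> 'p rnm"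
  where "rabs x = compr (\<lambda>q. q \<in>\<^sub>0 x \<^bold>\<or> q \<in>\<^sub>0 rneg x)"

definition rscale :: "rat \<Rightarrow> 'p::preorder rnm \<Rightarrow> 'p rnm"
  where "rscale c x =
    (if c > 0 then compr (\<lambda>q. (q / c) \<in>\<^sub>0 x)
     else if c < 0 then compr (\<lambda>q. (q / (- c)) \<in>\<^sub>0 rneg x)
     else rrat 0)"

definition rsum :: "'p::preorder rnm list \<Rightarrow> 'p rnm"
  where "rsum xs = foldr radd xs (rrat 0)"

definition rdist_le :: "'p::preorder rnm \<Rightarrow> 'p rnm \<Rightarrow> rat \<Rightarrow> 'p fm"
  where "rdist_le x y e = rle (rabs (radd x (rneg y))) (rrat e)"

definition rlim :: "(nat \<Rightarrow> 'p::preorder rnm) \<Rightarrow> 'p rnm \<Rightarrow> 'p fm"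
  where "rlim u l =
    (\<^bold>\<forall>e. fgnd (0 < e) \<^bold>\<longrightarrow> (\<^bold>\<exists>N. \<^bold>\<forall>n. fgnd (N \<le> n) \<^bold>\<longrightarrow> rdist_le (u n) l e))"

section \<open>The Stone space in the extension\<close>

text \<open>
  The ground model Boolean algebra is a type \<open>'a\<close>. Points of its Stone space in \<open>V[G]\<close> are the
  ultrafilters of \<open>V[G]\<close> on it.
\<close>

type_synonym ('a, 'p) pnm = "('a, 'p) nm"
type_synonym ('a, 'p) psnm = "(('a, 'p) nm, 'p) nm"
type_synonym ('a, 'p) pfnm = "((('a, 'p) nm, 'p) nm, 'p) nm"

definition is_ultrafilter :: "('a::boolean_algebra, 'p::preorder) pnm \<Rightarrow> 'p fm"
  where "is_ultrafilter x =
    ((\<^bold>\<not> bot \<in>\<^sub>0 x) \<^bold>\<and>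
     (\<^bold>\<forall>a b. a \<in>\<^sub>0 x \<^bold>\<and> b \<in>\<^sub>0 x \<^bold>\<longrightarrow> inf a b \<in>\<^sub>0 x) \<^bold>\<and>
     (\<^bold>\<forall>a b. fgnd (a \<le> b) \<^bold>\<and> a \<in>\<^sub>0 x \<^bold>\<longrightarrow> b \<in>\<^sub>0 x) \<^bold>\<and>
     (\<^bold>\<forall>a. a \<in>\<^sub>0 x \<^bold>\<or> (- a) \<in>\<^sub>0 x))"

definition stone :: "('a::boolean_algebra, 'p::preorder) psnm"
  where "stone = compr is_ultrafilter"

definition clop :: "'a::boolean_algebra \<Rightarrow> ('a, 'p::preorder) psnm"
  where "clop a = compr (\<lambda>x. is_ultrafilter x \<^bold>\<and> a \<in>\<^sub>0 x)"

definition is_open :: "('a::boolean_algebra, 'p::preorder) psnm \<Rightarrow> 'p fm"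
  where "is_open S = (S \<subseteq>\<^sub>1 stone \<^bold>\<and> (\<^bold>\<forall>x. x \<in>\<^sub>1 S \<^bold>\<longrightarrow> (\<^bold>\<exists>a. x \<in>\<^sub>1 clop a \<^bold>\<and> clop a \<subseteq>\<^sub>1 S)))"

definition is_closed :: "('a::boolean_algebra, 'p::preorder) psnm \<Rightarrow> 'p fm"
  where "is_closed S = (S \<subseteq>\<^sub>1 stone \<^bold>\<and> is_open (diff1 stone S))"

definition is_sigma_algebra :: "('a::boolean_algebra, 'p::preorder) pfnm \<Rightarrow> 'p fm"
  where "is_sigma_algebra F =
    ((\<^bold>\<forall>S. S \<in>\<^sub>2 F \<^bold>\<longrightarrow> S \<subseteq>\<^sub>1 stone) \<^bold>\<and> stone \<in>\<^sub>2 F \<^bold>\<and>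
     (\<^bold>\<forall>S. S \<in>\<^sub>2 F \<^bold>\<longrightarrow> diff1 stone S \<in>\<^sub>2 F) \<^bold>\<and>
     (\<^bold>\<forall>S. (\<^bold>\<forall>n. S n \<in>\<^sub>2 F) \<^bold>\<longrightarrow> Union1 S \<in>\<^sub>2 F))"

definition is_borel :: "('a::boolean_algebra, 'p::preorder) psnm \<Rightarrow> 'p fm"
  where "is_borel B =
    (\<^bold>\<forall>F. is_sigma_algebra F \<^bold>\<and> (\<^bold>\<forall>S. is_open S \<^bold>\<longrightarrow> S \<in>\<^sub>2 F) \<^bold>\<longrightarrow> B \<in>\<^sub>2 F)"

definition is_continuous :: "(('a::boolean_algebra, 'p::preorder) pnm \<Rightarrow> 'p rnm) \<Rightarrow> 'p fm"
  where "is_continuous f =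
    ((\<^bold>\<forall>x. x \<in>\<^sub>1 stone \<^bold>\<longrightarrow> is_real (f x)) \<^bold>\<and>
     (\<^bold>\<forall>x y. x \<in>\<^sub>1 stone \<^bold>\<and> x =\<^sub>0 y \<^bold>\<longrightarrow> f x =\<^sub>0 f y) \<^bold>\<and>
     (\<^bold>\<forall>x e. x \<in>\<^sub>1 stone \<^bold>\<and> fgnd (0 < e) \<^bold>\<longrightarrow>
        (\<^bold>\<exists>S. is_open S \<^bold>\<and> x \<in>\<^sub>1 S \<^bold>\<and> (\<^bold>\<forall>y. y \<in>\<^sub>1 S \<^bold>\<longrightarrow> rdist_le (f y) (f x) e))))"

section \<open>Measures in the extension\<close>

definition is_measure :: "('a::boolean_algebra \<Rightarrow> 'p::preorder rnm) \<Rightarrow> 'p fm"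
  where "is_measure \<mu> =
    ((\<^bold>\<forall>a. is_real (\<mu> a)) \<^bold>\<and>
     (\<^bold>\<forall>a b. fgnd (inf a b = bot) \<^bold>\<longrightarrow> \<mu> (sup a b) =\<^sub>0 radd (\<mu> a) (\<mu> b)) \<^bold>\<and>
     (\<^bold>\<exists>C. \<^bold>\<forall>as. fgnd (\<forall>i<length as. \<forall>j<i. inf (as ! i) (as ! j) = bot) \<^bold>\<longrightarrow>
        rle (rsum (map (\<lambda>a. rabs (\<mu> a)) as)) (rrat C)))"

definition borel_family :: "('a::boolean_algebra, 'p::preorder) psnm list \<Rightarrow> 'p fm"
  where "borel_family Bs =
    ((\<^bold>\<forall>i. fgnd (i < length Bs) \<^bold>\<longrightarrow> is_borel (Bs ! i)) \<^bold>\<and>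
     (\<^bold>\<forall>i j. fgnd (i < length Bs \<and> j < i) \<^bold>\<longrightarrow> disj1 (Bs ! i) (Bs ! j)))"

text \<open>\<open>var_le \<nu> D c\<close>: the total variation of \<open>\<nu>\<close> on \<open>D\<close> is at most \<open>c\<close>.\<close>

definition var_le :: "(('a::boolean_algebra, 'p::preorder) psnm \<Rightarrow> 'p rnm) \<Rightarrow> ('a, 'p) psnm \<Rightarrow> rat \<Rightarrow> 'p fm"
  where "var_le \<nu> D c =
    (\<^bold>\<forall>Bs. borel_family Bs \<^bold>\<and> (\<^bold>\<forall>i. fgnd (i < length Bs) \<^bold>\<longrightarrow> Bs ! i \<subseteq>\<^sub>1 D) \<^bold>\<longrightarrow>
       rle (rsum (map (\<lambda>B. rabs (\<nu> B)) Bs)) (rrat c))"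

text \<open>
  Signed Radon measures: real-valued countably additive functions on the Borel sets whose variation is
  inner regular with respect to compact sets. As the Stone space is compact and Hausdorff, its compact
  subsets are the closed ones.
\<close>

definition is_radon :: "(('a::boolean_algebra, 'p::preorder) psnm \<Rightarrow> 'p rnm) \<Rightarrow> 'p fm"
  where "is_radon \<nu> =
    ((\<^bold>\<forall>B. is_borel B \<^bold>\<longrightarrow> is_real (\<nu> B)) \<^bold>\<and>
     (\<^bold>\<forall>B C. is_borel B \<^bold>\<and> B =\<^sub>1 C \<^bold>\<longrightarrow> \<nu> B =\<^sub>0 \<nu> C) \<^bold>\<and>
     (\<^bold>\<forall>B. (\<^bold>\<forall>n. is_borel (B n)) \<^bold>\<and> (\<^bold>\<forall>m n. fgnd (m < n) \<^bold>\<longrightarrow> disj1 (B m) (B n)) \<^bold>\<longrightarrow>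
        rlim (\<lambda>n. rsum (map (\<lambda>i. \<nu> (B i)) [0..<n])) (\<nu> (Union1 B))) \<^bold>\<and>
     (\<^bold>\<forall>B e. is_borel B \<^bold>\<and> fgnd (0 < e) \<^bold>\<longrightarrow>
        (\<^bold>\<exists>K. is_closed K \<^bold>\<and> K \<subseteq>\<^sub>1 B \<^bold>\<and> var_le \<nu> (diff1 B K) e)))"

text \<open>\<open>radon_extension \<mu> \<nu>\<close>: \<open>\<nu>\<close> is the (unique) signed Radon measure extending \<open>\<mu>\<close>.\<close>

definition radon_extension ::
    "('a::boolean_algebra \<Rightarrow> 'p::preorder rnm) \<Rightarrow> (('a, 'p) psnm \<Rightarrow> 'p rnm) \<Rightarrow> 'p fm"
  where "radon_extension \<mu> \<nu> = (is_radon \<nu> \<^bold>\<and> (\<^bold>\<forall>a. \<nu> (clop a) =\<^sub>0 \<mu> a))"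

text \<open>
  \<open>has_int \<nu> f I\<close>: \<open>I\<close> is the integral of the bounded Borel function \<open>f\<close> with respect to \<open>\<nu>\<close>, i.e.
  the limit of the integrals of Borel simple functions (with rational values) converging uniformly
  to \<open>f\<close>. The list \<open>zs\<close> consists of the values of a simple function and the sets where they are taken.
\<close>

definition has_int ::
    "(('a::boolean_algebra, 'p::preorder) psnm \<Rightarrow> 'p rnm) \<Rightarrow> (('a, 'p) pnm \<Rightarrow> 'p rnm) \<Rightarrow> 'p rnm \<Rightarrow> 'p fm"
  where "has_int \<nu> f I =
    (is_real I \<^bold>\<and>
     (\<^bold>\<forall>e. fgnd (0 < e) \<^bold>\<longrightarrow>
       (\<^bold>\<exists>zs. borel_family (map snd zs) \<^bold>\<and>
          (\<^bold>\<forall>x. x \<in>\<^sub>1 stone \<^bold>\<longrightarrow> (\<^bold>\<exists>i. fgnd (i < length zs) \<^bold>\<and> x \<in>\<^sub>1 snd (zs ! i))) \<^bold>\<and>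
          (\<^bold>\<forall>i x. fgnd (i < length zs) \<^bold>\<and> x \<in>\<^sub>1 snd (zs ! i) \<^bold>\<longrightarrow> rdist_le (f x) (rrat (fst (zs ! i))) e) \<^bold>\<and>
          rdist_le I (rsum (map (\<lambda>(c, B). rscale c (\<nu> B)) zs)) e)))"

definition pointwise_null :: "(nat \<Rightarrow> 'a::boolean_algebra \<Rightarrow> 'p::preorder rnm) \<Rightarrow> 'p fm"
  where "pointwise_null \<mu> = (\<^bold>\<forall>a. rlim (\<lambda>n. \<mu> n a) (rrat 0))"

definition weak_star_null :: "(nat \<Rightarrow> 'a::boolean_algebra \<Rightarrow> 'p::preorder rnm) \<Rightarrow> 'p fm"
  where "weak_star_null \<mu> =
    (\<^bold>\<forall>\<nu> f I. (\<^bold>\<forall>n. radon_extension (\<mu> n) (\<nu> n)) \<^bold>\<and> is_continuous f \<^bold>\<and> (\<^bold>\<forall>n. has_int (\<nu> n) f (I n)) \<^bold>\<longrightarrow>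
       rlim I (rrat 0))"

definition weakly_null :: "(nat \<Rightarrow> 'a::boolean_algebra \<Rightarrow> 'p::preorder rnm) \<Rightarrow> 'p fm"
  where "weakly_null \<mu> =
    (\<^bold>\<forall>\<nu> B. (\<^bold>\<forall>n. radon_extension (\<mu> n) (\<nu> n)) \<^bold>\<and> is_borel B \<^bold>\<longrightarrow> rlim (\<lambda>n. \<nu> n B) (rrat 0))"

definition nikodym :: "'a::boolean_algebra itself \<Rightarrow> 'p::preorder fm"
  where "nikodym _ =
    (\<^bold>\<forall>\<mu> :: nat \<Rightarrow> 'a \<Rightarrow> 'p rnm.
       (\<^bold>\<forall>n. is_measure (\<mu> n)) \<^bold>\<and> pointwise_null \<mu> \<^bold>\<longrightarrow> weak_star_null \<mu>)"

definition grothendieck :: "'a::boolean_algebra itself \<Rightarrow> 'p::preorder fm"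
  where "grothendieck _ =
    (\<^bold>\<forall>\<mu> :: nat \<Rightarrow> 'a \<Rightarrow> 'p rnm.
       (\<^bold>\<forall>n. is_measure (\<mu> n)) \<^bold>\<and> weak_star_null \<mu> \<^bold>\<longrightarrow> weakly_null \<mu>)"

end

theory Submission
  imports Defs
begin

text \<open>
  Fix pairwise disjoint elements \<open>A i\<close> of the algebra and ground model ultrafilters \<open>U i\<close> containing
  them, and let \<open>\<epsilon>\<^sub>i\<close> be the signs given by the digits of the random real. For disjoint blocks of
  \<open>16 ^ k\<close> indices and weights \<open>w\<^sub>k\<close> consider \<open>\<mu>\<^sub>k = w\<^sub>k * (\<Sum>i. \<epsilon>\<^sub>i * \<delta>\<^sub>i)\<close>, the sum taken over the \<open>k\<close>-th
  block and \<open>\<delta>\<^sub>i\<close> being the point mass at \<open>U i\<close>. For a bounded ground model sequence \<open>b\<close>, Chebyshev's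
  inequality and the Borel-Cantelli lemma in \<open>V\<close> show that \<open>w\<^sub>k * (\<Sum>i. \<epsilon>\<^sub>i * b\<^sub>i)\<close> tends to \<open>0\<close> for almost
  all choices of signs, hence for the random one; so \<open>\<mu>\<close> is pointwise null.

  With \<open>w\<^sub>k = 1 / 8 ^ k\<close>, the continuous function with value \<open>\<epsilon>\<^sub>i / 2 ^ k\<close> on \<open>A i\<close> for \<open>i\<close> in the \<open>k\<close>-th
  block, and \<open>0\<close> elsewhere, has \<open>\<mu>\<^sub>k\<close>-integral \<open>1\<close> for all \<open>k\<close>: the Nikodym property fails. With
  \<open>w\<^sub>k = 1 / 16 ^ k\<close> the norms are bounded, so \<open>\<mu>\<close> is even weak* null, but the measures of the open set
  given by the \<open>A i\<close> with \<open>\<epsilon>\<^sub>i = 1\<close> tend to \<open>1/2\<close>: the Grothendieck property fails.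
\<close>

section \<open>Forcing calculus\<close>

text \<open>The random real avoids only null sets coded in V, whereas weak* nullness concerns
  continuous functions and Radon measures of V[G]. Two facts bridge the gap. By compactness of the
  Stone space in V[G], a continuous function is, below a stronger condition and up to a given error,
  constant on each of finitely many covering algebra elements; these and the \<open>U i\<close> lie
  in V, so its values at the points become a bounded ground model sequence. And since the
  definitions quantify over all Radon extensions, proving weak* nullness in the Grothendieck half
  requires uniqueness of the extension; for the refutations it suffices to exhibit
  \<open>nu\<close>. The constants meet three demands. Squared weight times block size is summable:
  \<open>1 / 4 ^ k\<close> for weight \<open>1 / 8 ^ k\<close>, and \<open>1 / 16 ^ k\<close> for
  weight \<open>1 / 16 ^ k\<close>. Weight times block size times the coefficient
  \<open>1 / 2 ^ k\<close> is 1 in the first case, as \<open>16 = 8 * 2\<close>. Weight times block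
  size is 1 in the second case. A condition can be strengthened to decide any finite number of
  signs, but in general not infinitely many. Hence the finite blocks, and the treatment of real
  names through rational approximations that conditions decide.\<close>

definition down :: "'p::preorder fm \<Rightarrow> bool"
  where "down \<phi> \<longleftrightarrow> (\<forall>p q. q \<le> p \<longrightarrow> \<phi> p \<longrightarrow> \<phi> q)"

text \<open>These are the regular open sets in the topology of downward closed sets, that is, the
  possible truth values of the forcing language. They support the basic move of the whole proof,
  \<open>reg_dense\<close>: to force a statement at \<open>p\<close>, it suffices to find below each
  \<open>q\<close> under \<open>p\<close> a condition that has decided enough for the statement to
  be forced there.\<close>

definition reg :: "'p::preorder fm \<Rightarrow> bool"
  where "reg \<phi> \<longleftrightarrow> down \<phi> \<and> (\<forall>p. (\<forall>q\<le>p. \<exists>r\<le>q. \<phi> r) \<longrightarrow> \<phi> p)"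

named_theorems reg_intros

lemma downD: "down \<phi> \<Longrightarrow> \<phi> p \<Longrightarrow> q \<le> p \<Longrightarrow> \<phi> q"
  by (auto simp: down_def)

lemma reg_down [reg_intros]: "reg \<phi> \<Longrightarrow> down \<phi>"
  by (simp add: reg_def)

lemma regD: "reg \<phi> \<Longrightarrow> \<phi> p \<Longrightarrow> q \<le> p \<Longrightarrow> \<phi> q"
  by (auto simp: reg_def down_def)

lemma reg_dense: "reg \<phi> \<Longrightarrow> (\<And>q. q \<le> p \<Longrightarrow> \<exists>r\<le>q. \<phi> r) \<Longrightarrow> \<phi> p"
  by (auto simp: reg_def)

lemma regI: "(\<And>p q. q \<le> p \<Longrightarrow> \<phi> p \<Longrightarrow> \<phi> q) \<Longrightarrow> (\<And>p. \<forall>q\<le>p. \<exists>r\<le>q. \<phi> r \<Longrightarrow> \<phi> p) \<Longrightarrow> reg \<phi>"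
  by (auto simp: reg_def down_def)

lemma dense_ex: "\<forall>q\<le>p. \<exists>r\<le>q. P r \<Longrightarrow> \<exists>r\<le>(p::'p::preorder). P r"
  using order_refl by metis

lemma dense_of_down: "down \<phi> \<Longrightarrow> \<phi> p \<Longrightarrow> \<forall>q\<le>p. \<exists>r\<le>q. \<phi> r"
  using order_refl unfolding down_def by meson

text \<open>Being dense below a condition is an idempotent requirement. The clauses for disjunction,
  existence and membership all have this form.\<close>

lemma reg_denseI: "reg (\<lambda>p. \<forall>q\<le>p. \<exists>r\<le>q. P r)"
proof (rule regI)
  show "\<forall>r\<le>q. \<exists>s\<le>r. P s" if "q \<le> p" "\<forall>q\<le>p. \<exists>r\<le>q. P r" for p q :: 'a
    using that order_trans by meson
  show "\<forall>q\<le>p. \<exists>r\<le>q. P r" if "\<forall>q\<le>p. \<exists>r\<le>q. \<forall>s\<le>r. \<exists>t\<le>s. P t" for p :: 'a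
    using that order_trans order_refl by metis
qed

lemma reg_fgnd [reg_intros]: "reg (fgnd b)"
  by (rule regI) (auto simp: fgnd_def)

lemma reg_fnot [reg_intros]: "down \<phi> \<Longrightarrow> reg (\<^bold>\<not> \<phi>)"
  unfolding fnot_def down_def by (rule regI) (meson order_trans order_refl)+

lemma reg_fand [reg_intros]: "reg \<phi> \<Longrightarrow> reg \<psi> \<Longrightarrow> reg (\<phi> \<^bold>\<and> \<psi>)"
  unfolding fand_def
  by (rule regI) (blast intro: regD reg_dense)+

lemma reg_fdisj [reg_intros]: "reg (\<phi> \<^bold>\<or> \<psi>)"
  unfolding fdisj_def by (rule reg_denseI)

lemma reg_fex [reg_intros]: "reg (\<^bold>\<exists>x. \<phi> x)"
  unfolding fex_def by (rule reg_denseI)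

lemma reg_mem_by [reg_intros]: "reg (mem_by eq x T)"
  unfolding mem_by_def by (rule reg_denseI)

lemma reg_fimp [reg_intros]:
  assumes "down \<phi>" "reg \<psi>"
  shows "reg (\<phi> \<^bold>\<longrightarrow> \<psi>)"
proof (rule regI)
  show "(\<phi> \<^bold>\<longrightarrow> \<psi>) q" if "q \<le> p" "(\<phi> \<^bold>\<longrightarrow> \<psi>) p" for p q
    using that order_trans unfolding fimp_def by meson
  show "(\<phi> \<^bold>\<longrightarrow> \<psi>) p" if d: "\<forall>q\<le>p. \<exists>r\<le>q. (\<phi> \<^bold>\<longrightarrow> \<psi>) r" for p
    unfolding fimp_def
  proof (intro allI impI)
    fix q assume q: "q \<le> p" "\<phi> q"
    show "\<psi> q"
    proof (rule reg_dense[OF assms(2)])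
      fix s assume s: "s \<le> q"
      then obtain r where "r \<le> s" "(\<phi> \<^bold>\<longrightarrow> \<psi>) r" using d q order_trans by meson
      then show "\<exists>r\<le>s. \<psi> r"
        using downD[OF assms(1) q(2)] s order_trans order_refl unfolding fimp_def by meson
    qed
  qed
qed

lemma reg_fall [reg_intros]: "(\<And>x. reg (\<phi> x)) \<Longrightarrow> reg (\<^bold>\<forall>x. \<phi> x)"
  unfolding fall_def
  by (rule regI) (blast intro: regD reg_dense)+

lemma reg_fiff [reg_intros]: "reg \<phi> \<Longrightarrow> reg \<psi> \<Longrightarrow> reg (\<phi> \<^bold>\<longleftrightarrow> \<psi>)"
  unfolding fiff_def by (intro reg_intros)

lemma reg_eq_by [reg_intros]: "reg (eq_by eq S T)"
  unfolding eq_by_def by (intro reg_intros)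

lemma fnotD: "(\<^bold>\<not> \<phi>) p \<Longrightarrow> q \<le> p \<Longrightarrow> \<not> \<phi> q"
  by (simp add: fnot_def)

lemma down_fnot: "(\<^bold>\<not> \<phi>) p \<Longrightarrow> q \<le> p \<Longrightarrow> (\<^bold>\<not> \<phi>) q"
  using order_trans unfolding fnot_def by meson

lemma decide: "\<exists>r\<le>p. \<phi> r \<or> (\<^bold>\<not> \<phi>) r"
  unfolding fnot_def using order_refl by blast

lemma not_forcesE:
  assumes "reg \<phi>" "\<not> \<phi> p"
  obtains q where "q \<le> p" "(\<^bold>\<not> \<phi>) q"
  using assms unfolding reg_def fnot_def by blast

text \<open>The indices are treated one after another, and monotonicity preserves what was decided
  earlier. An infinite set of indices would require a limit of conditions, which need not
  exist.\<close>

lemma dense_finite: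
  assumes "finite A" and "\<And>i q. i \<in> A \<Longrightarrow> q \<le> p \<Longrightarrow> \<exists>r\<le>q. P i r"
    and "\<And>i. i \<in> A \<Longrightarrow> down (P i)"
  shows "\<exists>r\<le>(p::'p::preorder). \<forall>i\<in>A. P i r"
  using assms
proof (induction A rule: finite_induct)
  case empty
  then show ?case by auto
next
  case (insert i A)
  then obtain r where r: "r \<le> p" "\<forall>i\<in>A. P i r" by blast
  then obtain s where s: "s \<le> r" "P i s" using insert.prems(1)[of i r] by blast
  have "\<forall>j\<in>A. P j s" using r s insert.prems(2) by (meson downD insertCI)
  then show ?case using r s by (metis insert_iff order_trans)
qed

section \<open>Names\<close>

lemma mem0_iff: "(x \<in>\<^sub>0 T) p \<longleftrightarrow> (\<forall>q\<le>p. \<exists>r\<le>q. \<exists>s. (x, s) \<in> T \<and> r \<le> s)"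
  unfolding mem_by_def fgnd_def by (auto simp: Bex_def)

lemma mem1_iff: "(x \<in>\<^sub>1 T) p \<longleftrightarrow> (\<forall>q\<le>p. \<exists>r\<le>q. \<exists>y s. (y, s) \<in> T \<and> r \<le> s \<and> (x =\<^sub>0 y) r)"
  unfolding mem_by_def by (auto simp: Bex_def)

lemma eq_by_iff: "eq_by eq S T p \<longleftrightarrow> (\<forall>x. \<forall>q\<le>p. mem_by eq x S q \<longleftrightarrow> mem_by eq x T q)"
  unfolding eq_by_def fall_def fiff_def fand_def fimp_def by blast

lemma eq_by_refl: "eq_by eq S S p"
  and eq_by_sym: "eq_by eq S T p \<Longrightarrow> eq_by eq T S p"
  and eq_by_trans: "eq_by eq S T p \<Longrightarrow> eq_by eq T U p \<Longrightarrow> eq_by eq S U p"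
  by (simp_all add: eq_by_iff)

lemma eq_by_mem: "eq_by eq S T p \<Longrightarrow> q \<le> p \<Longrightarrow> mem_by eq x S q \<longleftrightarrow> mem_by eq x T q"
  by (simp add: eq_by_iff)

lemma mem_by_cong:
  assumes "eq_by eq x y p" "mem_by (eq_by eq) x S p"
  shows "mem_by (eq_by eq) y S p"
  unfolding mem_by_def
proof (intro allI impI)
  fix q assume "q \<le> p"
  then obtain r z s where "r \<le> q" "(z, s) \<in> S" "r \<le> s" "eq_by eq x z r"
    using assms(2) unfolding mem_by_def by blast
  moreover have "eq_by eq x y r"
    using assms(1) \<open>q \<le> p\<close> \<open>r \<le> q\<close> order_trans regD[OF reg_eq_by] by meson
  ultimately show "\<exists>r\<le>q. \<exists>(z, s)\<in>S. r \<le> s \<and> eq_by eq y z r"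
    using eq_by_sym eq_by_trans by blast
qed

lemma mem0_compr:
  assumes "reg (\<phi> x)"
  shows "(x \<in>\<^sub>0 compr \<phi>) p \<longleftrightarrow> \<phi> x p"
proof
  assume L: "(x \<in>\<^sub>0 compr \<phi>) p"
  show "\<phi> x p"
    by (rule reg_dense[OF assms]) (use L regD[OF assms] in \<open>fastforce simp: mem0_iff compr_def\<close>)
next
  assume "\<phi> x p"
  then have "\<forall>q\<le>p. \<exists>r\<le>q. \<phi> x r" using assms reg_down dense_of_down by blast
  then show "(x \<in>\<^sub>0 compr \<phi>) p" unfolding mem0_iff compr_def
    using order_refl by fastforce
qed

text \<open>Above the lowest level, membership is up to forced equality of names, so a comprehension
  is faithful only for formulas that do not distinguish names of the same object; this is the second
  hypothesis.\<close>

lemma mem_by_compr: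
  assumes "reg (\<phi> x)" and "\<And>y q. eq_by eq x y q \<Longrightarrow> \<phi> y q \<Longrightarrow> \<phi> x q" and "\<And>y. down (\<phi> y)"
  shows "mem_by (eq_by eq) x (compr \<phi>) p \<longleftrightarrow> \<phi> x p"
proof
  assume L: "mem_by (eq_by eq) x (compr \<phi>) p"
  show "\<phi> x p"
  proof (rule reg_dense[OF assms(1)])
    fix q assume "q \<le> p"
    then obtain r y s where "r \<le> q" "\<phi> y s" "r \<le> s" "eq_by eq x y r"
      using L unfolding mem_by_def compr_def by blast
    then show "\<exists>r\<le>q. \<phi> x r" using assms(2,3) downD by blast
  qed
next
  assume "\<phi> x p"
  then show "mem_by (eq_by eq) x (compr \<phi>) p"
    unfolding mem_by_def compr_def using regD[OF assms(1)] eq_by_refl order_refl by blast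
qed

section \<open>Real numbers in the extension\<close>

lemma mem_rrat [simp]: "(q \<in>\<^sub>0 rrat c) p \<longleftrightarrow> q < c"
  unfolding rrat_def by (subst mem0_compr[OF reg_fgnd]) (simp add: fgnd_def)

text \<open>Each quantifier contributes its own "densely below"; downward closure merges the two
  into one.\<close>

lemma fex2_iff:
  assumes "\<And>a b. down (\<phi> a b)"
  shows "(\<^bold>\<exists>a b. \<phi> a b) p \<longleftrightarrow> (\<forall>r\<le>p. \<exists>s\<le>r. \<exists>a b. \<phi> a b s)"
proof
  assume L: "(\<^bold>\<exists>a b. \<phi> a b) p"
  show "\<forall>r\<le>p. \<exists>s\<le>r. \<exists>a b. \<phi> a b s"
  proof (intro allI impI)
    fix r assume "r \<le> p"
    then obtain s a where s: "s \<le> r" "(\<^bold>\<exists>b. \<phi> a b) s" using L unfolding fex_def[of "\<lambda>a. \<^bold>\<exists>b. \<phi> a b"] by blast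
    then have "\<exists>t\<le>s. \<exists>b. \<phi> a b t" unfolding fex_def by (rule_tac dense_ex)
    then show "\<exists>s\<le>r. \<exists>a b. \<phi> a b s" using s(1) order_trans by meson
  qed
next
  assume R: "\<forall>r\<le>p. \<exists>s\<le>r. \<exists>a b. \<phi> a b s"
  show "(\<^bold>\<exists>a b. \<phi> a b) p"
    unfolding fex_def[of "\<lambda>a. \<^bold>\<exists>b. \<phi> a b"]
  proof (intro allI impI)
    fix r assume "r \<le> p"
    then obtain s a b where s: "s \<le> r" "\<phi> a b s" using R by blast
    then have "(\<^bold>\<exists>b. \<phi> a b) s"
      unfolding fex_def using dense_of_down[OF assms] by blast
    then show "\<exists>s\<le>r. \<exists>a. (\<^bold>\<exists>b. \<phi> a b) s" using s(1) by blast
  qed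
qed

lemma mem_radd: "(q \<in>\<^sub>0 radd x y) p \<longleftrightarrow>
    (\<forall>r\<le>p. \<exists>s\<le>r. \<exists>a b. (a \<in>\<^sub>0 x) s \<and> (b \<in>\<^sub>0 y) s \<and> q = a + b)"
proof -
  have "(q \<in>\<^sub>0 radd x y) p \<longleftrightarrow> (\<^bold>\<exists>a b. a \<in>\<^sub>0 x \<^bold>\<and> b \<in>\<^sub>0 y \<^bold>\<and> fgnd (q = a + b)) p"
    unfolding radd_def by (rule mem0_compr) (rule reg_intros)
  then show ?thesis
    by (subst (asm) fex2_iff) (intro reg_intros, simp add: fand_def fgnd_def)
qed

lemma mem_rneg: "(q \<in>\<^sub>0 rneg x) p \<longleftrightarrow> (\<forall>r\<le>p. \<exists>s\<le>r. \<exists>t>q. (\<^bold>\<not> (- t) \<in>\<^sub>0 x) s)"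
proof -
  have "(q \<in>\<^sub>0 rneg x) p \<longleftrightarrow> (\<^bold>\<exists>s. fgnd (q < s) \<^bold>\<and> (\<^bold>\<not> (- s) \<in>\<^sub>0 x)) p"
    unfolding rneg_def by (rule mem0_compr) (rule reg_intros)
  then show ?thesis unfolding fex_def fand_def fgnd_def by auto
qed

lemma mem_rabs: "(q \<in>\<^sub>0 rabs x) p \<longleftrightarrow> (\<forall>r\<le>p. \<exists>s\<le>r. (q \<in>\<^sub>0 x) s \<or> (q \<in>\<^sub>0 rneg x) s)"
  unfolding rabs_def by (subst mem0_compr[OF reg_fdisj]) (simp add: fdisj_def)

text \<open>\<open>near x c e\<close> forces \<open>\<bar>x - c\<bar> \<le> e\<close>; for \<open>e = 0\<close> it says that the cut \<open>x\<close> is \<open>rrat c\<close>.\<close>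

definition near :: "'p::preorder rnm \<Rightarrow> rat \<Rightarrow> rat \<Rightarrow> 'p fm"
  where "near x c e p \<longleftrightarrow> (\<forall>q<c - e. (q \<in>\<^sub>0 x) p) \<and> (\<forall>q\<ge>c + e. (\<^bold>\<not> q \<in>\<^sub>0 x) p)"

lemma reg_near [reg_intros]: "reg (near x c e)"
proof (rule regI)
  show "near x c e q" if "q \<le> p" "near x c e p" for p q
    using that unfolding near_def by (blast intro: regD[OF reg_mem_by] down_fnot)
  show "near x c e p" if "\<forall>q\<le>p. \<exists>r\<le>q. near x c e r" for p
    using that unfolding near_def
    by (meson reg_dense[OF reg_mem_by] reg_dense[OF reg_fnot[OF reg_down[OF reg_mem_by]]])
qed

lemmas near_down = regD[OF reg_near]

lemma near_rrat [simp]: "near (rrat c) c 0 p"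
  by (auto simp: near_def fnot_def)

lemma near_mono: "near x c e p \<Longrightarrow> \<bar>c - d\<bar> + e \<le> e' \<Longrightarrow> near x d e' p"
  unfolding near_def by (auto simp: abs_le_iff)

text \<open>A rational strictly between two disjoint intervals would be forced both into and out of
  the cut.\<close>

lemma near_dist: "near x c e p \<Longrightarrow> near x d e' p \<Longrightarrow> \<bar>c - d\<bar> \<le> e + e'"
proof (rule ccontr)
  assume n: "near x c e p" "near x d e' p" and "\<not> \<bar>c - d\<bar> \<le> e + e'"
  then consider "c + e < d - e'" | "d + e' < c - e" by (auto simp: abs_le_iff)
  then show False
  proof cases
    case 1
    then show False using n unfolding near_def fnot_def by (meson order_refl)
  next
    case 2
    then show False using n unfolding near_def fnot_def by (meson order_refl)
  qed
qed

text \<open>The upper half uses that a cut has no largest element: if some \<open>q\<close> with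
  \<open>c + e \<le> q\<close> were forced in, so would be a larger \<open>s\<close>, against the
  hypothesis for the error \<open>e + (s - q)\<close>.\<close>

lemma near_closed:
  assumes "\<And>d. d > 0 \<Longrightarrow> near x c (e + d) p" and "is_real x p"
  shows "near x c e p"
  unfolding near_def
proof (intro conjI allI impI)
  fix q assume "q < c - e"
  then have "near x c (e + (c - e - q) / 2) p" "q < c - (e + (c - e - q) / 2)"
    by - (intro assms(1), auto simp: field_simps)
  then show "(q \<in>\<^sub>0 x) p" unfolding near_def by blast
next
  fix q assume q: "c + e \<le> q"
  show "(\<^bold>\<not> q \<in>\<^sub>0 x) p" unfolding fnot_def
  proof (intro allI impI notI)
    fix r assume r: "r \<le> p" "(q \<in>\<^sub>0 x) r"
    then have "(\<^bold>\<exists>s. fgnd (q < s) \<^bold>\<and> s \<in>\<^sub>0 x) r"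
      using assms(2) unfolding is_real_def fand_def fall_def fimp_def by blast
    then obtain s t where t: "t \<le> r" "q < s" "(s \<in>\<^sub>0 x) t"
      unfolding fex_def fand_def fgnd_def using order_refl by blast
    have "near x c (e + (s - q)) p" "c + (e + (s - q)) \<le> s" using assms(1) t q by auto
    then have "(\<^bold>\<not> s \<in>\<^sub>0 x) p" unfolding near_def by blast
    then show False using t r order_trans unfolding fnot_def by meson
  qed
qed

lemma near_radd:
  assumes "near x c e p" "near y d e' p"
  shows "near (radd x y) (c + d) (e + e') p"
  unfolding near_def
proof (intro conjI allI impI)
  fix q assume q: "q < c + d - (e + e')"
  define h where "h = (c + d - (e + e') - q) / 2"
  have h: "h > 0" "q = (c - e - h) + (d - e' - h)" using q by (auto simp: h_def field_simps)
  have "(c - e - h \<in>\<^sub>0 x) p" "(d - e' - h \<in>\<^sub>0 y) p"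
    using assms h unfolding near_def by auto
  then show "(q \<in>\<^sub>0 radd x y) p"
    unfolding mem_radd using h(2) regD[OF reg_mem_by] order_refl by metis
next
  fix q assume q: "c + d + (e + e') \<le> q"
  show "(\<^bold>\<not> q \<in>\<^sub>0 radd x y) p" unfolding fnot_def
  proof (intro allI impI notI)
    fix r assume r: "r \<le> p" "(q \<in>\<^sub>0 radd x y) r"
    then obtain s a b where s: "s \<le> r" "(a \<in>\<^sub>0 x) s" "(b \<in>\<^sub>0 y) s" "q = a + b"
      unfolding mem_radd using order_refl by blast
    have "s \<le> p" using s r order_trans by meson
    then have "\<not> c + e \<le> a" "\<not> d + e' \<le> b"
      using assms s unfolding near_def fnot_def by blast+
    then show False using s(4) q by auto
  qed
qed

lemma near_rneg:
  assumes "near x c e p"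
  shows "near (rneg x) (- c) e p"
  unfolding near_def
proof (intro conjI allI impI)
  fix q assume q: "q < - c - e"
  have "(\<^bold>\<not> (- (- c - e)) \<in>\<^sub>0 x) p" using assms unfolding near_def by auto
  then show "(q \<in>\<^sub>0 rneg x) p"
    unfolding mem_rneg using q down_fnot order_refl by blast
next
  fix q assume q: "- c + e \<le> q"
  show "(\<^bold>\<not> q \<in>\<^sub>0 rneg x) p" unfolding fnot_def
  proof (intro allI impI notI)
    fix r assume r: "r \<le> p" "(q \<in>\<^sub>0 rneg x) r"
    then obtain s t where s: "s \<le> r" "t > q" "(\<^bold>\<not> (- t) \<in>\<^sub>0 x) s"
      unfolding mem_rneg using order_refl by blast
    have "(- t \<in>\<^sub>0 x) p" using assms s q unfolding near_def by auto
    then show False using s r order_trans order_refl regD[OF reg_mem_by] unfolding fnot_def by meson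
  qed
qed

lemma near_rabs:
  assumes "near x c e p"
  shows "near (rabs x) \<bar>c\<bar> e p"
proof -
  note n = assms near_rneg[OF assms]
  show ?thesis unfolding near_def
  proof (intro conjI allI impI)
    fix q assume "q < \<bar>c\<bar> - e"
    then have "(q \<in>\<^sub>0 x) p \<or> (q \<in>\<^sub>0 rneg x) p"
      using n unfolding near_def by (cases "c \<ge> 0") auto
    then show "(q \<in>\<^sub>0 rabs x) p"
      unfolding mem_rabs using regD[OF reg_mem_by] order_refl by meson
  next
    fix q assume q: "\<bar>c\<bar> + e \<le> q"
    then have "(\<^bold>\<not> q \<in>\<^sub>0 x) p" "(\<^bold>\<not> q \<in>\<^sub>0 rneg x) p"
      using n unfolding near_def by auto
    then show "(\<^bold>\<not> q \<in>\<^sub>0 rabs x) p"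
      unfolding fnot_def mem_rabs using order_refl order_trans by metis
  qed
qed

lemma near_rscale:
  assumes "near x c 0 p"
  shows "near (rscale d x) (d * c) 0 p"
proof -
  have pos: "near (compr (\<lambda>q. (q / k) \<in>\<^sub>0 y)) (k * b) 0 p" if "k > 0" "near y b 0 p" for k b y
  proof -
    have "(q \<in>\<^sub>0 compr (\<lambda>q. (q / k) \<in>\<^sub>0 y)) r \<longleftrightarrow> ((q / k) \<in>\<^sub>0 y) r" for q r
      by (rule mem0_compr) (rule reg_intros)
    then show ?thesis using that unfolding near_def fnot_def
      by (auto simp: field_simps)
  qed
  consider "d > 0" | "d < 0" | "d = 0" by linarith
  then show ?thesis
  proof cases
    case 1
    then show ?thesis using pos[OF 1 assms] by (simp add: rscale_def)
  next
    case 2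
    then show ?thesis using pos[of "- d", OF _ near_rneg[OF assms]] by (simp add: rscale_def)
  next
    case 3
    then show ?thesis using near_rrat[of 0] by (simp add: rscale_def)
  qed
qed

lemma near_rsum_err:
  assumes "\<And>i. i < length xs \<Longrightarrow> near (xs ! i) (c i) (e i) p"
  shows "near (rsum xs) (\<Sum>i<length xs. c i) (\<Sum>i<length xs. e i) p"
  using assms
proof (induction xs arbitrary: c e)
  case Nil
  then show ?case using near_rrat[of 0] by (simp add: rsum_def)
next
  case (Cons x xs)
  have "near (rsum xs) (\<Sum>i<length xs. c (Suc i)) (\<Sum>i<length xs. e (Suc i)) p"
    using Cons.prems[of "Suc _"] by (intro Cons.IH) auto
  from near_radd[OF Cons.prems[of 0, simplified] this]
  show ?case by (simp add: rsum_def sum.lessThan_Suc_shift del: sum.lessThan_Suc)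
qed

lemma near_rsum:
  assumes "\<And>i. i < length xs \<Longrightarrow> near (xs ! i) (c i) 0 p"
  shows "near (rsum xs) (\<Sum>i<length xs. c i) 0 p"
  using near_rsum_err[of xs c "\<lambda>_. 0" p] assms by simp

lemma near_eq:
  assumes "near x c 0 p" "near y c 0 p"
  shows "(x =\<^sub>0 y) p"
proof -
  have "(q \<in>\<^sub>0 z) r \<longleftrightarrow> q < c" if "near z c 0 p" "r \<le> p" for q r z
    using that unfolding near_def fnot_def by (cases "q < c") (auto intro: regD[OF reg_mem_by])
  then show ?thesis using assms unfolding eq_by_iff by blast
qed

lemma near_cong:
  assumes "(x =\<^sub>0 y) p" "near x c e p"
  shows "near y c e p"
  using assms order_refl unfolding near_def fnot_def eq_by_iff by metis

lemma rle_iff: "rle x y p \<longleftrightarrow> (\<forall>q. \<forall>r\<le>p. (q \<in>\<^sub>0 x) r \<longrightarrow> (q \<in>\<^sub>0 y) r)"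
  by (simp add: rle_def fall_def fimp_def)

section \<open>Order, distance and limits of real names via rational approximations\<close>

lemma reg_rle [reg_intros]: "reg (rle x y)"
  unfolding rle_def by (intro reg_intros)

lemma reg_rdist_le [reg_intros]: "reg (rdist_le x y e)"
  unfolding rdist_le_def by (intro reg_intros)

lemma reg_is_real [reg_intros]: "reg (is_real x)"
  unfolding is_real_def by (intro reg_intros)

lemma reg_rlim [reg_intros]: "reg (rlim u l)"
  unfolding rlim_def by (intro reg_intros)

lemma near_rleI: "near x c e p \<Longrightarrow> c + e \<le> d \<Longrightarrow> rle x (rrat d) p"
  unfolding near_def rle_iff fnot_def by auto (meson linorder_not_le order_trans)

lemma near_rleD:
  assumes "near x c e p" "rle x (rrat d) p"
  shows "c - e \<le> d"
proof (rule ccontr)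
  assume "\<not> ?thesis"
  then have "(d \<in>\<^sub>0 x) p" using assms unfolding near_def by auto
  then show False using assms unfolding rle_iff by auto
qed

lemma near_is_real:
  assumes "near x c 0 p"
  shows "is_real x p"
proof -
  have *: "(q \<in>\<^sub>0 x) r \<longleftrightarrow> q < c" if "r \<le> p" for q r
    using that assms unfolding near_def fnot_def by (cases "q < c") (auto intro: regD[OF reg_mem_by])
  have "\<forall>q\<le>p. \<exists>r\<le>q. \<exists>q. (q \<in>\<^sub>0 x) r"
    using * lt_ex[of c] order_refl by metis
  moreover have "\<forall>q\<le>p. \<exists>r\<le>q. \<exists>t. (\<^bold>\<not> t \<in>\<^sub>0 x) r"
    using assms unfolding near_def by (metis add.right_neutral down_fnot order_refl)
  moreover have "\<forall>r\<le>q. \<exists>s\<le>r. \<exists>u. t < u \<and> (u \<in>\<^sub>0 x) s" if "q \<le> p" "(t \<in>\<^sub>0 x) q" for q t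
    using that * dense[of t c] order_refl order_trans by metis
  moreover have "(s \<in>\<^sub>0 x) q" if "q \<le> p" "s < t" "(t \<in>\<^sub>0 x) q" for q s t
    using that * by auto
  ultimately show ?thesis
    unfolding is_real_def fand_def fall_def fimp_def fgnd_def fex_def by auto
qed

text \<open>Walk from an element \<open>a\<close> of the cut in steps of length \<open>e\<close>
  towards some \<open>b\<close> outside it. If no condition below \<open>q1\<close> caught a step
  leaving the cut, induction would force every \<open>a + of_nat k * e\<close> into the cut, and
  after finitely many steps also \<open>b\<close>.\<close>

lemma is_real_near:
  assumes "is_real x p" "e > 0"
  shows "\<exists>r\<le>p. \<exists>c. near x c e r"
proof -
  obtain q0 a where q0: "q0 \<le> p" "(a \<in>\<^sub>0 x) q0"
    using assms unfolding is_real_def fand_def fex_def by (meson order_refl)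
  obtain q1 b where q1: "q1 \<le> q0" "(\<^bold>\<not> b \<in>\<^sub>0 x) q1"
    using assms q0(1) unfolding is_real_def fand_def fex_def by (meson order_refl)
  have lower: "(s \<in>\<^sub>0 x) r" if "r \<le> p" "(t \<in>\<^sub>0 x) r" "s \<le> t" for r s t
  proof (cases "s = t")
    case False
    then have "s < t" using that by simp
    moreover have "(\<^bold>\<forall>q s. fgnd (s < q) \<^bold>\<and> q \<in>\<^sub>0 x \<^bold>\<longrightarrow> s \<in>\<^sub>0 x) p"
      using assms(1) unfolding is_real_def fand_def by blast
    ultimately show ?thesis
      using that(1,2) unfolding fand_def fall_def fimp_def fgnd_def by blast
  qed (use that in simp)
  have q1p: "q1 \<le> p" using q0 q1 order_trans by meson
  have a: "(a \<in>\<^sub>0 x) q1" by (rule regD[OF reg_mem_by q0(2) q1(1)])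
  obtain n :: nat where n: "(b - a) / e < of_nat n" using reals_Archimedean2 by blast
  have bn: "b \<le> a + of_nat n * e" using n assms(2) by (simp add: field_simps)
  have "\<exists>r\<le>q1. \<exists>c. (c \<in>\<^sub>0 x) r \<and> (\<^bold>\<not> (c + e) \<in>\<^sub>0 x) r"
  proof (rule ccontr)
    assume no: "\<not> ?thesis"
    have "((a + of_nat k * e) \<in>\<^sub>0 x) q1" for k :: nat
    proof (induction k)
      case (Suc k)
      show ?case
      proof (rule ccontr)
        assume "\<not> ((a + of_nat (Suc k) * e) \<in>\<^sub>0 x) q1"
        then obtain r where "r \<le> q1" "(\<^bold>\<not> (a + of_nat (Suc k) * e) \<in>\<^sub>0 x) r"
          by (rule not_forcesE[OF reg_mem_by])
        moreover have "a + of_nat (Suc k) * e = (a + of_nat k * e) + e" by (simp add: algebra_simps)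
        ultimately show False using no regD[OF reg_mem_by Suc] by metis
      qed
    qed (use a in simp)
    then have "(b \<in>\<^sub>0 x) q1" using lower q1p bn by blast
    then show False using q1 unfolding fnot_def by auto
  qed
  then obtain r c where r: "r \<le> q1" "(c \<in>\<^sub>0 x) r" "(\<^bold>\<not> (c + e) \<in>\<^sub>0 x) r" by blast
  have rp: "r \<le> p" using r q1p order_trans by meson
  have "near x c e r" unfolding near_def
  proof (intro conjI allI impI)
    fix q assume "q < c - e" then show "(q \<in>\<^sub>0 x) r" using lower[OF rp r(2)] assms(2) by simp
  next
    fix q assume "c + e \<le> q"
    then show "(\<^bold>\<not> q \<in>\<^sub>0 x) r"
      using r(3) lower rp order_trans unfolding fnot_def by meson
  qed
  then show ?thesis using rp by blast
qed

lemma near_rdist_leI: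
  assumes "near x c e p" "near y d e' p" "\<bar>c - d\<bar> + e + e' \<le> b"
  shows "rdist_le x y b p"
proof -
  have "near (rabs (radd x (rneg y))) \<bar>c + - d\<bar> (e + e') p"
    by (intro near_rabs near_radd near_rneg assms)
  then show ?thesis unfolding rdist_le_def by (rule near_rleI) (use assms(3) in simp)
qed

lemma rdist_leD:
  assumes "rdist_le x y b p" "near x c e p" "near y d e' p"
  shows "\<bar>c - d\<bar> \<le> b + e + e'"
proof -
  have "near (rabs (radd x (rneg y))) \<bar>c + - d\<bar> (e + e') p"
    by (intro near_rabs near_radd near_rneg assms)
  from near_rleD[OF this assms(1)[unfolded rdist_le_def]] show ?thesis by simp
qed

text \<open>Turns an estimate of a real name into an inequality between rationals: stronger
  conditions supply approximations of \<open>x\<close> with arbitrarily small error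
  \<open>h\<close>, which \<open>near_closed\<close> then removes.\<close>

lemma near_of_approx:
  assumes "is_real x p"
    and "\<And>q c h. q \<le> p \<Longrightarrow> h > 0 \<Longrightarrow> near x c h q \<Longrightarrow> \<bar>c - d\<bar> \<le> e + h"
  shows "near x d e p"
proof (rule near_closed[OF _ assms(1)])
  fix h :: rat assume h: "h > 0"
  show "near x d (e + h) p"
  proof (rule reg_dense[OF reg_near])
    fix q assume q: "q \<le> p"
    then obtain r c where r: "r \<le> q" "near x c (h/2) r"
      using is_real_near[of x q "h/2"] regD[OF reg_is_real assms(1)] h by auto
    have "\<bar>c - d\<bar> \<le> e + h/2" using assms(2)[OF order_trans[OF r(1) q] _ r(2)] h by simp
    then have "near x d (e + h) r" by (intro near_mono[OF r(2)]) simp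
    then show "\<exists>r\<le>q. near x d (e + h) r" using r by blast
  qed
qed

lemma rdist_le_near:
  assumes "rdist_le x y e p" "near y d e' p" "is_real x p"
  shows "near x d (e + e') p"
proof (rule near_of_approx[OF assms(3)])
  fix q c h assume q: "q \<le> p" "near x c h q"
  from rdist_leD[OF regD[OF reg_rdist_le assms(1) q(1)] q(2) near_down[OF assms(2) q(1)]]
  show "\<bar>c - d\<bar> \<le> e + e' + h" by simp
qed

lemma rdist_le_near':
  assumes "rdist_le x y e p" "near x d e' p" "is_real y p"
  shows "near y d (e + e') p"
proof (rule near_of_approx[OF assms(3)])
  fix q c h assume q: "q \<le> p" "near y c h q"
  from rdist_leD[OF regD[OF reg_rdist_le assms(1) q(1)] near_down[OF assms(2) q(1)] q(2)]
  show "\<bar>c - d\<bar> \<le> e + e' + h" by simp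
qed

lemma rlimI:
  assumes "\<And>e q. e > 0 \<Longrightarrow> q \<le> p \<Longrightarrow> \<exists>r\<le>q. \<exists>N. \<forall>n\<ge>N. rdist_le (u n) l e r"
  shows "rlim u l p"
  unfolding rlim_def fall_def fimp_def fex_def fgnd_def
proof (intro allI impI)
  fix e q s assume "q \<le> p" "(0::rat) < e" "s \<le> q"
  then obtain r N where "r \<le> s" "\<forall>n\<ge>N. rdist_le (u n) l e r" using assms order_trans by meson
  then show "\<exists>r\<le>s. \<exists>N. \<forall>x. \<forall>q\<le>r. N \<le> x \<longrightarrow> rdist_le (u x) l e q"
    using regD[OF reg_rdist_le] by blast
qed

lemma rlimD:
  assumes "rlim u l p" "e > 0" "q \<le> p"
  shows "\<exists>r\<le>q. \<exists>N. \<forall>n\<ge>N. rdist_le (u n) l e r"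
  using assms unfolding rlim_def fall_def fimp_def fex_def fgnd_def by (meson order_refl)

text \<open>The real whose value is \<open>v\<close> on every condition that decides it to be \<open>v\<close>.\<close>

definition pw :: "('p::preorder \<Rightarrow> rat \<Rightarrow> bool) \<Rightarrow> 'p rnm"
  where "pw V = {(q, s). \<exists>v. V s v \<and> q < v}"

lemma near_pw:
  assumes "\<And>s v v'. V s v \<Longrightarrow> V s v' \<Longrightarrow> v = v'" "\<And>v. down (\<lambda>s. V s v)" "V p v"
  shows "near (pw V) v 0 p"
  unfolding near_def
proof (intro conjI allI impI)
  fix q assume "q < v - 0"
  then have "(q, p) \<in> pw V" using assms(3) unfolding pw_def by auto
  then show "(q \<in>\<^sub>0 pw V) p" unfolding mem0_iff by (meson order_refl)
next
  fix q assume q: "v + 0 \<le> q"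
  show "(\<^bold>\<not> q \<in>\<^sub>0 pw V) p" unfolding fnot_def
  proof (intro allI impI notI)
    fix r assume "r \<le> p" "(q \<in>\<^sub>0 pw V) r"
    then obtain t s v' where t: "t \<le> r" "t \<le> s" "V s v'" "q < v'"
      unfolding mem0_iff pw_def by (auto dest!: dense_ex)
    have "V t v'" "V t v"
      using t \<open>r \<le> p\<close> downD[OF assms(2) assms(3)] downD[OF assms(2) t(3)] order_trans by (meson)+
    then show False using assms(1) q t(4) by fastforce
  qed
qed

section \<open>The Stone space of the extension\<close>

lemma is_ultrafilter_iff: "is_ultrafilter x p \<longleftrightarrow>
    (\<forall>q\<le>p. \<not> (bot \<in>\<^sub>0 x) q) \<and>
    (\<forall>a b. \<forall>q\<le>p. (a \<in>\<^sub>0 x) q \<longrightarrow> (b \<in>\<^sub>0 x) q \<longrightarrow> (inf a b \<in>\<^sub>0 x) q) \<and>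
    (\<forall>a b. \<forall>q\<le>p. a \<le> b \<longrightarrow> (a \<in>\<^sub>0 x) q \<longrightarrow> (b \<in>\<^sub>0 x) q) \<and>
    (\<forall>a. \<forall>q\<le>p. \<exists>r\<le>q. (a \<in>\<^sub>0 x) r \<or> (- a \<in>\<^sub>0 x) r)"
  unfolding is_ultrafilter_def fand_def fnot_def fall_def fimp_def fgnd_def fdisj_def by auto

lemma reg_is_ultrafilter [reg_intros]: "reg (is_ultrafilter x)"
  unfolding is_ultrafilter_def by (intro reg_intros)

lemmas is_ultrafilter_down = regD[OF reg_is_ultrafilter]

lemma is_ultrafilter_cong: "(x =\<^sub>0 y) p \<Longrightarrow> is_ultrafilter y p \<Longrightarrow> is_ultrafilter x p"
  unfolding is_ultrafilter_iff by (simp add: eq_by_iff) (meson order_trans)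

lemma ultrafilter_bot: "is_ultrafilter x p \<Longrightarrow> \<not> (bot \<in>\<^sub>0 x) p"
  and ultrafilter_inf: "is_ultrafilter x p \<Longrightarrow> (a \<in>\<^sub>0 x) p \<Longrightarrow> (b \<in>\<^sub>0 x) p \<Longrightarrow> (inf a b \<in>\<^sub>0 x) p"
  and ultrafilter_up: "is_ultrafilter x p \<Longrightarrow> (a \<in>\<^sub>0 x) p \<Longrightarrow> a \<le> b \<Longrightarrow> (b \<in>\<^sub>0 x) p"
  and ultrafilter_decide: "is_ultrafilter x p \<Longrightarrow> \<exists>r\<le>p. (a \<in>\<^sub>0 x) r \<or> (- a \<in>\<^sub>0 x) r"
  by (simp_all add: is_ultrafilter_iff)

lemma mem_stone [simp]: "(x \<in>\<^sub>1 stone) p \<longleftrightarrow> is_ultrafilter x p"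
  unfolding stone_def
  by (rule mem_by_compr) (auto intro: reg_intros is_ultrafilter_cong)

lemma mem_clop [simp]: "(x \<in>\<^sub>1 clop a) p \<longleftrightarrow> is_ultrafilter x p \<and> (a \<in>\<^sub>0 x) p"
proof -
  have "(x \<in>\<^sub>1 clop a) p \<longleftrightarrow> (is_ultrafilter x \<^bold>\<and> a \<in>\<^sub>0 x) p"
    unfolding clop_def
  proof (rule mem_by_compr)
    fix y q assume "(x =\<^sub>0 y) q" "(is_ultrafilter y \<^bold>\<and> a \<in>\<^sub>0 y) q"
    then show "(is_ultrafilter x \<^bold>\<and> a \<in>\<^sub>0 x) q"
      unfolding fand_def using is_ultrafilter_cong eq_by_mem[OF _ order_refl, of _ x y q a] by auto
  qed (intro reg_intros)+
  then show ?thesis by (simp add: fand_def)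
qed

lemma mem_diff1 [simp]: "(x \<in>\<^sub>1 diff1 S T) p \<longleftrightarrow> (x \<in>\<^sub>1 S) p \<and> (\<^bold>\<not> x \<in>\<^sub>1 T) p"
proof -
  have "(x \<in>\<^sub>1 diff1 S T) p \<longleftrightarrow> (x \<in>\<^sub>1 S \<^bold>\<and> (\<^bold>\<not> x \<in>\<^sub>1 T)) p"
    unfolding diff1_def
  proof (rule mem_by_compr)
    fix y q assume e: "(x =\<^sub>0 y) q" and y: "(y \<in>\<^sub>1 S \<^bold>\<and> (\<^bold>\<not> y \<in>\<^sub>1 T)) q"
    have "\<not> (x \<in>\<^sub>1 T) r" if "r \<le> q" for r
      using y mem_by_cong[OF regD[OF reg_eq_by e that]] that unfolding fand_def fnot_def by blast
    then show "(x \<in>\<^sub>1 S \<^bold>\<and> (\<^bold>\<not> x \<in>\<^sub>1 T)) q"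
      using y mem_by_cong[OF eq_by_sym[OF e]] unfolding fand_def fnot_def by blast
  qed (intro reg_intros)+
  then show ?thesis by (simp add: fand_def)
qed

lemma mem_Union1: "(x \<in>\<^sub>1 Union1 S) p \<longleftrightarrow> (\<forall>q\<le>p. \<exists>r\<le>q. \<exists>n. (x \<in>\<^sub>1 S n) r)"
proof -
  have "(x \<in>\<^sub>1 Union1 S) p \<longleftrightarrow> (\<^bold>\<exists>n. x \<in>\<^sub>1 S n) p"
    unfolding Union1_def
  proof (rule mem_by_compr)
    fix y q assume e: "(x =\<^sub>0 y) q" and y: "(\<^bold>\<exists>n. y \<in>\<^sub>1 S n) q"
    show "(\<^bold>\<exists>n. x \<in>\<^sub>1 S n) q" unfolding fex_def
    proof (intro allI impI)
      fix s assume "s \<le> q"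
      then obtain r n where r: "r \<le> s" "(y \<in>\<^sub>1 S n) r" using y unfolding fex_def by blast
      have "(x =\<^sub>0 y) r" using regD[OF reg_eq_by e] order_trans[OF r(1) \<open>s \<le> q\<close>] by blast
      then show "\<exists>r\<le>s. \<exists>n. (x \<in>\<^sub>1 S n) r" using r mem_by_cong[OF eq_by_sym] by blast
    qed
  qed (intro reg_intros)+
  then show ?thesis by (simp add: fex_def)
qed

lemma sub1_iff: "(S \<subseteq>\<^sub>1 T) p \<longleftrightarrow> (\<forall>x. \<forall>q\<le>p. (x \<in>\<^sub>1 S) q \<longrightarrow> (x \<in>\<^sub>1 T) q)"
  unfolding sub1_def fall_def fimp_def ..

lemma disj1_iff: "disj1 S T p \<longleftrightarrow> (\<forall>x. \<forall>q\<le>p. \<not> ((x \<in>\<^sub>1 S) q \<and> (x \<in>\<^sub>1 T) q))"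
proof -
  have "disj1 S T p \<longleftrightarrow> (\<forall>q\<le>p. \<not> (\<forall>r\<le>q. \<exists>s\<le>r. \<exists>x. (x \<in>\<^sub>1 S) s \<and> (x \<in>\<^sub>1 T) s))"
    unfolding disj1_def fnot_def fex_def fand_def ..
  also have "\<dots> \<longleftrightarrow> (\<forall>x. \<forall>q\<le>p. \<not> ((x \<in>\<^sub>1 S) q \<and> (x \<in>\<^sub>1 T) q))"
  proof (intro iffI allI impI notI)
    fix x q assume *: "\<forall>q\<le>p. \<not> (\<forall>r\<le>q. \<exists>s\<le>r. \<exists>x. (x \<in>\<^sub>1 S) s \<and> (x \<in>\<^sub>1 T) s)" "q \<le> p"
      "(x \<in>\<^sub>1 S) q \<and> (x \<in>\<^sub>1 T) q"
    then have "\<forall>r\<le>q. (x \<in>\<^sub>1 S) r \<and> (x \<in>\<^sub>1 T) r" using regD[OF reg_mem_by] by meson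
    then show False using * order_refl by meson
  next
    fix q assume *: "\<forall>x. \<forall>q\<le>p. \<not> ((x \<in>\<^sub>1 S) q \<and> (x \<in>\<^sub>1 T) q)" "q \<le> p"
      "\<forall>r\<le>q. \<exists>s\<le>r. \<exists>x. (x \<in>\<^sub>1 S) s \<and> (x \<in>\<^sub>1 T) s"
    from dense_ex[OF this(3)] obtain s x where "s \<le> q" "(x \<in>\<^sub>1 S) s \<and> (x \<in>\<^sub>1 T) s" by blast
    then show False using * order_trans by meson
  qed
  finally show ?thesis .
qed

lemma reg_sub1 [reg_intros]: "reg (S \<subseteq>\<^sub>1 T)"
  unfolding sub1_def by (intro reg_intros)

lemma reg_disj1 [reg_intros]: "reg (disj1 S T)"
  unfolding disj1_def by (intro reg_intros)

lemma reg_is_open [reg_intros]: "reg (is_open S)"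
  unfolding is_open_def by (intro reg_intros)

lemma reg_is_closed [reg_intros]: "reg (is_closed S)"
  unfolding is_closed_def by (intro reg_intros)

lemma reg_is_borel [reg_intros]: "reg (is_borel S)"
  unfolding is_borel_def is_sigma_algebra_def by (intro reg_intros)

lemma fnot_mem_iff:
  assumes "is_ultrafilter x p"
  shows "(\<^bold>\<not> a \<in>\<^sub>0 x) p \<longleftrightarrow> (- a \<in>\<^sub>0 x) p"
proof
  assume n: "(\<^bold>\<not> a \<in>\<^sub>0 x) p"
  show "(- a \<in>\<^sub>0 x) p"
  proof (rule reg_dense[OF reg_mem_by])
    fix q assume q: "q \<le> p"
    then obtain r where "r \<le> q" "(a \<in>\<^sub>0 x) r \<or> (- a \<in>\<^sub>0 x) r"
      using assms unfolding is_ultrafilter_iff by blast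
    then show "\<exists>r\<le>q. (- a \<in>\<^sub>0 x) r" using fnotD[OF n] order_trans[OF _ q] by blast
  qed
next
  assume c: "(- a \<in>\<^sub>0 x) p"
  show "(\<^bold>\<not> a \<in>\<^sub>0 x) p" unfolding fnot_def
  proof (intro allI impI notI)
    fix q assume q: "q \<le> p" "(a \<in>\<^sub>0 x) q"
    then have "(inf a (- a) \<in>\<^sub>0 x) q"
      using assms regD[OF reg_mem_by c q(1)] unfolding is_ultrafilter_iff by blast
    then show False using assms q unfolding is_ultrafilter_iff by simp
  qed
qed

section \<open>Finite joins, prime ideals and compactness in the extension\<close>

definition joins :: "'a::boolean_algebra list \<Rightarrow> 'a"
  where "joins as = foldr sup as bot"

lemma joins_Nil [simp]: "joins [] = bot" and joins_Cons [simp]: "joins (a # as) = sup a (joins as)"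
  by (simp_all add: joins_def)

lemma joins_append [simp]: "joins (as @ bs) = sup (joins as) (joins bs)"
  by (induction as) (auto simp: sup_assoc)

lemma joins_upper: "a \<in> set as \<Longrightarrow> a \<le> joins as"
  by (induction as) (auto intro: le_supI1 le_supI2)

lemma joins_least: "(\<And>a. a \<in> set as \<Longrightarrow> a \<le> b) \<Longrightarrow> joins as \<le> b"
  by (induction as) auto

text \<open>Primeness of ultrafilters. The strengthening to \<open>r\<close> is needed because which
  joinand belongs to \<open>x\<close> may be undecided at \<open>p\<close>.\<close>

lemma ultrafilter_joins:
  assumes "is_ultrafilter x p" "(joins as \<in>\<^sub>0 x) p"
  shows "\<exists>r\<le>p. \<exists>a\<in>set as. (a \<in>\<^sub>0 x) r"
  using assms
proof (induction as arbitrary: p)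
  case Nil
  then show ?case unfolding is_ultrafilter_iff by auto
next
  case (Cons a as)
  obtain r where r: "r \<le> p" "(a \<in>\<^sub>0 x) r \<or> (- a \<in>\<^sub>0 x) r"
    using ultrafilter_decide[OF Cons.prems(1)] by blast
  show ?case
  proof (cases "(a \<in>\<^sub>0 x) r")
    case False
    have u: "is_ultrafilter x r" using Cons.prems(1) r(1) is_ultrafilter_down by blast
    have "(inf (- a) (joins (a # as)) \<in>\<^sub>0 x) r"
      by (rule ultrafilter_inf[OF u _ regD[OF reg_mem_by Cons.prems(2) r(1)]]) (use r False in simp)
    moreover have "inf (- a) (joins (a # as)) \<le> joins as" by (simp add: inf_sup_distrib1)
    ultimately have "(joins as \<in>\<^sub>0 x) r" by (rule ultrafilter_up[OF u])
    then show ?thesis using Cons.IH[OF u] r(1) order_trans by (metis list.set_intros(2))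
  qed (use r in auto)
qed

lemma top_in_ultrafilter:
  assumes "is_ultrafilter x p" shows "(top \<in>\<^sub>0 x) p"
proof -
  have "(\<^bold>\<not> bot \<in>\<^sub>0 x) p" using assms unfolding is_ultrafilter_iff fnot_def by blast
  then show ?thesis using fnot_mem_iff[OF assms] by simp
qed

text \<open>
  Maximal consistent sets of pairs \<open>(a, s)\<close>, read as ``\<open>s\<close> forces \<open>a\<close> out of the ultrafilter'', are
  names for prime ideals. Consistency has finite character, so Zorn's lemma in \<open>V\<close> yields the Boolean
  prime ideal theorem of \<open>V[G]\<close>.
\<close>

definition consistent :: "'p::preorder \<Rightarrow> ('a::boolean_algebra \<times> 'p) set \<Rightarrow> bool"
  where "consistent p M \<longleftrightarrow> (\<forall>q\<le>p. \<forall>as. (\<forall>a\<in>set as. \<exists>s\<ge>q. (a, s) \<in> M) \<longrightarrow> joins as \<noteq> top)"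

lemma maximal_consistent:
  assumes "consistent p M0"
  obtains M where "M0 \<subseteq> M" "consistent p M" "\<And>N. consistent p N \<Longrightarrow> M \<subseteq> N \<Longrightarrow> N = M"
proof -
  define A where "A = {M. M0 \<subseteq> M \<and> consistent p M}"
  have "\<Union>C \<in> A" if C: "C \<noteq> {}" "subset.chain A C" for C
  proof -
    have "C \<subseteq> A" using C(2) by (simp add: subset.chain_def)
    then have "M0 \<subseteq> \<Union>C" using C(1) unfolding A_def by blast
    moreover have "consistent p (\<Union>C)" unfolding consistent_def
    proof (intro allI impI)
      fix q as assume q: "q \<le> p" "\<forall>a\<in>set as. \<exists>s\<ge>q. (a, s) \<in> \<Union>C"
      then obtain s where s: "\<And>a. a \<in> set as \<Longrightarrow> q \<le> s a \<and> (a, s a) \<in> \<Union>C" by metis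
      have "finite ((\<lambda>a. (a, s a)) ` set as)" "(\<lambda>a. (a, s a)) ` set as \<subseteq> \<Union>C" using s by auto
      then obtain M where "M \<in> C" "(\<lambda>a. (a, s a)) ` set as \<subseteq> M"
        using finite_subset_Union_chain[OF _ _ C] by blast
      then have "\<forall>a\<in>set as. \<exists>t\<ge>q. (a, t) \<in> M" "consistent p M"
        using s \<open>C \<subseteq> A\<close> unfolding A_def by auto
      then show "joins as \<noteq> top" using q(1) unfolding consistent_def by simp
    qed
    ultimately show ?thesis by (simp add: A_def)
  qed
  moreover have "A \<noteq> {}" using assms unfolding A_def by blast
  ultimately obtain M where "M \<in> A" "\<forall>X\<in>A. M \<subseteq> X \<longrightarrow> X = M"
    using subset_Zorn_nonempty[of A] by blast
  then show thesis by (intro that[of M]) (auto simp: A_def)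
qed

lemma ultrafilter_avoiding:
  fixes M0 :: "('a::boolean_algebra \<times> 'p::preorder) set"
  assumes "consistent p M0"
  obtains x where "is_ultrafilter x p" "\<And>a q. q \<le> p \<Longrightarrow> (a, q) \<in> M0 \<Longrightarrow> (\<^bold>\<not> a \<in>\<^sub>0 x) q"
proof -
  obtain M where M: "M0 \<subseteq> M" "consistent p M" and max: "\<And>N. consistent p N \<Longrightarrow> M \<subseteq> N \<Longrightarrow> N = M"
    using maximal_consistent[OF assms] by blast
  define E where "E a q \<longleftrightarrow> (\<exists>s\<ge>q. (a, s) \<in> M)" for a q
  have con: "joins as \<noteq> top" if "q \<le> p" "\<And>a. a \<in> set as \<Longrightarrow> E a q" for as q
    using M(2) that unfolding consistent_def E_def by blast
  have E_down: "E a r" if "E a q" "r \<le> q" for a q r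
    using that order_trans unfolding E_def by meson
  have out: "\<exists>q\<le>s. \<exists>as. (\<forall>b\<in>set as. E b q) \<and> - a \<le> joins as" if s: "s \<le> p" "\<not> E a s" for a s
  proof -
    have "(a, s) \<notin> M" using s(2) order_refl unfolding E_def by blast
    then have "\<not> consistent p (insert (a, s) M)" using max by blast
    then obtain q bs where q: "q \<le> p" "\<forall>b\<in>set bs. \<exists>t\<ge>q. (b, t) \<in> insert (a, s) M" "joins bs = top"
      unfolding consistent_def by blast
    have bs: "q \<le> s \<and> b = a \<or> E b q" if "b \<in> set bs" for b
      using q(2) that unfolding E_def by auto
    \<comment> \<open>Elements satisfying \<open>E\<close> at \<open>q\<close> never join to
      \<open>top\<close>, so the added pair must have been used; this places \<open>q\<close> below
      \<open>s\<close>.\<close>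
    have "\<exists>b\<in>set bs. \<not> E b q" using con[OF q(1), of bs] q(3) by blast
    then have qs: "q \<le> s" using bs by blast
    define as where "as = filter (\<lambda>b. E b q) bs"
    have "b \<le> sup a (joins as)" if "b \<in> set bs" for b
      using bs[OF that] that joins_upper[of b as] by (auto simp: as_def intro: le_supI2)
    then have "joins bs \<le> sup a (joins as)" by (rule joins_least)
    then have "sup a (joins as) = top" using q(3) by (simp add: top.extremum_unique)
    then have "- a \<le> joins as" by (simp add: sup_shunt)
    moreover have "\<forall>b\<in>set as. E b q" by (simp add: as_def)
    ultimately show ?thesis using qs by blast
  qed
  have prime: "\<exists>r\<le>q. E a r \<or> E (- a) r" if q: "q \<le> p" for a q
  proof (rule ccontr)
    assume no: "\<not> ?thesis"
    then have "\<not> E a q" using order_refl by blast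
    then obtain r as where r: "r \<le> q" "\<forall>b\<in>set as. E b r" "- a \<le> joins as" using out q by blast
    have "r \<le> p" using r q order_trans by blast
    moreover have "\<not> E (- a) r" using no r by blast
    ultimately obtain t bs where t: "t \<le> r" "\<forall>b\<in>set bs. E b t" "- (- a) \<le> joins bs"
      using out by blast
    \<comment> \<open>One finite family of excluded elements covers \<open>- a\<close>, the other
      covers \<open>a\<close>. Below \<open>t\<close> both are excluded, so together they contradict
      \<open>con\<close>.\<close>
    have "sup (- a) a \<le> joins (as @ bs)" 
      unfolding joins_append by (rule sup_mono) (use r(3) t(3) in simp_all)
    then have "joins (as @ bs) = top" by (simp add: top.extremum_unique)
    moreover have "t \<le> p" using t \<open>r \<le> p\<close> order_trans by blast
    moreover have "E b t" if "b \<in> set (as @ bs)" for b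
      using that r(2) t(2) E_down[OF _ t(1)] by auto
    ultimately show False using con[of t "as @ bs"] by blast
  qed
  \<comment> \<open>\<open>M\<close> names a prime ideal and \<open>x\<close> its dual ultrafilter,
    whence the complement.\<close>
  define x where "x = {(a, s). (- a, s) \<in> M}"
  have mem: "(a \<in>\<^sub>0 x) q \<longleftrightarrow> (\<forall>r\<le>q. \<exists>s\<le>r. E (- a) s)" for a q
    unfolding mem0_iff x_def E_def by simp blast
  have clash: "\<not> E a q" if "(a \<in>\<^sub>0 x) q" "q \<le> p" for a q
  proof
    assume a: "E a q"
    from dense_ex[OF that(1)[unfolded mem]] obtain r where r: "r \<le> q" "E (- a) r" by blast
    then have "E a r" using a E_down by blast
    moreover have "r \<le> p" using r that order_trans by blast
    ultimately show False using con[of r "[a, - a]"] r by auto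
  qed
  have intro_mem: "(a \<in>\<^sub>0 x) q" if "q \<le> p" "\<And>r. r \<le> q \<Longrightarrow> \<not> E a r" for a q
    unfolding mem
  proof (intro allI impI)
    fix r assume r: "r \<le> q"
    from prime[OF order_trans[OF r that(1)]] obtain s where "s \<le> r" "E a s \<or> E (- a) s" by blast
    then show "\<exists>s\<le>r. E (- a) s" using that(2)[OF order_trans[OF _ r]] by blast
  qed
  have "is_ultrafilter x p" unfolding is_ultrafilter_iff
  proof (intro conjI allI impI)
    fix q assume q: "q \<le> p"
    show "\<not> (bot \<in>\<^sub>0 x) q"
    proof
      assume "(bot \<in>\<^sub>0 x) q"
      from dense_ex[OF this[unfolded mem]] obtain r where r: "r \<le> q" "E top r" by auto
      then have "r \<le> p" using q order_trans by blast
      then show False using con[of r "[top]"] r by auto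
    qed
  next
    fix a b q assume q: "q \<le> p" "(a \<in>\<^sub>0 x) q" "(b \<in>\<^sub>0 x) q"
    show "(inf a b \<in>\<^sub>0 x) q"
    proof (rule intro_mem[OF q(1)])
      fix r assume r: "r \<le> q"
      show "\<not> E (inf a b) r"
      proof
        assume e: "E (inf a b) r"
        obtain s where s: "s \<le> r" "E (- a) s" using q(2) r unfolding mem by blast
        obtain t where t: "t \<le> s" "E (- b) t"
          using q(3) order_trans[OF s(1) r] unfolding mem by blast
        have tr: "t \<le> r" "t \<le> p" using order_trans[OF t(1) s(1)] order_trans[OF _ order_trans[OF r q(1)]] by blast+
        have "joins [inf a b, - a, - b] \<noteq> top"
          using t(2) E_down[OF s(2) t(1)] E_down[OF e tr(1)] by (intro con[OF tr(2)]) auto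
        moreover have "joins [inf a b, - a, - b] = top"
          by simp (metis compl_inf sup_compl_top sup_assoc)
        ultimately show False by simp
      qed
    qed
  next
    fix a b q assume q: "q \<le> p" "a \<le> b" "(a \<in>\<^sub>0 x) q"
    show "(b \<in>\<^sub>0 x) q"
    proof (rule intro_mem[OF q(1)])
      fix r assume r: "r \<le> q"
      show "\<not> E b r"
      proof
        assume e: "E b r"
        obtain s where s: "s \<le> r" "E (- a) s" using q(3) r unfolding mem by blast
        have "joins [b, - a] \<noteq> top"
          using s(2) E_down[OF e s(1)] by (intro con[OF order_trans[OF s(1) order_trans[OF r q(1)]]]) auto
        moreover have "sup a (- a) \<le> sup b (- a)" using q(2) by (rule sup_mono) simp
        then have "joins [b, - a] = top" by (simp add: top.extremum_unique)
        ultimately show False by simp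
      qed
    qed
  next
    fix a q assume q: "q \<le> p"
    then obtain r where r: "r \<le> q" "E a r \<or> E (- a) r" using prime by blast
    have "(- a \<in>\<^sub>0 x) r" if "E a r" unfolding mem using E_down[OF that] order_refl by auto
    moreover have "(a \<in>\<^sub>0 x) r" if "E (- a) r" unfolding mem using E_down[OF that] order_refl by auto
    ultimately show "\<exists>r\<le>q. (a \<in>\<^sub>0 x) r \<or> (- a \<in>\<^sub>0 x) r" using r by blast
  qed
  moreover have "(\<^bold>\<not> a \<in>\<^sub>0 x) q" if "q \<le> p" "(a, q) \<in> M0" for a q
  proof -
    have "E a q" using that M(1) order_refl unfolding E_def by blast
    then show ?thesis unfolding fnot_def using clash E_down order_trans[OF _ that(1)] by blast
  qed
  ultimately show thesis using that by blast
qed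

text \<open>The cover \<open>j\<close> is a family of algebra elements in V[G], but the finite
  subcover is an actual list in V, found below a stronger condition. If there were none, the pairs
  in \<open>j\<close> would be consistent, and an ultrafilter avoiding all of them would escape the
  cover.\<close>

lemma stone_compact:
  assumes dn: "\<And>a. down (j a)"
    and cov: "\<And>x q. q \<le> p \<Longrightarrow> is_ultrafilter x q \<Longrightarrow> \<exists>r\<le>q. \<exists>a. j a r \<and> (a \<in>\<^sub>0 x) r"
  shows "\<exists>r\<le>p. \<exists>as. (\<forall>a\<in>set as. j a r) \<and> joins as = top"
proof (rule ccontr)
  assume no: "\<not> ?thesis"
  have "consistent p {(a, s). j a s}" unfolding consistent_def
  proof (intro allI impI)
    fix q as assume "q \<le> p" "\<forall>a\<in>set as. \<exists>s\<ge>q. (a, s) \<in> {(a, s). j a s}"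
    moreover from this have "\<forall>a\<in>set as. j a q" using dn downD by blast
    ultimately show "joins as \<noteq> top" using no by blast
  qed
  then obtain x where x: "is_ultrafilter x p"
    "\<And>a q. q \<le> p \<Longrightarrow> (a, q) \<in> {(a, s). j a s} \<Longrightarrow> (\<^bold>\<not> a \<in>\<^sub>0 x) q"
    using ultrafilter_avoiding by blast
  obtain r a where r: "r \<le> p" "j a r" "(a \<in>\<^sub>0 x) r" using cov[OF order_refl x(1)] by blast
  then have "(\<^bold>\<not> a \<in>\<^sub>0 x) r" using x(2)[OF r(1)] by simp
  then show False using r(3) unfolding fnot_def by simp
qed

subsection \<open>Ground model points\<close>

definition ultra :: "'a::boolean_algebra set \<Rightarrow> bool"
  where "ultra U \<longleftrightarrow> bot \<notin> U \<and> (\<forall>a b. a \<in> U \<longrightarrow> b \<in> U \<longrightarrow> inf a b \<in> U) \<and>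
    (\<forall>a b. a \<le> b \<longrightarrow> a \<in> U \<longrightarrow> b \<in> U) \<and> (\<forall>a. a \<in> U \<or> - a \<in> U)"

definition check :: "'x set \<Rightarrow> ('x, 'p::preorder) nm"
  where "check U = compr (\<lambda>a. fgnd (a \<in> U))"

lemma mem_check [simp]: "(a \<in>\<^sub>0 check U) p \<longleftrightarrow> a \<in> U"
  unfolding check_def by (subst mem0_compr[OF reg_fgnd]) (simp add: fgnd_def)

lemma is_ultrafilter_check [simp]: "ultra U \<Longrightarrow> is_ultrafilter (check U) p"
  unfolding is_ultrafilter_iff ultra_def using order_refl by auto

text \<open>Over the one-point order \<open>unit\<close> the forcing language is ordinary truth, so
  the name constructed by \<open>ultrafilter_avoiding\<close> yields an ultrafilter of V.\<close>

lemma ultra_exists: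
  assumes "(a::'a::boolean_algebra) \<noteq> bot"
  shows "\<exists>U. ultra U \<and> a \<in> U"
proof -
  have "joins as \<noteq> top" if "\<forall>b\<in>set as. b = - a" for as
  proof -
    have "joins as \<le> - a" using that by (intro joins_least) simp
    then show ?thesis using assms by (metis compl_eq_compl_iff compl_bot_eq double_compl top.extremum_unique)
  qed
  then have "consistent () {(- a, ())}" by (simp add: consistent_def)
  then obtain x where x: "is_ultrafilter x ()" "(\<^bold>\<not> - a \<in>\<^sub>0 x) ()"
    using ultrafilter_avoiding[of "()" "{(- a, ())}"] by auto
  have a: "(a \<in>\<^sub>0 x) ()" using x(2) fnot_mem_iff[OF x(1)] by simp
  have "ultra {b. (b \<in>\<^sub>0 x) ()}" 
    using ultrafilter_bot[OF x(1)] ultrafilter_inf[OF x(1)] ultrafilter_up[OF x(1)]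
      ultrafilter_decide[OF x(1)] unfolding ultra_def by (auto, metis (full_types) old.unit.exhaust)
  then show ?thesis using a by blast
qed

lemma ultra_compl: "ultra U \<Longrightarrow> - a \<in> U \<longleftrightarrow> a \<notin> U"
  unfolding ultra_def by (metis inf_compl_bot)

lemma ultra_joins:
  assumes "ultra U" shows "joins as \<in> U \<longleftrightarrow> (\<exists>a\<in>set as. a \<in> U)"
proof
  assume "joins as \<in> U"
  then have "(joins as \<in>\<^sub>0 check U) ()" by simp
  from ultrafilter_joins[OF is_ultrafilter_check[OF assms] this]
  show "\<exists>a\<in>set as. a \<in> U" by auto
next
  assume "\<exists>a\<in>set as. a \<in> U"
  then show "joins as \<in> U" using assms joins_upper unfolding ultra_def by blast
qed

lemma ultra_top: "ultra U \<Longrightarrow> top \<in> U"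
  using ultra_compl[of U bot] unfolding ultra_def by simp

subsection \<open>Open, closed and Borel sets\<close>

lemma is_open_iff: "is_open S p \<longleftrightarrow> (S \<subseteq>\<^sub>1 stone) p \<and>
    (\<forall>x. \<forall>q\<le>p. (x \<in>\<^sub>1 S) q \<longrightarrow>
      (\<forall>r\<le>q. \<exists>s\<le>r. \<exists>a. is_ultrafilter x s \<and> (a \<in>\<^sub>0 x) s \<and> (clop a \<subseteq>\<^sub>1 S) s))"
  unfolding is_open_def fand_def fall_def fimp_def fex_def mem_clop by auto

lemma is_open_clop [simp]: "is_open (clop a) p"
  unfolding is_open_iff sub1_iff by (auto intro: is_ultrafilter_down regD[OF reg_mem_by])

lemma is_openD:
  assumes "is_open S p" "(x \<in>\<^sub>1 S) p"
  shows "\<exists>r\<le>p. \<exists>a. (a \<in>\<^sub>0 x) r \<and> (clop a \<subseteq>\<^sub>1 S) r"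
  using assms order_refl unfolding is_open_iff by meson

lemma is_borel_iff: "is_borel B p \<longleftrightarrow> (\<forall>F. \<forall>q\<le>p. is_sigma_algebra F q \<longrightarrow>
    (\<forall>S. \<forall>r\<le>q. is_open S r \<longrightarrow> (S \<in>\<^sub>2 F) r) \<longrightarrow> (B \<in>\<^sub>2 F) q)"
  unfolding is_borel_def fand_def fall_def fimp_def by auto

lemma is_sigma_algebra_iff: "is_sigma_algebra F p \<longleftrightarrow>
    (\<forall>S. \<forall>q\<le>p. (S \<in>\<^sub>2 F) q \<longrightarrow> (S \<subseteq>\<^sub>1 stone) q) \<and> (stone \<in>\<^sub>2 F) p \<and>
    (\<forall>S. \<forall>q\<le>p. (S \<in>\<^sub>2 F) q \<longrightarrow> (diff1 stone S \<in>\<^sub>2 F) q) \<and>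
    (\<forall>S. \<forall>q\<le>p. (\<forall>n. (S n \<in>\<^sub>2 F) q) \<longrightarrow> (Union1 S \<in>\<^sub>2 F) q)"
  unfolding is_sigma_algebra_def fand_def fall_def fimp_def by blast

lemma borel_open: "is_open S p \<Longrightarrow> is_borel S p"
  unfolding is_borel_iff using regD[OF reg_is_open] order_refl by meson

lemma borel_clop [simp]: "is_borel (clop a) p"
  by (simp add: borel_open)

lemma borel_compl:
  assumes "is_borel B p"
  shows "is_borel (diff1 stone B) p"
  unfolding is_borel_iff
proof (intro allI impI)
  fix F :: "('a, 'b) pfnm" and q
  assume q: "q \<le> p" "is_sigma_algebra F q" "\<forall>S. \<forall>r\<le>q. is_open S r \<longrightarrow> (S \<in>\<^sub>2 F) r"
  then have "(B \<in>\<^sub>2 F) q" using assms unfolding is_borel_iff by simp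
  then show "(diff1 stone B \<in>\<^sub>2 F) q" using q(2) unfolding is_sigma_algebra_iff by simp
qed

lemma borel_Union:
  assumes "\<And>n. is_borel (B n) p"
  shows "is_borel (Union1 B) p"
  unfolding is_borel_iff
proof (intro allI impI)
  fix F :: "('a, 'b) pfnm" and q
  assume q: "q \<le> p" "is_sigma_algebra F q" "\<forall>S. \<forall>r\<le>q. is_open S r \<longrightarrow> (S \<in>\<^sub>2 F) r"
  then have "(B n \<in>\<^sub>2 F) q" for n using assms unfolding is_borel_iff by simp
  then show "(Union1 B \<in>\<^sub>2 F) q" using q(2) unfolding is_sigma_algebra_iff by simp
qed

lemma borel_cong:
  assumes "is_borel B p" "(B =\<^sub>1 C) p"
  shows "is_borel C p"
  unfolding is_borel_iff
proof (intro allI impI)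
  fix F :: "('a, 'b) pfnm" and q
  assume q: "q \<le> p" "is_sigma_algebra F q" "\<forall>S. \<forall>r\<le>q. is_open S r \<longrightarrow> (S \<in>\<^sub>2 F) r"
  then have "(B \<in>\<^sub>2 F) q" using assms(1) unfolding is_borel_iff by simp
  then show "(C \<in>\<^sub>2 F) q" by (rule mem_by_cong[OF regD[OF reg_eq_by assms(2) q(1)]])
qed

lemma eq1I: "(\<And>x q. q \<le> p \<Longrightarrow> (x \<in>\<^sub>1 S) q \<longleftrightarrow> (x \<in>\<^sub>1 T) q) \<Longrightarrow> (S =\<^sub>1 T) p"
  by (simp add: eq_by_iff)

lemma sub1_cong: "(S =\<^sub>1 T) p \<Longrightarrow> (T \<subseteq>\<^sub>1 U) p \<Longrightarrow> (S \<subseteq>\<^sub>1 U) p"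
  unfolding sub1_iff eq_by_iff by blast

lemma borel_sub_stone:
  assumes "is_borel (B :: ('a::boolean_algebra, 'p::preorder) psnm) p"
  shows "(B \<subseteq>\<^sub>1 stone) p"
proof -
  \<comment> \<open>\<open>is_borel\<close> is tested on one particular sigma-algebra, the power set
    of the Stone space.\<close>
  define F :: "('a, 'p) pfnm" where "F = compr (\<lambda>S. S \<subseteq>\<^sub>1 stone)"
  have F: "(S \<in>\<^sub>2 F) q \<longleftrightarrow> (S \<subseteq>\<^sub>1 stone) q" for S q
    unfolding F_def by (rule mem_by_compr) (auto intro: reg_intros sub1_cong)
  have "is_sigma_algebra F p"
    unfolding is_sigma_algebra_iff F
    unfolding sub1_iff mem_diff1 mem_Union1 mem_stone
  proof (intro conjI allI impI)
    fix S q x r assume S: "\<forall>n x. \<forall>s\<le>q. (x \<in>\<^sub>1 S n) s \<longrightarrow> is_ultrafilter x s"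
      and r: "r \<le> q" "\<forall>q\<le>r. \<exists>r\<le>q. \<exists>n. (x \<in>\<^sub>1 S n) r"
    show "is_ultrafilter x r"
      by (rule reg_dense[OF reg_is_ultrafilter]) (use S r order_trans in meson)
  qed auto
  moreover have "(S \<in>\<^sub>2 F) r" if "is_open S r" for S r using that unfolding F is_open_iff by blast
  ultimately have "(B \<in>\<^sub>2 F) p" using assms order_refl unfolding is_borel_iff by blast
  then show ?thesis unfolding F .
qed

lemma fnot_fnot: "reg \<phi> \<Longrightarrow> (\<^bold>\<not> (\<^bold>\<not> \<phi>)) p \<longleftrightarrow> \<phi> p"
  by (metis down_fnot fnotD fnot_def not_forcesE order_refl reg_def downD)

lemma borel_diff:
  assumes "is_borel B p" "is_borel C p"
  shows "is_borel (diff1 B C) p"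
proof -
  \<comment> \<open>De Morgan: the difference is the complement of the union of the complement of
    \<open>B\<close> with \<open>C\<close>, here written as a sequence that is constantly
    \<open>C\<close> from index 1 on.\<close>
  let ?S = "\<lambda>n::nat. if n = 0 then diff1 stone B else C"
  have "is_borel (diff1 stone (Union1 ?S)) p"
    using assms by (intro borel_compl borel_Union) (auto intro: borel_compl)
  moreover have "(diff1 stone (Union1 ?S) =\<^sub>1 diff1 B C) p"
  proof (rule eq1I)
    fix x q assume q: "q \<le> p"
    have ex: "(\<exists>n. (x \<in>\<^sub>1 ?S n) r) \<longleftrightarrow> is_ultrafilter x r \<and> (\<^bold>\<not> x \<in>\<^sub>1 B) r \<or> (x \<in>\<^sub>1 C) r" for r
    proof
      assume "is_ultrafilter x r \<and> (\<^bold>\<not> x \<in>\<^sub>1 B) r \<or> (x \<in>\<^sub>1 C) r"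
      then have "(x \<in>\<^sub>1 ?S 0) r \<or> (x \<in>\<^sub>1 ?S 1) r" by simp
      then show "\<exists>n. (x \<in>\<^sub>1 ?S n) r" by blast
    qed (auto split: if_splits)
    have B: "is_ultrafilter x r" if "(x \<in>\<^sub>1 B) r" "r \<le> q" for r
      using borel_sub_stone[OF assms(1)] that order_trans[OF _ q] unfolding sub1_iff by auto
    have "(x \<in>\<^sub>1 diff1 stone (Union1 ?S)) q \<longleftrightarrow> is_ultrafilter x q \<and>
       (\<forall>r\<le>q. \<not> (is_ultrafilter x r \<and> (\<^bold>\<not> x \<in>\<^sub>1 B) r \<or> (x \<in>\<^sub>1 C) r))"
    proof -
      have "(\<^bold>\<not> x \<in>\<^sub>1 Union1 ?S) q \<longleftrightarrow> (\<forall>r\<le>q. \<not> (\<exists>n. (x \<in>\<^sub>1 ?S n) r))"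
        unfolding fnot_def mem_Union1
      proof (intro iffI allI impI notI)
        fix r assume 1: "\<forall>qa\<le>q. \<not> (\<forall>q\<le>qa. \<exists>r\<le>q. \<exists>n. (x \<in>\<^sub>1 ?S n) r)" "r \<le> q" "\<exists>n. (x \<in>\<^sub>1 ?S n) r"
        then obtain n where "(x \<in>\<^sub>1 ?S n) r" by blast
        from regD[OF reg_mem_by this] have "\<forall>s\<le>r. \<exists>t\<le>s. \<exists>n. (x \<in>\<^sub>1 ?S n) t"
          using order_refl by meson
        then show False using 1(1,2) by blast
      next
        fix r assume 1: "\<forall>r\<le>q. \<not> (\<exists>n. (x \<in>\<^sub>1 ?S n) r)" "r \<le> q" "\<forall>q\<le>r. \<exists>r\<le>q. \<exists>n. (x \<in>\<^sub>1 ?S n) r"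
        then show False using dense_ex[OF 1(3)] order_trans by meson
      qed
      then show ?thesis unfolding mem_diff1 mem_stone ex by blast
    qed
    also have "\<dots> \<longleftrightarrow> (x \<in>\<^sub>1 diff1 B C) q"
      unfolding mem_diff1
      using B fnot_fnot[OF reg_mem_by, of "(=\<^sub>0)" x B q] is_ultrafilter_down[of x q] regD[OF reg_mem_by, of "(=\<^sub>0)" x B q]
      unfolding fnot_def using order_refl by blast
    finally show "(x \<in>\<^sub>1 diff1 stone (Union1 ?S)) q \<longleftrightarrow> (x \<in>\<^sub>1 diff1 B C) q" .
  qed
  ultimately show ?thesis by (rule borel_cong)
qed

lemma is_closedD:
  assumes "is_closed K p" "is_ultrafilter y p" "(\<^bold>\<not> y \<in>\<^sub>1 K) p"
  shows "\<exists>r\<le>p. \<exists>b. (b \<in>\<^sub>0 y) r \<and> disj1 (clop b) K r"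
proof -
  have "is_open (diff1 stone K) p" "(y \<in>\<^sub>1 diff1 stone K) p"
    using assms unfolding is_closed_def fand_def by auto
  then obtain r b where r: "r \<le> p" "(b \<in>\<^sub>0 y) r" "(clop b \<subseteq>\<^sub>1 diff1 stone K) r"
    using is_openD by blast
  have "disj1 (clop b) K r"
    using r(3) order_refl unfolding disj1_iff sub1_iff mem_diff1 fnot_def by blast
  then show ?thesis using r by blast
qed

section \<open>Radon measures of the extension\<close>

lemma borel_family_iff: "borel_family Bs p \<longleftrightarrow>
    (\<forall>i<length Bs. is_borel (Bs ! i) p) \<and> (\<forall>i<length Bs. \<forall>j<i. disj1 (Bs ! i) (Bs ! j) p)"
  unfolding borel_family_def fand_def fall_def fimp_def fgnd_def
  by (meson regD[OF reg_is_borel] regD[OF reg_disj1] order_refl)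

lemma var_le_iff: "var_le \<nu> D c p \<longleftrightarrow> (\<forall>Bs. \<forall>q\<le>p. borel_family Bs q \<longrightarrow>
    (\<forall>i<length Bs. (Bs ! i \<subseteq>\<^sub>1 D) q) \<longrightarrow> rle (rsum (map (\<lambda>B. rabs (\<nu> B)) Bs)) (rrat c) q)"
proof -
  have "(\<forall>i. \<forall>r\<le>q. i < length Bs \<longrightarrow> (Bs ! i \<subseteq>\<^sub>1 D) r) \<longleftrightarrow> (\<forall>i<length Bs. (Bs ! i \<subseteq>\<^sub>1 D) q)"
    for Bs q using regD[OF reg_sub1] order_refl by meson
  then show ?thesis unfolding var_le_def fand_def fall_def fimp_def fgnd_def by (simp only: imp_conjL)
qed

lemma is_radon_iff: "is_radon \<nu> p \<longleftrightarrow>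
    (\<forall>B. \<forall>q\<le>p. is_borel B q \<longrightarrow> is_real (\<nu> B) q) \<and>
    (\<forall>B C. \<forall>q\<le>p. is_borel B q \<longrightarrow> (B =\<^sub>1 C) q \<longrightarrow> (\<nu> B =\<^sub>0 \<nu> C) q) \<and>
    (\<forall>B. \<forall>q\<le>p. (\<forall>n. is_borel (B n) q) \<longrightarrow> (\<forall>m n. m < n \<longrightarrow> disj1 (B m) (B n) q) \<longrightarrow>
       rlim (\<lambda>n. rsum (map (\<lambda>i. \<nu> (B i)) [0..<n])) (\<nu> (Union1 B)) q) \<and>
    (\<forall>B e. \<forall>q\<le>p. is_borel B q \<longrightarrow> 0 < e \<longrightarrow>
       (\<forall>r\<le>q. \<exists>s\<le>r. \<exists>K. is_closed K s \<and> (K \<subseteq>\<^sub>1 B) s \<and> var_le \<nu> (diff1 B K) e s))"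
proof -
  have "(\<forall>m n. \<forall>r\<le>q. m < n \<longrightarrow> disj1 (B m) (B n) r) \<longleftrightarrow> (\<forall>m n. m < n \<longrightarrow> disj1 (B m) (B n) q)"
    for B :: "nat \<Rightarrow> ('a, 'b) psnm" and q using regD[OF reg_disj1] order_refl by meson
  then show ?thesis
    unfolding is_radon_def fand_def fall_def fimp_def fgnd_def fex_def by (simp only: imp_conjL)
qed

lemma reg_var_le [reg_intros]: "reg (var_le \<nu> D c)"
  unfolding var_le_def borel_family_def by (intro reg_intros)

lemma reg_is_radon [reg_intros]: "reg (is_radon \<nu>)"
  unfolding is_radon_def by (intro reg_intros)

lemma radon_real: "is_radon \<nu> p \<Longrightarrow> is_borel B p \<Longrightarrow> is_real (\<nu> B) p"
  unfolding is_radon_iff by simp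

lemma radon_inner_regular:
  assumes "is_radon \<nu> p" "is_borel B p" "0 < e" "r \<le> p"
  shows "\<exists>s\<le>r. \<exists>K. is_closed K s \<and> (K \<subseteq>\<^sub>1 B) s \<and> var_le \<nu> (diff1 B K) e s"
proof -
  from assms(1) have "\<forall>q\<le>p. is_borel B q \<longrightarrow> 0 < e \<longrightarrow>
      (\<forall>r\<le>q. \<exists>s\<le>r. \<exists>K. is_closed K s \<and> (K \<subseteq>\<^sub>1 B) s \<and> var_le \<nu> (diff1 B K) e s)"
    unfolding is_radon_iff by simp
  then show ?thesis using assms(2-4) order_refl[of p] by blast
qed

text \<open>The one-element family consisting of \<open>T\<close> is among those that the variation
  bounds.\<close>

lemma var_le_near:
  assumes "is_radon \<nu> p" "var_le \<nu> D e p" "is_borel T p" "(T \<subseteq>\<^sub>1 D) p"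
  shows "near (\<nu> T) 0 e p"
proof (rule near_of_approx[OF radon_real[OF assms(1,3)]])
  fix q c h assume q: "q \<le> p" "near (\<nu> T) c h q"
  have "borel_family [T] p" using assms(3) by (simp add: borel_family_iff)
  then have "rle (rsum [rabs (\<nu> T)]) (rrat e) p"
    using assms(2,4) unfolding var_le_iff by (auto dest!: spec[of _ "[T]"])
  then have "rle (rsum [rabs (\<nu> T)]) (rrat e) q" using q regD[OF reg_rle] by blast
  moreover have "near (rsum [rabs (\<nu> T)]) \<bar>c\<bar> h q"
    using near_rsum_err[of "[rabs (\<nu> T)]" "\<lambda>_. \<bar>c\<bar>" "\<lambda>_. h" q] near_rabs[OF q(2)] by simp
  ultimately show "\<bar>c - 0\<bar> \<le> e + h" using near_rleD by fastforce
qed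

text \<open>Countable additivity is applied to the sequence \<open>S\<close>, \<open>T\<close>,
  followed by empty sets, represented by \<open>clop bot\<close>. The hypothesis \<open>bot\<close>
  makes the tail contribute exactly 0. Coverage of \<open>B\<close> is asked only densely, since
  membership in \<open>S\<close> or \<open>T\<close> may be undecided.\<close>

lemma radon_add:
  assumes rad: "is_radon \<nu> p" and bot: "near (\<nu> (clop bot)) 0 0 p"
    and S: "is_borel S p" and T: "is_borel T p" and dj: "disj1 S T p"
    and sub: "(S \<subseteq>\<^sub>1 B) p" "(T \<subseteq>\<^sub>1 B) p"
    and cov: "\<And>x q. q \<le> p \<Longrightarrow> (x \<in>\<^sub>1 B) q \<Longrightarrow> \<exists>r\<le>q. (x \<in>\<^sub>1 S) r \<or> (x \<in>\<^sub>1 T) r"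
    and c: "near (\<nu> S) c e p" and d: "near (\<nu> T) d e' p"
  shows "near (\<nu> B) (c + d) (e + e') p"
proof -
  define F where "F = (\<lambda>n::nat. if n = 0 then S else if n = 1 then T else clop bot)"
  have bor: "is_borel (F n) p" for n using S T by (simp add: F_def)
  have empty: "\<not> (x \<in>\<^sub>1 clop bot) q" for x :: "('a, 'b) nm" and q
    using ultrafilter_bot by auto
  have "disj1 (F m) (F n) p" if "m < n" for m n
    using that dj empty by (auto simp: F_def disj1_iff)
  with bor have lim: "rlim (\<lambda>n. rsum (map (\<lambda>i. \<nu> (F i)) [0..<n])) (\<nu> (Union1 F)) p"
    using rad unfolding is_radon_iff by simp
  have real: "is_real (\<nu> (Union1 F)) p" by (rule radon_real[OF rad borel_Union[OF bor]])
  have "near (\<nu> (Union1 F)) (c + d) (e + e') p"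
  proof (rule near_closed[OF _ real])
    fix h :: rat assume h: "h > 0"
    show "near (\<nu> (Union1 F)) (c + d) (e + e' + h) p"
    proof (rule reg_dense[OF reg_near])
      fix q assume q: "q \<le> p"
      obtain r N where r: "r \<le> q"
        "\<forall>n\<ge>N. rdist_le (rsum (map (\<lambda>i. \<nu> (F i)) [0..<n])) (\<nu> (Union1 F)) h r"
        using rlimD[OF lim h q] by blast
      have rp: "r \<le> p" using r q order_trans by blast
      \<comment> \<open>The length \<open>N + 2\<close> is beyond the threshold of the limit and
        long enough to contain both \<open>S\<close> and \<open>T\<close>.\<close>
      have "near (rsum (map (\<lambda>i. \<nu> (F i)) [0..<N+2]))
          (\<Sum>i<length (map (\<lambda>i. \<nu> (F i)) [0..<N+2]). if i = 0 then c else if i = 1 then d else 0)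
          (\<Sum>i<length (map (\<lambda>i. \<nu> (F i)) [0..<N+2]). if i = 0 then e else if i = 1 then e' else 0) r"
      proof (rule near_rsum_err)
        fix i assume "i < length (map (\<lambda>i. \<nu> (F i)) [0..<N+2])"
        then have "map (\<lambda>i. \<nu> (F i)) [0..<N+2] ! i = \<nu> (F i)" by (simp del: upt_Suc)
        then show "near (map (\<lambda>i. \<nu> (F i)) [0..<N+2] ! i) (if i = 0 then c else if i = 1 then d else 0)
          (if i = 0 then e else if i = 1 then e' else 0) r"
          using c d bot near_down[OF _ rp] by (simp add: F_def)
      qed
      moreover have two: "(\<Sum>i<N+2. if i = 0 then a else if i = 1 then b else (0::rat)) = a + b" for a b
        by (simp add: sum.lessThan_Suc_shift del: sum.lessThan_Suc)
      ultimately have "near (rsum (map (\<lambda>i. \<nu> (F i)) [0..<N+2])) (c + d) (e + e') r"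
        by (simp del: upt_Suc sum.lessThan_Suc)
      moreover have "rdist_le (rsum (map (\<lambda>i. \<nu> (F i)) [0..<N+2])) (\<nu> (Union1 F)) h r"
        using r(2) by (simp del: upt_Suc)
      ultimately have "near (\<nu> (Union1 F)) (c + d) (h + (e + e')) r"
        using rdist_le_near' regD[OF reg_is_real real rp] by blast
      then show "\<exists>r\<le>q. near (\<nu> (Union1 F)) (c + d) (e + e' + h) r"
        using r(1) by (auto simp: algebra_simps)
    qed
  qed
  moreover have "(Union1 F =\<^sub>1 B) p"
  proof (rule eq1I)
    fix x q assume q: "q \<le> p"
    have ST: "(\<exists>n. (x \<in>\<^sub>1 F n) r) \<longleftrightarrow> (x \<in>\<^sub>1 S) r \<or> (x \<in>\<^sub>1 T) r" for r
    proof
      assume "(x \<in>\<^sub>1 S) r \<or> (x \<in>\<^sub>1 T) r"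
      then have "(x \<in>\<^sub>1 F 0) r \<or> (x \<in>\<^sub>1 F 1) r" by (simp add: F_def)
      then show "\<exists>n. (x \<in>\<^sub>1 F n) r" by blast
    qed (use empty in \<open>auto simp: F_def split: if_splits\<close>)
    show "(x \<in>\<^sub>1 Union1 F) q \<longleftrightarrow> (x \<in>\<^sub>1 B) q"
      unfolding mem_Union1 ST
    proof
      assume *: "\<forall>r\<le>q. \<exists>s\<le>r. (x \<in>\<^sub>1 S) s \<or> (x \<in>\<^sub>1 T) s"
      show "(x \<in>\<^sub>1 B) q"
      proof (rule reg_dense[OF reg_mem_by])
        fix r assume "r \<le> q"
        then obtain s where "s \<le> r" "(x \<in>\<^sub>1 S) s \<or> (x \<in>\<^sub>1 T) s" using * by blast
        moreover from this have "s \<le> p" using \<open>r \<le> q\<close> q order_trans by meson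
        ultimately show "\<exists>s\<le>r. (x \<in>\<^sub>1 B) s" using sub unfolding sub1_iff by meson
      qed
    next
      assume B: "(x \<in>\<^sub>1 B) q"
      show "\<forall>r\<le>q. \<exists>s\<le>r. (x \<in>\<^sub>1 S) s \<or> (x \<in>\<^sub>1 T) s"
        using cov[OF order_trans[OF _ q] regD[OF reg_mem_by B]] by blast
    qed
  qed
  then have "(\<nu> (Union1 F) =\<^sub>0 \<nu> B) p"
    using rad borel_Union[OF bor] unfolding is_radon_iff by simp
  ultimately show ?thesis by (rule near_cong[rotated])
qed

section \<open>Random combinations of point masses\<close>

locale sign_name =
  fixes \<rho> :: "(nat, 'p::preorder) nm" and U :: "nat \<Rightarrow> 'a::boolean_algebra set"
  assumes ultra_U: "\<And>i. ultra (U i)"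
begin

abbreviation X :: "nat \<Rightarrow> ('a, 'p) pnm"
  where "X i \<equiv> check (U i)"

text \<open>\<open>sgnv i s v\<close>: the condition \<open>s\<close> decides that the \<open>i\<close>-th random sign is \<open>v\<close>.\<close>

definition sgnv :: "nat \<Rightarrow> 'p \<Rightarrow> rat \<Rightarrow> bool"
  where "sgnv i s v \<longleftrightarrow> (i \<in>\<^sub>0 \<rho>) s \<and> v = 1 \<or> (\<^bold>\<not> i \<in>\<^sub>0 \<rho>) s \<and> v = - 1"

text \<open>The contribution of the \<open>i\<close>-th point to the unweighted measure of
  \<open>B\<close>, as decided by \<open>s\<close>. A point forced out of \<open>B\<close>
  contributes 0 even if its sign is undecided.\<close>

definition sval :: "nat \<Rightarrow> ('a, 'p) psnm \<Rightarrow> 'p \<Rightarrow> rat \<Rightarrow> bool"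
  where "sval i B s v \<longleftrightarrow> (\<^bold>\<not> X i \<in>\<^sub>1 B) s \<and> v = 0 \<or> (X i \<in>\<^sub>1 B) s \<and> sgnv i s v"

text \<open>The Radon measure \<open>w * (\<Sum>i\<in>I. \<epsilon>\<^sub>i * \<delta>\<^sub>x\<^sub>i)\<close>, where \<open>\<epsilon>\<^sub>i\<close> are the random signs and \<open>x\<^sub>i\<close> is named by \<open>X i\<close>.\<close>

definition nu :: "rat \<Rightarrow> nat set \<Rightarrow> ('a, 'p) psnm \<Rightarrow> 'p rnm"
  where "nu w I B = pw (\<lambda>s v. \<exists>h. (\<forall>i\<in>I. sval i B s (h i)) \<and> v = w * sum h I)"

lemma sgnv_unique: "sgnv i s v \<Longrightarrow> sgnv i s v' \<Longrightarrow> v = v'"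
  using fnotD[OF _ order_refl] unfolding sgnv_def by blast

lemma sgnv_abs: "sgnv i s v \<Longrightarrow> \<bar>v\<bar> = 1"
  unfolding sgnv_def by auto

lemma sgnv_down: "sgnv i s v \<Longrightarrow> r \<le> s \<Longrightarrow> sgnv i r v"
  unfolding sgnv_def using regD[OF reg_mem_by, of _ i \<rho>] down_fnot by metis

lemma sgnv_dense: "\<exists>r\<le>p. \<exists>v. sgnv i r v"
  using decide[of p "i \<in>\<^sub>0 \<rho>"] unfolding sgnv_def by blast

lemma sval_unique: "sval i B s v \<Longrightarrow> sval i B s v' \<Longrightarrow> v = v'"
  using fnotD[OF _ order_refl] sgnv_unique unfolding sval_def by meson

lemma sval_down: "sval i B s v \<Longrightarrow> r \<le> s \<Longrightarrow> sval i B r v"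
  unfolding sval_def using regD[OF reg_mem_by, of _ "X i" B] down_fnot sgnv_down by metis

lemma sval_dense: "\<exists>r\<le>p. \<exists>v. sval i B r v"
proof -
  obtain r v where r: "r \<le> p" "sgnv i r v" using sgnv_dense by blast
  obtain s where s: "s \<le> r" "(X i \<in>\<^sub>1 B) s \<or> (\<^bold>\<not> X i \<in>\<^sub>1 B) s" using decide by blast
  have "\<exists>v. sval i B s v" using s sgnv_down[OF r(2) s(1)] unfolding sval_def by blast
  then show ?thesis using order_trans[OF s(1) r(1)] by blast
qed

lemma sgnv_finite: "finite I \<Longrightarrow> \<exists>r\<le>p. \<exists>g. \<forall>i\<in>I. sgnv i r (g i)"
  using dense_finite[of I p "\<lambda>i r. \<exists>v. sgnv i r v"] sgnv_dense sgnv_down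
  unfolding down_def by metis

lemma sval_finite: "finite I \<Longrightarrow> \<exists>r\<le>p. \<exists>h. \<forall>i\<in>I. sval i B r (h i)"
  using dense_finite[of I p "\<lambda>i r. \<exists>v. sval i B r v"] sval_dense sval_down
  unfolding down_def by metis

lemma sval_cong:
  assumes "(B =\<^sub>1 C) r" "sval i B r v" shows "sval i C r v"
proof -
  have "(X i \<in>\<^sub>1 B) s \<longleftrightarrow> (X i \<in>\<^sub>1 C) s" if "s \<le> r" for s by (rule eq_by_mem[OF assms(1) that])
  then show ?thesis using assms(2) unfolding sval_def fnot_def by auto
qed

lemma near_nu:
  assumes "\<forall>i\<in>I. sval i B p (h i)"
  shows "near (nu w I B) (w * sum h I) 0 p"
  unfolding nu_def
proof (rule near_pw)
  fix s v v'
  assume "\<exists>h. (\<forall>i\<in>I. sval i B s (h i)) \<and> v = w * sum h I" "\<exists>h. (\<forall>i\<in>I. sval i B s (h i)) \<and> v' = w * sum h I"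
  then obtain h h' where "\<forall>i\<in>I. sval i B s (h i)" "v = w * sum h I" "\<forall>i\<in>I. sval i B s (h' i)" "v' = w * sum h' I"
    by blast
  moreover from this have "sum h I = sum h' I" using sval_unique by (intro sum.cong) auto
  ultimately show "v = v'" by simp
next
  show "down (\<lambda>s. \<exists>h. (\<forall>i\<in>I. sval i B s (h i)) \<and> v = w * sum h I)" for v
    using sval_down unfolding down_def by blast
qed (use assms in blast)

lemma is_ultrafilter_X [simp]: "is_ultrafilter (X i) p"
  by (rule is_ultrafilter_check[OF ultra_U])

lemma sval_clop: "sgnv i p v \<Longrightarrow> sval i (clop a) p (if a \<in> U i then v else 0)"
  unfolding sval_def fnot_def by auto

lemma near_nu_clop:
  assumes "\<forall>i\<in>I. sgnv i p (g i)"
  shows "near (nu w I (clop a)) (w * (\<Sum>i\<in>I. if a \<in> U i then g i else 0)) 0 p"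
  by (rule near_nu) (use assms sval_clop in blast)

lemma disjoint_ultra_sum:
  assumes "\<forall>i<length as. \<forall>j<i. inf (as ! i) (as ! j) = bot" "ultra V"
  shows "(\<Sum>k<length as. if as ! k \<in> V then 1 else 0) \<le> (1::rat)"
proof (cases "\<exists>k<length as. as ! k \<in> V")
  case True
  then obtain k where k: "k < length as" "as ! k \<in> V" by blast
  have "as ! j \<notin> V" if "j < length as" "j \<noteq> k" for j
  proof
    assume "as ! j \<in> V"
    then have "inf (as ! k) (as ! j) \<in> V" "inf (as ! j) (as ! k) \<in> V" using assms(2) k unfolding ultra_def by blast+
    moreover have "inf (as ! k) (as ! j) = bot \<or> inf (as ! j) (as ! k) = bot"
      using assms(1) k(1) that by (metis linorder_neqE_nat)
    ultimately show False using assms(2) unfolding ultra_def by auto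
  qed
  then have "(\<Sum>j<length as. if as ! j \<in> V then 1 else (0::rat)) = (\<Sum>j<length as. if j = k then 1 else 0)"
    using k(2) by (intro sum.cong) auto
  then show ?thesis using k by simp
qed simp

lemma nu_is_real:
  assumes "finite I" shows "is_real (nu w I B) p"
proof (rule reg_dense[OF reg_is_real])
  fix q show "\<exists>r\<le>q. is_real (nu w I B) r"
    using sval_finite[OF assms, of q B] near_nu near_is_real by meson
qed

text \<open>An ultrafilter containing the join of two disjoint elements contains exactly one of
  them, which gives additivity. It contains at most one member of any disjoint family, so each point
  adds at most \<open>w\<close> to the variation; this explains the bound
  \<open>w * of_nat (card I)\<close>.\<close>

lemma is_measure_nu:
  assumes I: "finite I" and w: "w \<ge> 0"
  shows "is_measure (\<lambda>a. nu w I (clop a)) p"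
proof -
  have 1: "(nu w I (clop (sup a b)) =\<^sub>0 radd (nu w I (clop a)) (nu w I (clop b))) q"
    if ab: "inf a b = bot" for a b q
  proof (rule reg_dense[OF reg_eq_by])
    fix q
    obtain r g where r: "r \<le> q" "\<forall>i\<in>I. sgnv i r (g i)" using sgnv_finite[OF I] by blast
    have U: "sup a b \<in> U i \<longleftrightarrow> a \<in> U i \<or> b \<in> U i" "\<not> (a \<in> U i \<and> b \<in> U i)" for i
      using ultra_joins[OF ultra_U, of "[a, b]"] ultra_U[of i] ab unfolding ultra_def by (auto, metis)
    have "near (radd (nu w I (clop a)) (nu w I (clop b)))
       (w * (\<Sum>i\<in>I. if a \<in> U i then g i else 0) + w * (\<Sum>i\<in>I. if b \<in> U i then g i else 0)) 0 r"
      using near_radd[OF near_nu_clop[OF r(2), of w a] near_nu_clop[OF r(2), of w b]] by simp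
    moreover have "w * (\<Sum>i\<in>I. if a \<in> U i then g i else 0) + w * (\<Sum>i\<in>I. if b \<in> U i then g i else 0)
       = w * (\<Sum>i\<in>I. if sup a b \<in> U i then g i else 0)"
      unfolding distrib_left[symmetric] sum.distrib[symmetric]
      using U by (intro arg_cong[of _ _ "(*) w"] sum.cong) auto
    ultimately show "\<exists>r\<le>q. (nu w I (clop (sup a b)) =\<^sub>0 radd (nu w I (clop a)) (nu w I (clop b))) r"
      using r near_eq[OF near_nu_clop[OF r(2), of w "sup a b"]] by auto
  qed
  have 2: "rle (rsum (map (\<lambda>a. rabs (nu w I (clop a))) as)) (rrat (w * of_nat (card I))) q"
    if as: "\<forall>i<length as. \<forall>j<i. inf (as ! i) (as ! j) = bot" for as q
  proof (rule reg_dense[OF reg_rle])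
    fix q
    obtain r g where r: "r \<le> q" "\<forall>i\<in>I. sgnv i r (g i)" using sgnv_finite[OF I] by blast
    define c where "c k = \<bar>w * (\<Sum>i\<in>I. if as ! k \<in> U i then g i else 0)\<bar>" for k
    have "near (rsum (map (\<lambda>a. rabs (nu w I (clop a))) as))
        (\<Sum>k<length (map (\<lambda>a. rabs (nu w I (clop a))) as). c k) 0 r"
      unfolding c_def by (rule near_rsum) (use near_rabs[OF near_nu_clop[OF r(2)]] in simp)
    moreover have "(\<Sum>k<length as. c k) \<le> w * of_nat (card I)"
    proof -
      have "c k \<le> w * (\<Sum>i\<in>I. if as ! k \<in> U i then 1 else 0)" for k
      proof -
        have "\<bar>\<Sum>i\<in>I. if as ! k \<in> U i then g i else 0\<bar> \<le> (\<Sum>i\<in>I. if as ! k \<in> U i then 1 else 0)"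
          using r(2) sgnv_abs by (intro order_trans[OF sum_abs] sum_mono) (auto intro: eq_refl)
        then show ?thesis unfolding c_def abs_mult using w by (simp add: mult_left_mono)
      qed
      then have "(\<Sum>k<length as. c k) \<le> (\<Sum>k<length as. w * (\<Sum>i\<in>I. if as ! k \<in> U i then 1 else 0))"
        by (rule sum_mono)
      also have "\<dots> = w * (\<Sum>i\<in>I. \<Sum>k<length as. if as ! k \<in> U i then 1 else 0)"
        unfolding sum_distrib_left[symmetric] by (subst sum.swap) rule
      also have "\<dots> \<le> w * (\<Sum>i\<in>I. 1)"
        using w disjoint_ultra_sum[OF as ultra_U] by (intro mult_left_mono sum_mono) auto
      finally show ?thesis by simp
    qed
    ultimately show "\<exists>r\<le>q. rle (rsum (map (\<lambda>a. rabs (nu w I (clop a))) as)) (rrat (w * of_nat (card I))) r"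
      using r(1) near_rleI by fastforce
  qed
  show ?thesis
    unfolding is_measure_def fand_def fall_def fimp_def fgnd_def fex_def
  proof (intro conjI allI impI)
    fix q :: 'p
    show "\<exists>r\<le>q. \<exists>C. \<forall>as. \<forall>s\<le>r. (\<forall>i<length as. \<forall>j<i. inf (as ! i) (as ! j) = bot) \<longrightarrow>
        rle (rsum (map (\<lambda>a. rabs (nu w I (clop a))) as)) (rrat C) s"
      by (intro exI[of _ q] exI[of _ "w * of_nat (card I)"] conjI allI impI order_refl 2) simp
  qed (use nu_is_real[OF I] 1[unfolded fgnd_def] in simp_all)
qed

section \<open>Finite sets of points, and the Radon property of \<open>nu\<close>\<close>

definition points :: "nat set \<Rightarrow> ('a, 'p) psnm"
  where "points J = {(X i, s) |i s. i \<in> J}"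

lemma mem_points: "(x \<in>\<^sub>1 points J) p \<longleftrightarrow> (\<forall>q\<le>p. \<exists>r\<le>q. \<exists>i\<in>J. (x =\<^sub>0 X i) r)"
  unfolding mem1_iff points_def using order_refl by fastforce

text \<open>An ultrafilter forced to differ from \<open>X i\<close> differs from it at some element;
  that element or its complement lies in \<open>y\<close> but not in \<open>U i\<close>. Meets
  combine finitely many such choices.\<close>

lemma separate_points:
  assumes "finite J" "is_ultrafilter y p" "\<And>i. i \<in> J \<Longrightarrow> (\<^bold>\<not> y =\<^sub>0 X i) p"
  shows "\<exists>r\<le>p. \<exists>b. (b \<in>\<^sub>0 y) r \<and> (\<forall>i\<in>J. b \<notin> U i)"
  using assms(1,3)
proof (induction J rule: finite_induct)
  case empty
  then show ?case using top_in_ultrafilter[OF assms(2)] order_refl by auto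
next
  case (insert i J)
  then obtain r b where r: "r \<le> p" "(b \<in>\<^sub>0 y) r" "\<forall>i\<in>J. b \<notin> U i" by auto
  have "\<exists>s\<le>r. \<exists>c. (c \<in>\<^sub>0 y) s \<and> c \<notin> U i"
  proof -
    have "\<not> (y =\<^sub>0 X i) r" using insert.prems[of i] r(1) unfolding fnot_def by auto
    then obtain a s where s: "s \<le> r" "(a \<in>\<^sub>0 y) s \<noteq> (a \<in> U i)"
      unfolding eq_by_iff mem_check by blast
    show ?thesis
    proof (cases "a \<in> U i")
      case True
      then have "\<not> (a \<in>\<^sub>0 y) s" using s by simp
      then obtain t where t: "t \<le> s" "(\<^bold>\<not> a \<in>\<^sub>0 y) t" by (rule not_forcesE[OF reg_mem_by])
      have "t \<le> p" using t s r order_trans by meson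
      then have "(- a \<in>\<^sub>0 y) t" using t fnot_mem_iff is_ultrafilter_down[OF assms(2)] by blast
      then show ?thesis using True ultra_compl[OF ultra_U] t s order_trans by meson
    qed (use s in auto)
  qed
  then obtain s c where s: "s \<le> r" "(c \<in>\<^sub>0 y) s" "c \<notin> U i" by blast
  have "s \<le> p" using s r order_trans by blast
  then have "(inf b c \<in>\<^sub>0 y) s"
    by (intro ultrafilter_inf is_ultrafilter_down[OF assms(2)] s regD[OF reg_mem_by r(2)])
  moreover have "inf b c \<notin> U k" if "k \<in> insert i J" for k
    using that r(3) s(3) ultra_U[of k] inf_le1[of b c] inf_le2[of b c] unfolding ultra_def by blast
  ultimately show ?case using \<open>s \<le> p\<close> by blast
qed

lemma points_not_mem:
  assumes "(\<^bold>\<not> x \<in>\<^sub>1 points J) p" "i \<in> J" shows "(\<^bold>\<not> x =\<^sub>0 X i) p"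
  unfolding fnot_def
proof (intro allI impI notI)
  fix q assume q: "q \<le> p" "(x =\<^sub>0 X i) q"
  then have "(x \<in>\<^sub>1 points J) q"
    unfolding mem_points using regD[OF reg_eq_by q(2)] assms(2) order_refl by meson
  then show False using assms(1) q(1) unfolding fnot_def by blast
qed

lemma is_closed_points:
  assumes "finite J"
  shows "is_closed (points J) p"
proof -
  have "(points J \<subseteq>\<^sub>1 stone) p"
    unfolding sub1_iff mem_stone
  proof (intro allI impI)
    fix x q assume x: "(x \<in>\<^sub>1 points J) q"
    show "is_ultrafilter x q"
    proof (rule reg_dense[OF reg_is_ultrafilter])
      fix r assume "r \<le> q"
      then obtain s i where "s \<le> r" "(x =\<^sub>0 X i) s" using x unfolding mem_points by blast
      then show "\<exists>r'\<le>r. is_ultrafilter x r'"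
        using is_ultrafilter_cong is_ultrafilter_check[OF ultra_U] by blast
    qed
  qed
  moreover have "is_open (diff1 stone (points J)) p"
    unfolding is_open_iff
  proof (intro conjI allI impI)
    show "(diff1 stone (points J) \<subseteq>\<^sub>1 stone) p" unfolding sub1_iff by simp
  next
    fix x q r assume x: "(x \<in>\<^sub>1 diff1 stone (points J)) q" and rq: "r \<le> q"
    have u: "is_ultrafilter x r" using x rq is_ultrafilter_down by auto
    have "(\<^bold>\<not> x \<in>\<^sub>1 points J) r" using x rq down_fnot by auto
    from separate_points[OF assms u points_not_mem[OF this]]
    obtain s b where s: "s \<le> r" "(b \<in>\<^sub>0 x) s" "\<forall>i\<in>J. b \<notin> U i" by blast
    have "(clop b \<subseteq>\<^sub>1 diff1 stone (points J)) s"
      unfolding sub1_iff mem_diff1 mem_stone mem_clop fnot_def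
    proof (intro allI impI conjI notI)
      fix y t t' assume y: "is_ultrafilter y t \<and> (b \<in>\<^sub>0 y) t" and t': "t' \<le> t" "(y \<in>\<^sub>1 points J) t'"
      obtain t'' i where "t'' \<le> t'" "i \<in> J" "(y =\<^sub>0 X i) t''"
        using dense_ex[OF t'(2)[unfolded mem_points]] by blast
      moreover from this have "(b \<in>\<^sub>0 y) t''" using y t' order_trans regD[OF reg_mem_by] by meson
      ultimately have "b \<in> U i" using eq_by_mem[OF _ order_refl, of _ y "X i" t'' b] by simp
      then show False using s(3) \<open>i \<in> J\<close> by blast
    qed blast
    then show "\<exists>s\<le>r. \<exists>a. is_ultrafilter x s \<and> (a \<in>\<^sub>0 x) s \<and> (clop a \<subseteq>\<^sub>1 diff1 stone (points J)) s"
      using s is_ultrafilter_down[OF u] by blast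
  qed
  ultimately show ?thesis unfolding is_closed_def fand_def by blast
qed

lemma nu_cong:
  assumes "finite I" "(B =\<^sub>1 C) p" shows "(nu w I B =\<^sub>0 nu w I C) p"
proof (rule reg_dense[OF reg_eq_by])
  fix q assume q: "q \<le> p"
  obtain r h where r: "r \<le> q" "\<forall>i\<in>I. sval i B r (h i)" using sval_finite[OF assms(1)] by blast
  have "(B =\<^sub>1 C) r" using regD[OF reg_eq_by assms(2)] r q order_trans by blast
  then have "\<forall>i\<in>I. sval i C r (h i)" using sval_cong r(2) by blast
  from near_eq[OF near_nu[OF r(2), of w] near_nu[OF this, of w]]
  show "\<exists>r\<le>q. (nu w I B =\<^sub>0 nu w I C) r" using r(1) by blast
qed

text \<open>Only finitely many points carry mass. Once a condition has decided for each of them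
  whether it lies in the union and, if so, in which set \<open>B (k i)\<close>, the partial sums are
  constant from the largest \<open>k i\<close> on.\<close>

lemma nu_countably_additive:
  assumes I: "finite I" and dj: "\<And>m n. m < n \<Longrightarrow> disj1 (B m) (B n) p"
  shows "rlim (\<lambda>n. rsum (map (\<lambda>i. nu w I (B i)) [0..<n])) (nu w I (Union1 B)) p"
proof (rule rlimI)
  fix e :: rat and q assume e: "e > 0" and q: "q \<le> p"
  let ?P = "\<lambda>i r. (\<exists>v. sgnv i r v) \<and> ((\<^bold>\<not> X i \<in>\<^sub>1 Union1 B) r \<or> (\<exists>n. (X i \<in>\<^sub>1 B n) r))"
  have "\<exists>r\<le>q. \<forall>i\<in>I. ?P i r"
  proof (rule dense_finite[OF I])
    fix i q'
    obtain r v where r: "r \<le> q'" "sgnv i r v" using sgnv_dense by blast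
    obtain s where s: "s \<le> r" "(X i \<in>\<^sub>1 Union1 B) s \<or> (\<^bold>\<not> X i \<in>\<^sub>1 Union1 B) s" using decide by blast
    have "\<exists>t\<le>s. (\<^bold>\<not> X i \<in>\<^sub>1 Union1 B) t \<or> (\<exists>n. (X i \<in>\<^sub>1 B n) t)"
    proof (cases "(X i \<in>\<^sub>1 Union1 B) s")
      case True
      then show ?thesis using dense_ex[OF True[unfolded mem_Union1]] by blast
    qed (use s(2) order_refl in blast)
    then obtain t where t: "t \<le> s" "(\<^bold>\<not> X i \<in>\<^sub>1 Union1 B) t \<or> (\<exists>n. (X i \<in>\<^sub>1 B n) t)" by blast
    have "t \<le> r" using t s order_trans by blast
    then show "\<exists>r\<le>q'. ?P i r" using t(2) sgnv_down[OF r(2)] r(1) order_trans by meson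
  next
    fix i show "down (?P i)"
      unfolding down_def
    proof (intro allI impI)
      fix p q assume "q \<le> p" "?P i p"
      then show "?P i q"
        using sgnv_down[of i p _ q] down_fnot[of "X i \<in>\<^sub>1 Union1 B" p q]
          regD[OF reg_mem_by, of "(=\<^sub>0)" "X i" _ p q] by blast
    qed
  qed
  then obtain r where r: "r \<le> q" "\<forall>i\<in>I. ?P i r" by blast
  then obtain g where g: "\<forall>i\<in>I. sgnv i r (g i)" by metis
  define T where "T = {i \<in> I. \<exists>n. (X i \<in>\<^sub>1 B n) r}"
  have "\<forall>i\<in>T. \<exists>n. (X i \<in>\<^sub>1 B n) r" unfolding T_def by blast
  from bchoice[OF this] obtain k where k: "\<And>i. i \<in> T \<Longrightarrow> (X i \<in>\<^sub>1 B (k i)) r" by blast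
  have fT: "finite T" "T \<subseteq> I" using I unfolding T_def by auto
  have rp: "r \<le> p" using r q order_trans by blast
  have unm: "(X i \<in>\<^sub>1 Union1 B) s" if "(X i \<in>\<^sub>1 B m) s" for i m s
    unfolding mem_Union1 using regD[OF reg_mem_by that] order_refl by meson
  have U: "sval i (Union1 B) r (if i \<in> T then g i else 0)" if "i \<in> I" for i
    using that g r(2) unm k unfolding sval_def T_def by auto
  have Bm: "sval i (B m) r (if i \<in> T \<and> k i = m then g i else 0)" if "i \<in> I" for i m
  proof (cases "i \<in> T \<and> k i = m")
    case True
    then show ?thesis using that g k[of i] unfolding sval_def by auto
  next
    case False
    have "\<not> (X i \<in>\<^sub>1 B m) s" if s: "s \<le> r" for s
    proof
      assume m: "(X i \<in>\<^sub>1 B m) s"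
      have "s \<le> p" using s rp order_trans by blast
      show False
      proof (cases "i \<in> T")
        case True
        have "(X i \<in>\<^sub>1 B (k i)) s" by (rule regD[OF reg_mem_by k[OF True] s])
        moreover have "k i < m \<or> m < k i" using False True by auto
        ultimately show False using dj m \<open>s \<le> p\<close> unfolding disj1_iff by meson
      next
        case False
        then have "(\<^bold>\<not> X i \<in>\<^sub>1 Union1 B) r" using \<open>i \<in> I\<close> r(2) unfolding T_def by auto
        then show False using unm[OF m] s unfolding fnot_def by blast
      qed
    qed
    then show ?thesis using False unfolding sval_def fnot_def by auto
  qed
  have "rdist_le (rsum (map (\<lambda>i. nu w I (B i)) [0..<n])) (nu w I (Union1 B)) e r" if n: "\<forall>i\<in>T. k i < n" for n
  proof -
    have "near (rsum (map (\<lambda>i. nu w I (B i)) [0..<n]))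
       (\<Sum>m<length (map (\<lambda>i. nu w I (B i)) [0..<n]). w * (\<Sum>i\<in>I. if i \<in> T \<and> k i = m then g i else 0)) 0 r"
      by (rule near_rsum) (use near_nu Bm in simp)
    moreover have "(\<Sum>m<n. w * (\<Sum>i\<in>I. if i \<in> T \<and> k i = m then g i else 0)) = w * (\<Sum>i\<in>I. if i \<in> T then g i else 0)"
    proof -
      have "(\<Sum>m<n. if i \<in> T \<and> k i = m then g i else 0) = (if i \<in> T then g i else 0)" for i
        using n by (cases "i \<in> T") auto
      then show ?thesis unfolding sum_distrib_left[symmetric] by (subst sum.swap) simp
    qed
    moreover have "near (nu w I (Union1 B)) (w * (\<Sum>i\<in>I. if i \<in> T then g i else 0)) 0 r"
      by (rule near_nu) (use U in blast)
    ultimately show ?thesis using e near_rdist_leI by fastforce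
  qed
  \<comment> \<open>The inserted 0 keeps \<open>Max\<close> meaningful when no point lies in the
    union.\<close>
  moreover have "\<forall>n\<ge>Suc (Max (insert 0 (k ` T))). \<forall>i\<in>T. k i < n"
    using fT(1) by (metis Max_ge finite_imageI finite_insert imageI insertCI le_imp_less_Suc order_less_le_trans)
  ultimately show "\<exists>r\<le>q. \<exists>N. \<forall>n\<ge>N. rdist_le (rsum (map (\<lambda>i. nu w I (B i)) [0..<n])) (nu w I (Union1 B)) e r"
    using r(1) by blast
qed

text \<open>The points of the support that lie in \<open>B\<close> form a finite, hence closed, set,
  and nothing is left of the measure on the rest of \<open>B\<close>: the variation there is 0,
  whatever \<open>e\<close> is.\<close>

lemma nu_inner_regular:
  assumes I: "finite I" and e: "0 < e"
  shows "\<exists>s\<le>p. \<exists>K. is_closed K s \<and> (K \<subseteq>\<^sub>1 B) s \<and> var_le (nu w I) (diff1 B K) e s"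
proof -
  have "\<exists>s\<le>p. \<forall>i\<in>I. (X i \<in>\<^sub>1 B) s \<or> (\<^bold>\<not> X i \<in>\<^sub>1 B) s"
  proof (rule dense_finite[OF I])
    show "down (\<lambda>s. (X i \<in>\<^sub>1 B) s \<or> (\<^bold>\<not> X i \<in>\<^sub>1 B) s)" for i
      unfolding down_def by (metis regD[OF reg_mem_by] down_fnot)
  qed (rule decide)
  then obtain s where s: "s \<le> p" "\<forall>i\<in>I. (X i \<in>\<^sub>1 B) s \<or> (\<^bold>\<not> X i \<in>\<^sub>1 B) s" by blast
  define J where "J = {i \<in> I. (X i \<in>\<^sub>1 B) s}"
  have "finite J" using I unfolding J_def by simp
  have sub: "(points J \<subseteq>\<^sub>1 B) s" unfolding sub1_iff
  proof (intro allI impI)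
    fix x q assume q: "q \<le> s" "(x \<in>\<^sub>1 points J) q"
    show "(x \<in>\<^sub>1 B) q"
    proof (rule reg_dense[OF reg_mem_by])
      fix r assume r: "r \<le> q"
      then obtain t i where t: "t \<le> r" "i \<in> J" "(x =\<^sub>0 X i) t" using q(2) unfolding mem_points by blast
      have "t \<le> s" using t r q order_trans by meson
      then have "(X i \<in>\<^sub>1 B) t" using t(2) regD[OF reg_mem_by, of "(=\<^sub>0)" "X i" B s t] unfolding J_def by blast
      then show "\<exists>r'\<le>r. (x \<in>\<^sub>1 B) r'" using mem_by_cong[OF eq_by_sym[OF t(3)]] t(1) by blast
    qed
  qed
  have "var_le (nu w I) (diff1 B (points J)) e s" unfolding var_le_iff
  proof (intro allI impI)
    fix Bs q assume q: "q \<le> s" and Bs: "\<forall>k<length Bs. (Bs ! k \<subseteq>\<^sub>1 diff1 B (points J)) q"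
    have "sval i (Bs ! k) q 0" if "k < length Bs" "i \<in> I" for k i
    proof -
      have "\<not> (X i \<in>\<^sub>1 Bs ! k) t" if t: "t \<le> q" for t
      proof
        assume "(X i \<in>\<^sub>1 Bs ! k) t"
        then have m: "(X i \<in>\<^sub>1 B) t" "(\<^bold>\<not> X i \<in>\<^sub>1 points J) t"
          using Bs \<open>k < length Bs\<close> t unfolding sub1_iff mem_diff1 by blast+
        have "i \<in> J" using m(1) s(2) \<open>i \<in> I\<close> order_trans[OF t q] unfolding J_def fnot_def by blast
        from points_not_mem[OF m(2) this] show False using eq_by_refl order_refl unfolding fnot_def by blast
      qed
      then show ?thesis unfolding sval_def fnot_def by blast
    qed
    then have nz: "near (nu w I (Bs ! k)) 0 0 q" if "k < length Bs" for k
      using near_nu[of I "Bs ! k" q "\<lambda>_. 0" w] that by simp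
    have "near (rsum (map (\<lambda>B. rabs (nu w I B)) Bs)) (\<Sum>k<length (map (\<lambda>B. rabs (nu w I B)) Bs). 0) 0 q"
      by (rule near_rsum) (use near_rabs[OF nz] in simp)
    then show "rle (rsum (map (\<lambda>B. rabs (nu w I B)) Bs)) (rrat e) q"
      by (rule near_rleI) (use e in simp)
  qed
  then show ?thesis using s(1) sub is_closed_points[OF \<open>finite J\<close>] by blast
qed

lemma is_radon_nu: "finite I \<Longrightarrow> is_radon (nu w I) p"
  unfolding is_radon_iff
  by (intro conjI allI impI nu_is_real nu_cong nu_countably_additive nu_inner_regular) auto

end

section \<open>Random signs\<close>

text \<open>The Rademacher functions on the Cantor space.\<close>

definition rad :: "(nat \<Rightarrow> bool) \<Rightarrow> nat \<Rightarrow> real"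
  where "rad s i = (if s i then 1 else - 1)"

lemma space_cantor [simp]: "space cantor_measure = UNIV"
  by (simp add: cantor_measure_def space_PiM)

lemma prob_space_cantor: "prob_space cantor_measure"
  unfolding cantor_measure_def by (intro prob_space_PiM) (simp add: measure_pmf.prob_space_axioms)

interpretation cantor: prob_space cantor_measure
  by (rule prob_space_cantor)

lemma prob_cantor_UNIV [simp]: "measure cantor_measure UNIV = 1"
  using cantor.prob_space by simp

lemma measurable_cantor_coord [measurable]: "Measurable.pred cantor_measure (\<lambda>s. s i)"
proof -
  have "(\<lambda>s. s i) \<in> measurable cantor_measure (measure_pmf (bernoulli_pmf (1/2)))"
    unfolding cantor_measure_def by (rule measurable_component_singleton) simp
  then show ?thesis by (simp add: measurable_def)
qed

lemma measure_cantor_all: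
  assumes "finite J"
  shows "measure cantor_measure {s. \<forall>i\<in>J. s i} = (1/2) ^ card J"
proof -
  interpret P: product_prob_space "\<lambda>_. measure_pmf (bernoulli_pmf (1/2))" "UNIV :: nat set"
    by unfold_locales
  have "emeasure cantor_measure {s\<in>space cantor_measure. \<forall>i\<in>J. s i \<in> {True}} =
      (\<Prod>i\<in>J. emeasure (measure_pmf (bernoulli_pmf (1/2))) {True})"
    unfolding cantor_measure_def by (rule P.emeasure_PiM_Collect) (use assms in auto)
  also have "emeasure (measure_pmf (bernoulli_pmf (1/2))) {True} = ennreal (1/2)"
    by (subst emeasure_pmf_single) simp
  also have "(\<Prod>i\<in>J. ennreal (1/2)) = ennreal ((1/2) ^ card J)"
    unfolding prod_constant by (rule ennreal_power) simp
  finally show ?thesis unfolding cantor.emeasure_eq_measure by simp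
qed

lemma integral_rad_mult:
  assumes "i \<noteq> j"
  shows "(\<integral>s. rad s i * rad s j \<partial>cantor_measure) = 0"
proof -
  define f :: "nat set \<Rightarrow> (nat \<Rightarrow> bool) \<Rightarrow> real" where "f J = indicator {s. \<forall>i\<in>J. s i}" for J
  have meas: "{s. \<forall>i\<in>J. s i} \<in> sets cantor_measure" if "finite J" for J
  proof -
    have "{s\<in>space cantor_measure. \<forall>i\<in>J. s i} \<in> sets cantor_measure" using that by measurable
    then show ?thesis by simp
  qed
  have f: "integrable cantor_measure (f J)" "integral\<^sup>L cantor_measure (f J) = (1/2) ^ card J" if "finite J" for J
    using meas[OF that] measure_cantor_all[OF that] unfolding f_def
    by (auto simp: less_top[symmetric])
  \<comment> \<open>A Rademacher function is twice the indicator of a cylinder minus 1; expanding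
    \<open>(2 * x - 1) * (2 * y - 1)\<close> reduces orthogonality to measures of cylinders.\<close>
  have "rad s i * rad s j = 4 * f {i, j} s - 2 * f {i} s - 2 * f {j} s + 1" for s
    by (auto simp: rad_def f_def)
  then have "(\<integral>s. rad s i * rad s j \<partial>cantor_measure) =
      (\<integral>s. 4 * f {i, j} s - 2 * f {i} s - 2 * f {j} s + 1 \<partial>cantor_measure)" by simp
  also have "\<dots> = 4 * (1/2)^card {i, j} - 2 * (1/2)^card {i} - 2 * (1/2)^card {j} + 1"
    using f by simp
  finally show ?thesis using assms by (simp add: power2_eq_square)
qed

lemma measurable_rad [measurable]: "(\<lambda>s. rad s i) \<in> borel_measurable cantor_measure"
  unfolding rad_def by measurable

lemma integrable_rad_mult: "integrable cantor_measure (\<lambda>s. rad s i * rad s j)"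
  by (rule cantor.integrable_const_bound[of _ 1]) (auto simp: rad_def)

text \<open>The Rademacher functions are orthonormal, so the second moment of the sum is the sum of
  the squared coefficients; the bound is then Chebyshev's inequality.\<close>

lemma rad_chebyshev:
  assumes "finite I" "a > 0"
  shows "measure cantor_measure {s. a \<le> \<bar>\<Sum>i\<in>I. c i * rad s i\<bar>} \<le> (\<Sum>i\<in>I. (c i)\<^sup>2) / a\<^sup>2"
proof -
  have sq: "(\<Sum>i\<in>I. c i * rad s i)\<^sup>2 = (\<Sum>i\<in>I. \<Sum>j\<in>I. (c i * c j) * (rad s i * rad s j))" for s
    by (simp add: power2_eq_square sum_product algebra_simps)
  have int: "integrable cantor_measure (\<lambda>s. (\<Sum>i\<in>I. c i * rad s i)\<^sup>2)"
    unfolding sq by (intro Bochner_Integration.integrable_sum integrable_mult_right integrable_rad_mult)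
  have "(\<integral>s. (\<Sum>i\<in>I. c i * rad s i)\<^sup>2 \<partial>cantor_measure) =
      (\<Sum>i\<in>I. \<Sum>j\<in>I. (c i * c j) * (\<integral>s. rad s i * rad s j \<partial>cantor_measure))"
    unfolding sq using integrable_rad_mult by (simp add: Bochner_Integration.integral_sum)
  also have "\<dots> = (\<Sum>i\<in>I. \<Sum>j\<in>I. if j = i then (c i)\<^sup>2 else 0)"
  proof (intro sum.cong refl)
    fix i j
    have "(\<integral>s. rad s i * rad s i \<partial>cantor_measure) = 1"
    proof -
      have "rad s i * rad s i = 1" for s by (simp add: rad_def)
      then show ?thesis by simp
    qed
    then show "c i * c j * (\<integral>s. rad s i * rad s j \<partial>cantor_measure) = (if j = i then (c i)\<^sup>2 else 0)"
      using integral_rad_mult[of i j] by (auto simp: power2_eq_square)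
  qed
  also have "\<dots> = (\<Sum>i\<in>I. (c i)\<^sup>2)" using assms(1) by simp
  finally show ?thesis
    using cantor.second_moment_method[of "\<lambda>s. \<Sum>i\<in>I. c i * rad s i" a] int assms(2) by simp
qed

subsection \<open>Codes for finitely determined sets\<close>

text \<open>A filler for the sequences required by \<open>CUnion\<close>, which has to be built as
  the complement of a tautological union.\<close>

definition bempty :: bcode
  where "bempty = Compl (CUnion (\<lambda>n. if n = 0 then Cyl 0 else Compl (Cyl 0)))"

text \<open>An intersection in De Morgan form: the union collects, over the coordinates in
  \<open>I\<close>, the points that violate the pattern \<open>t\<close> there.\<close>

definition cyl :: "nat set \<Rightarrow> nat set \<Rightarrow> bcode"
  where "cyl I t = Compl (CUnion (\<lambda>m. if m \<in> I then (if m \<in> t then Compl (Cyl m) else Cyl m) else bempty))"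

lemma bset_bempty [simp]: "bset bempty = {}"
proof -
  have "s \<in> bset (if s 0 then Cyl 0 else Compl (Cyl 0))" for s by simp
  then have "\<exists>n. s \<in> bset (if n = (0::nat) then Cyl 0 else Compl (Cyl 0))" for s
    by (intro exI[of _ "if s 0 then 0 else 1"]) simp
  then show ?thesis unfolding bempty_def by auto
qed

lemma bset_cyl: "bset (cyl I t) = {s. \<forall>m\<in>I. s m \<longleftrightarrow> m \<in> t}"
proof -
  have "s \<in> bset (if m \<in> I then (if m \<in> t then Compl (Cyl m) else Cyl m) else bempty) \<longleftrightarrow>
      m \<in> I \<and> (s m \<longleftrightarrow> m \<notin> t)" for s m by simp
  then show ?thesis unfolding cyl_def by auto
qed

lemma in_code_bempty: "\<not> in_code r bempty p"
proof
  let ?F = "\<lambda>n::nat. if n = 0 then Cyl 0 else Compl (Cyl 0)"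
  assume "in_code r bempty p"
  then have "(\<^bold>\<not> (\<^bold>\<exists>n. in_code r (?F n))) p" by (simp add: bempty_def)
  moreover have "(\<^bold>\<exists>n. in_code r (?F n)) p" unfolding fex_def
  proof (intro allI impI)
    fix q assume "q \<le> p"
    obtain s where "s \<le> q" "in_code r (Cyl 0) s \<or> in_code r (Compl (Cyl 0)) s"
      using decide[of q "in_code r (Cyl 0)"] by auto
    then have "s \<le> q" "in_code r (?F 0) s \<or> in_code r (?F 1) s" by auto
    then show "\<exists>s\<le>q. \<exists>n. in_code r (?F n) s" by blast
  qed
  ultimately show False using fnotD order_refl by blast
qed

context sign_name
begin

text \<open>Connects decided signs with Borel codes: the pattern decided on \<open>I\<close> selects
  a cylinder whose reinterpretation contains the random real.\<close>

lemma in_code_cyl: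
  assumes "\<forall>i\<in>I. sgnv i p (g i)"
  shows "in_code \<rho> (cyl I {i\<in>I. g i = 1}) p"
proof -
  let ?F = "\<lambda>m. if m \<in> I then (if m \<in> {i\<in>I. g i = 1} then Compl (Cyl m) else Cyl m) else bempty"
  have "\<not> (\<^bold>\<exists>m. in_code \<rho> (?F m)) q" if q: "q \<le> p" for q
  proof
    assume "(\<^bold>\<exists>m. in_code \<rho> (?F m)) q"
    from dense_ex[OF this[unfolded fex_def]] obtain r m where r: "r \<le> q" "in_code \<rho> (?F m) r" by blast
    have m: "m \<in> I" using r(2) in_code_bempty by (auto split: if_splits)
    have s: "sgnv m r (g m)" using assms m sgnv_down order_trans[OF r(1) q] by blast
    show False
    proof (cases "g m = 1")
      case True
      then show False using r(2) m s fnotD[OF _ order_refl] unfolding sgnv_def by auto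
    next
      case False
      then show False using r(2) m s fnotD[OF _ order_refl] unfolding sgnv_def by auto
    qed
  qed
  then show ?thesis unfolding cyl_def in_code.simps fnot_def by blast
qed

text \<open>The only place where randomness enters. \<open>A n\<close> is the event that the
  \<open>n\<close>-th weighted sum is at least \<open>e\<close>; Chebyshev bounds its measure by a
  constant multiple of the summable term, so by Borel-Cantelli \<open>limsup A\<close> is null. As
  \<open>b\<close>, \<open>w\<close> and \<open>I\<close> are in V, this set has a code in V, and
  the random real avoids it: some \<open>r\<close> forces all events from an \<open>N\<close> on to
  fail. The conclusion speaks of decided signs, which is the form that \<open>near_nu\<close> can
  use.\<close>

lemma random_null_sums:
  assumes random: "random_over_V \<rho> p" and I: "\<And>n. finite (I n)" and b: "\<And>i. \<bar>b i\<bar> \<le> C"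
    and sm: "summable (\<lambda>n. (real_of_rat (w n))\<^sup>2 * card (I n))" and e: "e > 0"
  shows "\<exists>r\<le>p. \<exists>N. \<forall>n\<ge>N. \<forall>q\<le>r. \<forall>g. (\<forall>i\<in>I n. sgnv i q (g i)) \<longrightarrow> \<bar>w n * (\<Sum>i\<in>I n. g i * b i)\<bar> \<le> e"
proof -
  define bad where "bad n t \<longleftrightarrow> e \<le> \<bar>w n * (\<Sum>i\<in>I n. (if i \<in> t then 1 else - 1) * b i)\<bar>" for n and t :: "nat set"
  \<comment> \<open>A code for \<open>A n\<close>: the finite sign patterns are enumerated by
    \<open>set_decode\<close>. Only their trace on \<open>I n\<close> matters, so each relevant
    cylinder may occur many times.\<close>
  define d where "d n = CUnion (\<lambda>m. if bad n (set_decode m) then cyl (I n) (set_decode m) else bempty)" for n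
  define A where "A n = {s. real_of_rat e \<le> \<bar>\<Sum>i\<in>I n. real_of_rat (w n * b i) * rad s i\<bar>}" for n
  have bad_cong: "bad n t \<longleftrightarrow> bad n t'" if "\<And>i. i \<in> I n \<Longrightarrow> i \<in> t \<longleftrightarrow> i \<in> t'" for n t t'
    unfolding bad_def using that by (intro arg_cong[of _ _ "\<lambda>x. e \<le> \<bar>w n * x\<bar>"] sum.cong) auto
  have bad_A: "bad n {i. s i} \<longleftrightarrow> s \<in> A n" for n s
  proof -
    have "real_of_rat (w n * (\<Sum>i\<in>I n. (if i \<in> {i. s i} then 1 else - 1) * b i)) =
        (\<Sum>i\<in>I n. real_of_rat (w n * b i) * rad s i)"
      unfolding of_rat_mult of_rat_sum sum_distrib_left
      by (intro sum.cong) (auto simp: rad_def of_rat_minus)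
    moreover have "e \<le> \<bar>x\<bar> \<longleftrightarrow> real_of_rat e \<le> \<bar>real_of_rat x\<bar>" for x
      by (simp only: abs_of_rat of_rat_less_eq)
    ultimately show ?thesis unfolding bad_def A_def by (simp only: mem_Collect_eq)
  qed
  have bset_d: "bset (d n) = A n" for n
  proof (intro set_eqI iffI)
    fix s assume "s \<in> bset (d n)"
    then obtain m where m: "s \<in> bset (if bad n (set_decode m) then cyl (I n) (set_decode m) else bempty)"
      unfolding d_def by auto
    then have "bad n (set_decode m)" "\<forall>i\<in>I n. s i \<longleftrightarrow> i \<in> set_decode m"
      by (auto simp: bset_cyl split: if_splits)
    then show "s \<in> A n" using bad_cong[of n "set_decode m" "{i. s i}"] bad_A by auto
  next
    fix s assume s: "s \<in> A n"
    define m where "m = set_encode {i\<in>I n. s i}"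
    have m: "set_decode m = {i\<in>I n. s i}" unfolding m_def using I by simp
    have "bad n (set_decode m)" using s bad_cong[of n "{i. s i}" "set_decode m"] bad_A unfolding m by auto
    then have "s \<in> bset (if bad n (set_decode m) then cyl (I n) (set_decode m) else bempty)"
      using m by (auto simp: bset_cyl)
    then show "s \<in> bset (d n)" unfolding d_def bset.simps by (rule UN_I[OF UNIV_I])
  qed
  have "limsup A \<in> null_sets cantor_measure"
  proof (rule borel_cantelli_limsup1)
    show "A n \<in> sets cantor_measure" for n using range_bset bset_d by (metis rangeI)
    show "emeasure cantor_measure (A n) < \<infinity>" for n by (simp add: less_top[symmetric])
    have le: "measure cantor_measure (A n) \<le> (real_of_rat C)\<^sup>2 / (real_of_rat e)\<^sup>2 * ((real_of_rat (w n))\<^sup>2 * card (I n))" for n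
    proof -
      have "measure cantor_measure (A n) \<le> (\<Sum>i\<in>I n. (real_of_rat (w n * b i))\<^sup>2) / (real_of_rat e)\<^sup>2"
        unfolding A_def by (rule rad_chebyshev) (use I e in auto)
      also have "(\<Sum>i\<in>I n. (real_of_rat (w n * b i))\<^sup>2) \<le> (\<Sum>i\<in>I n. (real_of_rat (w n))\<^sup>2 * (real_of_rat C)\<^sup>2)"
      proof (rule sum_mono)
        fix i
        have "(b i)\<^sup>2 \<le> C\<^sup>2" using b[of i] by (metis abs_ge_zero power2_abs power_mono)
        then have "(real_of_rat (b i))\<^sup>2 \<le> (real_of_rat C)\<^sup>2" by (metis of_rat_less_eq of_rat_power)
        then show "(real_of_rat (w n * b i))\<^sup>2 \<le> (real_of_rat (w n))\<^sup>2 * (real_of_rat C)\<^sup>2"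
          by (simp add: of_rat_mult power_mult_distrib mult_left_mono)
      qed
      finally show ?thesis by (simp add: divide_right_mono algebra_simps)
    qed
    show "summable (\<lambda>n. measure cantor_measure (A n))"
      by (rule summable_comparison_test'[OF summable_mult[OF sm, of "(real_of_rat C)\<^sup>2 / (real_of_rat e)\<^sup>2"], of 0])
        (use le in \<open>simp add: measure_nonneg\<close>)
  qed
  \<comment> \<open>The limes superior as the intersection over \<open>N\<close> of the unions of
    \<open>d (N + k)\<close>, with the intersection expressed by complements.\<close>
  moreover define c where "c = Compl (CUnion (\<lambda>N. Compl (CUnion (\<lambda>k. d (N + k)))))"
  have "bset c = limsup A"
    unfolding c_def limsup_INF_SUP by (auto simp: bset_d) (metis le_iff_add atLeast_iff)+
  ultimately have "bset c \<in> null_sets cantor_measure" by simp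
  then have "(\<^bold>\<not> in_code \<rho> c) p"
    using random order_refl unfolding random_over_V_def fall_def fimp_def fgnd_def by blast
  then have "(\<^bold>\<not> (\<^bold>\<not> (\<^bold>\<exists>N. \<^bold>\<not> (\<^bold>\<exists>k. in_code \<rho> (d (N + k)))))) p" by (simp add: c_def)
  then have "(\<^bold>\<exists>N. \<^bold>\<not> (\<^bold>\<exists>k. in_code \<rho> (d (N + k)))) p" using fnot_fnot[OF reg_fex] by blast
  from dense_ex[OF this[unfolded fex_def[of "\<lambda>N. \<^bold>\<not> (\<^bold>\<exists>k. in_code \<rho> (d (N + k)))"]]]
  obtain r N where r: "r \<le> p" "(\<^bold>\<not> (\<^bold>\<exists>k. in_code \<rho> (d (N + k)))) r" by blast
  have "\<bar>w n * (\<Sum>i\<in>I n. g i * b i)\<bar> \<le> e" if n: "n \<ge> N" and q: "q \<le> r" and g: "\<forall>i\<in>I n. sgnv i q (g i)" for n q g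
  proof (rule ccontr)
    assume large: "\<not> ?thesis"
    define t where "t = {i\<in>I n. g i = 1}"
    have "(\<Sum>i\<in>I n. (if i \<in> t then 1 else - 1) * b i) = (\<Sum>i\<in>I n. g i * b i)"
      using g by (intro sum.cong) (auto simp: t_def sgnv_def)
    then have bad: "bad n t" using large unfolding bad_def by simp
    have "finite t" using I unfolding t_def by simp
    then have t: "set_decode (set_encode t) = t" by simp
    have "in_code \<rho> (cyl (I n) t) s" if "s \<le> q" for s
      unfolding t_def by (rule in_code_cyl) (use g sgnv_down that in blast)
    then have "in_code \<rho> (if bad n (set_decode (set_encode t)) then cyl (I n) (set_decode (set_encode t)) else bempty) s"
      if "s \<le> q" for s using that bad t by simp
    then have dn: "in_code \<rho> (d n) s" if "s \<le> q" for s
      unfolding d_def in_code.simps fex_def using that order_trans order_refl by meson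
    have "(\<^bold>\<exists>k. in_code \<rho> (d (N + k))) q" unfolding fex_def
    proof (intro allI impI)
      fix s assume "s \<le> q"
      then show "\<exists>s'\<le>s. \<exists>k. in_code \<rho> (d (N + k)) s'"
        using dn n order_refl[of s] by (metis le_add_diff_inverse)
    qed
    then show False using r(2) q unfolding fnot_def by blast
  qed
  then show ?thesis using r(1) by blast
qed

subsection \<open>Uniqueness of Radon extensions\<close>

text \<open>A point of \<open>B\<close> has a clopen neighbourhood missing \<open>L\<close> and the
  support points outside \<open>B\<close> (\<open>P\<close>); a point outside \<open>B\<close> has
  one missing \<open>K\<close> and the support points in \<open>B\<close> (\<open>Q\<close>). By
  compactness finitely many of these cover the space. The resulting \<open>a\<close> imitates
  \<open>B\<close>: it contains \<open>K\<close>, misses \<open>L\<close>, and agrees with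
  \<open>B\<close> on the support of \<open>nu\<close>.\<close>

lemma separating_element:
  assumes I: "finite I" and u: "u \<subseteq> I" and K: "is_closed K p" "is_closed L p"
    and B: "(K \<subseteq>\<^sub>1 B) p" "(L \<subseteq>\<^sub>1 diff1 stone B) p"
    and XB: "\<And>i. i \<in> I \<Longrightarrow> if i \<in> u then (X i \<in>\<^sub>1 B) p else (\<^bold>\<not> X i \<in>\<^sub>1 B) p"
  shows "\<exists>r\<le>p. \<exists>a. (K \<subseteq>\<^sub>1 clop a) r \<and> disj1 (clop a) L r \<and> (\<forall>i\<in>I. a \<in> U i \<longleftrightarrow> i \<in> u)"
proof -
  define P where "P b r \<longleftrightarrow> disj1 (clop b) L r \<and> (\<forall>i\<in>I - u. b \<notin> U i)" for b r
  define Q where "Q b r \<longleftrightarrow> disj1 (clop b) K r \<and> (\<forall>i\<in>u. b \<notin> U i)" for b r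
  have sep: "\<exists>s\<le>r. \<exists>b. (b \<in>\<^sub>0 y) s \<and> disj1 (clop b) M s \<and> (\<forall>i\<in>J. b \<notin> U i)"
    if "is_closed M r" "is_ultrafilter y r" "(\<^bold>\<not> y \<in>\<^sub>1 M) r" "finite J" "\<And>i. i \<in> J \<Longrightarrow> (\<^bold>\<not> y =\<^sub>0 X i) r" for r y M J
  proof -
    from is_closedD[OF that(1-3)] obtain s b where s: "s \<le> r" "(b \<in>\<^sub>0 y) s" "disj1 (clop b) M s" by blast
    have us: "is_ultrafilter y s" by (rule is_ultrafilter_down[OF that(2) s(1)])
    from separate_points[OF that(4) us down_fnot[OF that(5) s(1)]]
    obtain t c where t: "t \<le> s" "(c \<in>\<^sub>0 y) t" "\<forall>i\<in>J. c \<notin> U i" by blast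
    have "(inf b c \<in>\<^sub>0 y) t"
      by (rule ultrafilter_inf[OF is_ultrafilter_down[OF us t(1)] regD[OF reg_mem_by s(2) t(1)] t(2)])
    moreover have "disj1 (clop (inf b c)) M t"
      unfolding disj1_iff mem_clop
    proof (intro allI impI notI)
      fix x q assume q: "q \<le> t" "(is_ultrafilter x q \<and> (inf b c \<in>\<^sub>0 x) q) \<and> (x \<in>\<^sub>1 M) q"
      then have "(b \<in>\<^sub>0 x) q" using ultrafilter_up[of x q "inf b c" b] by simp
      then show False using s(3) q order_trans[OF q(1) t(1)] unfolding disj1_iff mem_clop by blast
    qed
    moreover have "inf b c \<notin> U i" if "i \<in> J" for i
      using t(3) that ultra_U[of i] inf_le2[of b c] unfolding ultra_def by blast
    ultimately show ?thesis using order_trans[OF t(1) s(1)] by blast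
  qed
  have "\<exists>r\<le>p. \<exists>as. (\<forall>b\<in>set as. P b r \<or> Q b r) \<and> joins as = top"
  proof (rule stone_compact)
    show "down (\<lambda>r. P b r \<or> Q b r)" for b
      unfolding down_def P_def Q_def using regD[OF reg_disj1] by blast
  next
    fix y :: "('a, 'p) nm" and q assume q: "q \<le> p" "is_ultrafilter y q"
    obtain r where r: "r \<le> q" "(y \<in>\<^sub>1 B) r \<or> (\<^bold>\<not> y \<in>\<^sub>1 B) r" using decide by blast
    have rp: "r \<le> p" using r q order_trans by blast
    have ur: "is_ultrafilter y r" by (rule is_ultrafilter_down[OF q(2) r(1)])
    have "\<exists>s\<le>r. \<exists>b. (b \<in>\<^sub>0 y) s \<and> (P b s \<or> Q b s)"
    proof (cases "(y \<in>\<^sub>1 B) r")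
      case True
      have "(\<^bold>\<not> y \<in>\<^sub>1 L) r" unfolding fnot_def
      proof (intro allI impI notI)
        fix s assume s: "s \<le> r" "(y \<in>\<^sub>1 L) s"
        then have "(\<^bold>\<not> y \<in>\<^sub>1 B) s" using B(2) order_trans[OF s(1) rp] unfolding sub1_iff mem_diff1 by blast
        then show False using regD[OF reg_mem_by True s(1)] fnotD order_refl by blast
      qed
      moreover have "(\<^bold>\<not> y =\<^sub>0 X i) r" if "i \<in> I - u" for i unfolding fnot_def
      proof (intro allI impI notI)
        fix s assume s: "s \<le> r" "(y =\<^sub>0 X i) s"
        then have "(X i \<in>\<^sub>1 B) s" using mem_by_cong[OF s(2) regD[OF reg_mem_by True s(1)]] by blast
        then show False using XB[of i] that fnotD[OF _ order_trans[OF s(1) rp]] by auto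
      qed
      ultimately show ?thesis
        using sep[OF regD[OF reg_is_closed K(2) rp] ur, of "I - u"] I unfolding P_def by blast
    next
      case False
      then have nB: "(\<^bold>\<not> y \<in>\<^sub>1 B) r" using r(2) by blast
      have "(\<^bold>\<not> y \<in>\<^sub>1 K) r"
        using nB B(1) order_trans[OF _ rp] unfolding fnot_def sub1_iff by blast
      moreover have "(\<^bold>\<not> y =\<^sub>0 X i) r" if "i \<in> u" for i unfolding fnot_def
      proof (intro allI impI notI)
        fix s assume s: "s \<le> r" "(y =\<^sub>0 X i) s"
        have "(X i \<in>\<^sub>1 B) p" using XB[of i] that u by auto
        from regD[OF reg_mem_by this order_trans[OF s(1) rp]]
        have "(y \<in>\<^sub>1 B) s" by (rule mem_by_cong[OF eq_by_sym[OF s(2)]])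
        then show False using fnotD[OF nB s(1)] by blast
      qed
      ultimately show ?thesis
        using sep[OF regD[OF reg_is_closed K(1) rp] ur, of u] I finite_subset[OF u] unfolding Q_def by blast
    qed
    then show "\<exists>s\<le>q. \<exists>b. (P b s \<or> Q b s) \<and> (b \<in>\<^sub>0 y) s" using order_trans[OF _ r(1)] by blast
  qed
  then obtain r as where r: "r \<le> p" "\<forall>b\<in>set as. P b r \<or> Q b r" "joins as = top" by blast
  \<comment> \<open>Only neighbourhoods of the first kind are joined. A point of \<open>K\<close>,
    or a support point in \<open>B\<close>, lies in none of the second kind, so the cover puts it
    into \<open>a\<close>.\<close>
  define a where "a = joins (filter (\<lambda>b. P b r) as)"
  have "(K \<subseteq>\<^sub>1 clop a) r" unfolding sub1_iff mem_clop
  proof (intro allI impI)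
    fix y q assume q: "q \<le> r" "(y \<in>\<^sub>1 K) q"
    have uy: "is_ultrafilter y q"
      using K(1) q order_trans[OF q(1) r(1)] unfolding is_closed_def fand_def sub1_iff by auto
    have "(a \<in>\<^sub>0 y) q"
    proof (rule reg_dense[OF reg_mem_by])
      fix s assume s: "s \<le> q"
      have us: "is_ultrafilter y s" by (rule is_ultrafilter_down[OF uy s])
      obtain t b where t: "t \<le> s" "b \<in> set as" "(b \<in>\<^sub>0 y) t"
        using ultrafilter_joins[OF us, of as] top_in_ultrafilter[OF us] r(3) by auto
      have ut: "is_ultrafilter y t" by (rule is_ultrafilter_down[OF us t(1)])
      have tq: "t \<le> q" using t s order_trans by blast
      have "\<not> Q b r"
        using regD[OF reg_mem_by q(2) tq] t(3) ut order_trans[OF tq q(1)] unfolding Q_def disj1_iff mem_clop by blast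
      then have "b \<le> a" using r(2) t(2) unfolding a_def by (intro joins_upper) auto
      then show "\<exists>t\<le>s. (a \<in>\<^sub>0 y) t" using ultrafilter_up[OF ut t(3)] t(1) by blast
    qed
    then show "is_ultrafilter y q \<and> (a \<in>\<^sub>0 y) q" using uy by blast
  qed
  moreover have "disj1 (clop a) L r" unfolding disj1_iff mem_clop
  proof (intro allI impI notI)
    fix y q assume q: "q \<le> r" "(is_ultrafilter y q \<and> (a \<in>\<^sub>0 y) q) \<and> (y \<in>\<^sub>1 L) q"
    then obtain s b where s: "s \<le> q" "b \<in> set (filter (\<lambda>b. P b r) as)" "(b \<in>\<^sub>0 y) s"
      using ultrafilter_joins[of y q] unfolding a_def by blast
    have "is_ultrafilter y s" "(y \<in>\<^sub>1 L) s"
      by (rule is_ultrafilter_down[OF _ s(1)], use q(2) in blast)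
        (rule regD[OF reg_mem_by conjunct2[OF q(2)] s(1)])
    then show False using s(2,3) order_trans[OF s(1) q(1)] unfolding P_def disj1_iff mem_clop by auto
  qed
  moreover have "a \<in> U i \<longleftrightarrow> i \<in> u" if i: "i \<in> I" for i
  proof -
    have "\<exists>b\<in>set as. b \<in> U i" using ultra_joins[OF ultra_U] ultra_top[OF ultra_U] r(3) by metis
    moreover have "a \<in> U i \<longleftrightarrow> (\<exists>b\<in>set as. P b r \<and> b \<in> U i)"
      unfolding a_def ultra_joins[OF ultra_U] by auto
    ultimately show ?thesis using r(2) i unfolding P_def Q_def by blast
  qed
  ultimately show ?thesis using r(1) by blast
qed

text \<open>Inner regularity of \<open>B\<close> and of its complement gives closed \<open>K\<close>
  and \<open>L\<close> with small remainders. For the separating \<open>a\<close>, the parts of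
  \<open>B\<close> and \<open>clop a\<close> outside each other lie in these remainders, so their
  measures nearly agree, while the measure of \<open>clop a\<close> is the prescribed
  \<open>v\<close> because \<open>a\<close> and \<open>B\<close> contain the same support points.
  The tolerance \<open>e/4\<close> occurs once for each difference and twice for the approximation
  \<open>c\<close> of their common part, \<open>e\<close> in total.\<close>

lemma radon_unique:
  assumes I: "finite I" and rad: "is_radon \<nu> p"
    and ext: "\<And>a. (\<nu> (clop a) =\<^sub>0 nu w I (clop a)) p" and B: "is_borel B p"
  shows "(\<nu> B =\<^sub>0 nu w I B) p"
proof (rule reg_dense[OF reg_eq_by])
  fix q0 assume q0: "q0 \<le> p"
  obtain q1 g where q1: "q1 \<le> q0" "\<forall>i\<in>I. sgnv i q1 (g i)" using sgnv_finite[OF I] by blast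
  obtain q h where q: "q \<le> q1" "\<forall>i\<in>I. sval i B q (h i)" using sval_finite[OF I] by blast
  have qp: "q \<le> p" using order_trans[OF q(1) order_trans[OF q1(1) q0]] .
  have g: "\<forall>i\<in>I. sgnv i q (g i)" using q1(2) sgnv_down[OF _ q(1)] by blast
  define u where "u = {i\<in>I. (X i \<in>\<^sub>1 B) q}"
  have XB: "if i \<in> u then (X i \<in>\<^sub>1 B) q else (\<^bold>\<not> X i \<in>\<^sub>1 B) q" if "i \<in> I" for i
    using q(2) that unfolding u_def sval_def by auto
  have hg: "h i = (if i \<in> u then g i else 0)" if "i \<in> I" for i
  proof -
    have "sval i B q (if i \<in> u then g i else 0)"
      using XB[OF that] g that unfolding sval_def by auto
    then show ?thesis using q(2) sval_unique that by blast
  qed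
  define v where "v = w * sum h I"
  have bot: "near (\<nu> (clop bot)) 0 0 q"
  proof (rule near_cong[OF eq_by_sym])
    show "(\<nu> (clop bot) =\<^sub>0 nu w I (clop bot)) q" by (rule regD[OF reg_eq_by ext qp])
    have "bot \<notin> U i" for i using ultra_U[of i] unfolding ultra_def by blast
    then show "near (nu w I (clop bot)) 0 0 q" using near_nu_clop[OF g, of w bot] by simp
  qed
  have real: "is_real (\<nu> B) q" by (rule regD[OF reg_is_real radon_real[OF rad B] qp])
  have "near (\<nu> B) v 0 q"
  proof (rule near_closed[OF _ real])
    fix e :: rat assume e: "e > 0"
    show "near (\<nu> B) v (0 + e) q"
    proof (rule reg_dense[OF reg_near])
      fix q' assume q': "q' \<le> q"
      have reg': "\<exists>s\<le>r. \<exists>K. is_closed K s \<and> (K \<subseteq>\<^sub>1 C) s \<and> var_le \<nu> (diff1 C K) (e/4) s"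
        if "r \<le> p" "is_borel C p" for C r
        by (rule radon_inner_regular[OF rad that(2) _ that(1)]) (use e in simp)
      obtain s K where s: "s \<le> q'" "is_closed K s" "(K \<subseteq>\<^sub>1 B) s" "var_le \<nu> (diff1 B K) (e/4) s"
        using reg'[OF order_trans[OF q' qp] B] by blast
      have sp: "s \<le> q" "s \<le> p" using order_trans[OF s(1) q'] order_trans[OF _ qp] by blast+
      obtain t L where t: "t \<le> s" "is_closed L t" "(L \<subseteq>\<^sub>1 diff1 stone B) t"
          "var_le \<nu> (diff1 (diff1 stone B) L) (e/4) t"
        using reg'[OF sp(2) borel_compl[OF B]] by blast
      have tq: "t \<le> q" using order_trans[OF t(1) sp(1)] .
      have "\<exists>r\<le>t. \<exists>a. (K \<subseteq>\<^sub>1 clop a) r \<and> disj1 (clop a) L r \<and> (\<forall>i\<in>I. a \<in> U i \<longleftrightarrow> i \<in> u)"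
      proof (rule separating_element[OF I _ regD[OF reg_is_closed s(2) t(1)] t(2) regD[OF reg_sub1 s(3) t(1)] t(3)])
        show "u \<subseteq> I" unfolding u_def by blast
        show "if i \<in> u then (X i \<in>\<^sub>1 B) t else (\<^bold>\<not> X i \<in>\<^sub>1 B) t" if "i \<in> I" for i
          using XB[OF that] regD[OF reg_mem_by _ tq] down_fnot[OF _ tq] by (auto split: if_splits)
      qed
      then obtain r1 a where r1: "r1 \<le> t" "(K \<subseteq>\<^sub>1 clop a) r1" "disj1 (clop a) L r1"
        and aU: "\<forall>i\<in>I. a \<in> U i \<longleftrightarrow> i \<in> u" by blast
      \<comment> \<open>\<open>S\<close> is the intersection of \<open>B\<close> and
        \<open>clop a\<close>, written as a double difference so that \<open>borel_diff\<close>
        applies.\<close>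
      define S T T' where "S = diff1 B (diff1 B (clop a))" and "T = diff1 B (clop a)" and "T' = diff1 (clop a) B"
      have BS: "is_borel S p" "is_borel T p" "is_borel T' p"
        unfolding S_def T_def T'_def by (intro borel_diff B borel_clop)+
      have r1p: "r1 \<le> p" using order_trans[OF r1(1) order_trans[OF tq qp]] .
      obtain r c where r: "r \<le> r1" "near (\<nu> S) c (e/4) r"
        using is_real_near[OF regD[OF reg_is_real radon_real[OF rad BS(1)] r1p], of "e/4"] e by auto
      have rp: "r \<le> p" "r \<le> t" "r \<le> q" "r \<le> s"
        using order_trans[OF r(1) r1p] order_trans[OF r(1) r1(1)] order_trans[OF _ tq] order_trans[OF _ t(1)] by blast+
      have rad_r: "is_radon \<nu> r" by (rule regD[OF reg_is_radon rad rp(1)])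
      note BSr = BS[THEN regD[OF reg_is_borel _ rp(1)]]
      have S_iff: "(x \<in>\<^sub>1 S) q' \<longleftrightarrow> (x \<in>\<^sub>1 B) q' \<and> (x \<in>\<^sub>1 clop a) q'" for x q'
      proof
        assume L: "(x \<in>\<^sub>1 S) q'"
        have "(\<^bold>\<not> (\<^bold>\<not> x \<in>\<^sub>1 clop a)) q'"
          using L down_fnot regD[OF reg_mem_by, of "(=\<^sub>0)" x B q'] unfolding S_def mem_diff1 fnot_def by auto
        then have "(x \<in>\<^sub>1 clop a) q'" by (simp only: fnot_fnot[OF reg_mem_by])
        then show "(x \<in>\<^sub>1 B) q' \<and> (x \<in>\<^sub>1 clop a) q'"
          using L unfolding S_def mem_diff1 by blast
      next
        assume R: "(x \<in>\<^sub>1 B) q' \<and> (x \<in>\<^sub>1 clop a) q'"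
        have "(\<^bold>\<not> x \<in>\<^sub>1 diff1 B (clop a)) q'"
          unfolding fnot_def[of "x \<in>\<^sub>1 diff1 B (clop a)"] mem_diff1
          using R regD[OF reg_mem_by, of "(=\<^sub>0)" x "clop a" q'] fnotD[OF _ order_refl] by blast
        then show "(x \<in>\<^sub>1 S) q'" using R unfolding S_def by (simp add: mem_diff1)
      qed
      have nT: "near (\<nu> T) 0 (e/4) r"
      proof (rule var_le_near[OF rad_r regD[OF reg_var_le s(4) rp(4)] BSr(2)])
        show "(T \<subseteq>\<^sub>1 diff1 B K) r"
          using r1(2) order_trans[OF _ r(1)] order_trans unfolding T_def sub1_iff mem_diff1 fnot_def by meson
      qed
      have nT': "near (\<nu> T') 0 (e/4) r"
      proof (rule var_le_near[OF rad_r regD[OF reg_var_le t(4) rp(2)] BSr(3)])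
        show "(T' \<subseteq>\<^sub>1 diff1 (diff1 stone B) L) r"
          unfolding T'_def sub1_iff mem_diff1 mem_stone
        proof (intro allI impI conjI)
          fix x q' assume x: "q' \<le> r" "(x \<in>\<^sub>1 clop a) q' \<and> (\<^bold>\<not> x \<in>\<^sub>1 B) q'"
          show "(\<^bold>\<not> x \<in>\<^sub>1 L) q'" unfolding fnot_def
          proof (intro allI impI notI)
            fix s' assume s': "s' \<le> q'" "(x \<in>\<^sub>1 L) s'"
            have "(x \<in>\<^sub>1 clop a) s'" by (rule regD[OF reg_mem_by conjunct1[OF x(2)] s'(1)])
            then show False
              using r1(3) s'(2) order_trans[OF s'(1) order_trans[OF x(1) r(1)]] unfolding disj1_iff by blast
          qed
        qed auto
      qed
      have "near (\<nu> B) (c + 0) (e/4 + e/4) r"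
      proof (rule radon_add[OF rad_r near_down[OF bot rp(3)] BSr(1,2)])
        show "disj1 S T r" unfolding disj1_iff S_iff unfolding T_def mem_diff1 using fnotD[OF _ order_refl] by blast
        show "(S \<subseteq>\<^sub>1 B) r" "(T \<subseteq>\<^sub>1 B) r" unfolding sub1_iff S_iff unfolding T_def mem_diff1 by blast+
        show "\<exists>r'\<le>q'. (x \<in>\<^sub>1 S) r' \<or> (x \<in>\<^sub>1 T) r'" if "(x \<in>\<^sub>1 B) q'" for x q'
        proof -
          obtain r' where "r' \<le> q'" "(x \<in>\<^sub>1 clop a) r' \<or> (\<^bold>\<not> x \<in>\<^sub>1 clop a) r'" using decide by blast
          then show ?thesis using regD[OF reg_mem_by that] unfolding S_iff T_def mem_diff1 by blast
        qed
      qed (use r(2) nT in auto)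
      moreover have "near (\<nu> (clop a)) (c + 0) (e/4 + e/4) r"
      proof (rule radon_add[OF rad_r near_down[OF bot rp(3)] BSr(1,3)])
        show "disj1 S T' r" unfolding disj1_iff S_iff unfolding T'_def mem_diff1 using fnotD[OF _ order_refl] by blast
        show "(S \<subseteq>\<^sub>1 clop a) r" "(T' \<subseteq>\<^sub>1 clop a) r" unfolding sub1_iff S_iff unfolding T'_def mem_diff1 by blast+
        show "\<exists>r'\<le>q'. (x \<in>\<^sub>1 S) r' \<or> (x \<in>\<^sub>1 T') r'" if "(x \<in>\<^sub>1 clop a) q'" for x q'
        proof -
          obtain r' where "r' \<le> q'" "(x \<in>\<^sub>1 B) r' \<or> (\<^bold>\<not> x \<in>\<^sub>1 B) r'" using decide by blast
          then show ?thesis using regD[OF reg_mem_by that] unfolding S_iff T'_def mem_diff1 by blast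
        qed
      qed (use r(2) nT' in auto)
      moreover have "near (\<nu> (clop a)) v 0 r"
      proof (rule near_cong[OF eq_by_sym[OF regD[OF reg_eq_by ext rp(1)]]])
        have "(\<Sum>i\<in>I. if a \<in> U i then g i else 0) = sum h I"
          using aU hg by (intro sum.cong) auto
        then have "near (nu w I (clop a)) v 0 q" using near_nu_clop[OF g, of w a] unfolding v_def by simp
        then show "near (nu w I (clop a)) v 0 r" by (rule near_down[OF _ rp(3)])
      qed
      ultimately have "\<bar>c + 0 - v\<bar> \<le> e/4 + e/4 + 0" using near_dist by blast
      then have "near (\<nu> B) v (0 + e) r"
        by (intro near_mono[OF \<open>near (\<nu> B) (c + 0) (e/4 + e/4) r\<close>]) (simp add: field_simps)
      moreover have "r \<le> q'" using order_trans[OF rp(4) s(1)] .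
      ultimately show "\<exists>r\<le>q'. near (\<nu> B) v (0 + e) r" by blast
    qed
  qed
  from near_eq[OF this near_nu[OF q(2), of w, folded v_def]]
  show "\<exists>r\<le>q0. (\<nu> B =\<^sub>0 nu w I B) r" using order_trans[OF q(1) q1(1)] by blast
qed

end

section \<open>Disjoint sequences in infinite Boolean algebras\<close>

text \<open>For \<open>d\<close> strictly between \<open>bot\<close> and \<open>b\<close>, an
  element below \<open>b\<close> is determined by its parts inside and outside \<open>d\<close>.
  Hence \<open>d\<close> or its relative complement again has infinitely many elements below it, and
  the other one is the nonzero piece split off.\<close>

lemma infinite_split:
  fixes b :: "'a::boolean_algebra"
  assumes "infinite {x. x \<le> b}"
  shows "\<exists>c\<le>b. infinite {x. x \<le> c} \<and> inf b (- c) \<noteq> bot"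
proof -
  have "\<exists>d. d \<in> {x. x \<le> b} - {bot, b}"
    using infinite_imp_nonempty[OF Diff_infinite_finite[OF _ assms, of "{bot, b}"]] by blast
  then obtain d where d: "d \<le> b" "d \<noteq> bot" "d \<noteq> b" by blast
  define d' where "d' = inf b (- d)"
  have "inj_on (\<lambda>x. (inf x d, inf x (- d))) {x. x \<le> b}"
  proof (rule inj_onI)
    fix x y assume "(inf x d, inf x (- d)) = (inf y d, inf y (- d))"
    then have "sup (inf x d) (inf x (- d)) = sup (inf y d) (inf y (- d))" by simp
    then show "x = y" by (simp add: inf_sup_distrib1[symmetric])
  qed
  moreover have "(\<lambda>x. (inf x d, inf x (- d))) ` {x. x \<le> b} \<subseteq> {x. x \<le> d} \<times> {x. x \<le> d'}"
    unfolding d'_def by (auto intro: le_infI1)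
  ultimately have "infinite ({x. x \<le> d} \<times> {x. x \<le> d'})"
    using assms finite_imageD[OF finite_subset] by blast
  then consider "infinite {x. x \<le> d}" | "infinite {x. x \<le> d'}" by blast
  then show ?thesis
  proof cases
    case 1
    have "inf b (- d) \<noteq> bot" using d(1,3) by (simp add: inf_shunt order.antisym)
    then show ?thesis using 1 d(1) by blast
  next
    case 2
    have "inf b (- d') = inf b d" unfolding d'_def by (simp add: inf_sup_distrib1)
    also have "\<dots> = d" using d(1) by (simp add: inf.absorb2)
    finally have "inf b (- d') \<noteq> bot" using d(2) by simp
    moreover have "d' \<le> b" unfolding d'_def by simp
    ultimately show ?thesis using 2 by blast
  qed
qed

text \<open>Iterated splitting gives a decreasing sequence with nonzero successive differences;
  these differences are the required elements.\<close>

lemma disjoint_sequence: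
  assumes "infinite (UNIV :: 'a::boolean_algebra set)"
  shows "\<exists>A :: nat \<Rightarrow> 'a. (\<forall>i. A i \<noteq> bot) \<and> (\<forall>i j. i \<noteq> j \<longrightarrow> inf (A i) (A j) = bot)"
proof -
  have "\<exists>C. \<forall>n. infinite {x::'a. x \<le> C n} \<and> (C (Suc n) \<le> C n \<and> inf (C n) (- C (Suc n)) \<noteq> bot)"
  proof (rule dependent_nat_choice)
    show "\<exists>b::'a. infinite {x. x \<le> b}" using assms by (intro exI[of _ top]) simp
  qed (use infinite_split in blast)
  then obtain C :: "nat \<Rightarrow> 'a" where C: "\<And>n. C (Suc n) \<le> C n" "\<And>n. inf (C n) (- C (Suc n)) \<noteq> bot" by blast
  define A where "A n = inf (C n) (- C (Suc n))" for n
  have "inf (A m) (A n) = bot" if "m < n" for m n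
  proof -
    have "C n \<le> C (Suc m)" using lift_Suc_antimono_le[of C "Suc m" n] C(1) that by simp
    then have "inf (A m) (A n) \<le> inf (- C (Suc m)) (C (Suc m))"
      unfolding A_def by (intro inf_mono) (auto intro: le_infI1)
    then show ?thesis by (simp add: bot.extremum_unique)
  qed
  then have "inf (A i) (A j) = bot" if "i \<noteq> j" for i j
    using that by (metis inf_commute linorder_neqE_nat)
  moreover have "A i \<noteq> bot" for i unfolding A_def by (rule C(2))
  ultimately show ?thesis by blast
qed

section \<open>Failure of the Nikodym and Grothendieck properties\<close>

text \<open>An initial segment of the \<open>k\<close>-th row of a pairing function, so blocks are
  disjoint by construction and \<open>lev\<close> recovers the block number.\<close>

definition blk :: "nat \<Rightarrow> nat set"
  where "blk k = prod_encode ` ({k} \<times> {..<16 ^ k})"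

definition lev :: "nat \<Rightarrow> nat"
  where "lev i = fst (prod_decode i)"

text \<open>Every row has infinitely many indices beyond its block. They receive 0, since otherwise
  the coefficients would not tend to 0 and the function built from them could fail to be
  continuous.\<close>

definition coef :: "nat \<Rightarrow> rat"
  where "coef i = (if i \<in> blk (lev i) then 1 / 2 ^ lev i else 0)"

lemma finite_blk [simp]: "finite (blk k)"
  by (simp add: blk_def)

lemma card_blk [simp]: "card (blk k) = 16 ^ k"
  unfolding blk_def by (subst card_image) (auto simp: inj_prod_encode card_cartesian_product)

lemma lev_blk: "i \<in> blk k \<Longrightarrow> lev i = k"
  by (auto simp: blk_def lev_def)

lemma coef_blk: "i \<in> blk k \<Longrightarrow> coef i = 1 / 2 ^ k"
  using lev_blk[of i k] by (simp add: coef_def)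

lemma coef_small:
  assumes "i \<notin> (\<Union>k<K. blk k)" shows "\<bar>coef i\<bar> \<le> 1 / 2 ^ K"
proof (cases "i \<in> blk (lev i)")
  case True
  then have "K \<le> lev i" using assms by (metis UN_I lessThan_iff linorder_not_le)
  then show ?thesis using True by (simp add: coef_def frac_le power_increasing)
qed (simp add: coef_def)

section \<open>Forcing clauses for integrals, continuity and the two properties\<close>

lemma has_int_iff: "has_int \<nu> f J p \<longleftrightarrow> is_real J p \<and>
    (\<forall>e. \<forall>q\<le>p. 0 < e \<longrightarrow> (\<forall>q'\<le>q. \<exists>r\<le>q'. \<exists>zs. borel_family (map snd zs) r \<and>
      (\<forall>x. \<forall>s\<le>r. is_ultrafilter x s \<longrightarrow> (\<forall>t\<le>s. \<exists>t'\<le>t. \<exists>i<length zs. (x \<in>\<^sub>1 snd (zs ! i)) t')) \<and>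
      (\<forall>i x. \<forall>s\<le>r. i < length zs \<longrightarrow> (x \<in>\<^sub>1 snd (zs ! i)) s \<longrightarrow> rdist_le (f x) (rrat (fst (zs ! i))) e s) \<and>
      rdist_le J (rsum (map (\<lambda>(c, B). rscale c (\<nu> B)) zs)) e r))"
proof -
  have *: "(\<^bold>\<exists>i. fgnd (i < length zs) \<^bold>\<and> x \<in>\<^sub>1 snd (zs ! i)) s \<longleftrightarrow>
      (\<forall>t\<le>s. \<exists>t'\<le>t. \<exists>i<length zs. (x \<in>\<^sub>1 snd (zs ! i)) t')" for zs x s
    unfolding fex_def fand_def by (simp add: fgnd_def[of "_ < length zs"])
  show ?thesis
    unfolding has_int_def fand_def[of "is_real J"] fex_def[of "\<lambda>zs. _ zs \<^bold>\<and> _ zs"]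
    unfolding fall_def fimp_def * mem_stone
    unfolding fand_def by (simp add: fgnd_def[of "0 < _"] fgnd_def[of "_ < length _"] imp_conjL)
qed

lemma is_continuous_iff: "is_continuous f p \<longleftrightarrow>
    (\<forall>x. \<forall>q\<le>p. is_ultrafilter x q \<longrightarrow> is_real (f x) q) \<and>
    (\<forall>x y. \<forall>q\<le>p. is_ultrafilter x q \<longrightarrow> (x =\<^sub>0 y) q \<longrightarrow> (f x =\<^sub>0 f y) q) \<and>
    (\<forall>x e. \<forall>q\<le>p. is_ultrafilter x q \<longrightarrow> 0 < e \<longrightarrow> (\<forall>r\<le>q. \<exists>s\<le>r. \<exists>S. is_open S s \<and> (x \<in>\<^sub>1 S) s \<and>
       (\<forall>y. \<forall>t\<le>s. (y \<in>\<^sub>1 S) t \<longrightarrow> rdist_le (f y) (f x) e t)))"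
  unfolding is_continuous_def fand_def fall_def fimp_def fex_def mem_stone
  by (simp add: fgnd_def[of "0 < _"] imp_conjL)

lemma weak_star_null_iff: "weak_star_null \<mu> p \<longleftrightarrow> (\<forall>\<nu> f J. \<forall>q\<le>p.
    (\<forall>n. radon_extension (\<mu> n) (\<nu> n) q) \<longrightarrow> is_continuous f q \<longrightarrow> (\<forall>n. has_int (\<nu> n) f (J n) q) \<longrightarrow>
    rlim J (rrat 0) q)"
  unfolding weak_star_null_def fand_def fall_def fimp_def by (simp only: imp_conjL)

lemma weakly_null_iff: "weakly_null \<mu> p \<longleftrightarrow> (\<forall>\<nu> B. \<forall>q\<le>p.
    (\<forall>n. radon_extension (\<mu> n) (\<nu> n) q) \<longrightarrow> is_borel B q \<longrightarrow> rlim (\<lambda>n. \<nu> n B) (rrat 0) q)"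
  unfolding weakly_null_def fand_def fall_def fimp_def by (simp only: imp_conjL)

lemma radon_extension_iff:
  "radon_extension \<mu> \<nu> p \<longleftrightarrow> is_radon \<nu> p \<and> (\<forall>a. (\<nu> (clop a) =\<^sub>0 \<mu> a) p)"
  unfolding radon_extension_def fand_def fall_def by simp

lemma nikodym_iff: "nikodym TYPE('a::boolean_algebra) p \<longleftrightarrow> (\<forall>\<mu> :: nat \<Rightarrow> 'a \<Rightarrow> _. \<forall>q\<le>p.
    (\<forall>n. is_measure (\<mu> n) q) \<longrightarrow> pointwise_null \<mu> q \<longrightarrow> weak_star_null \<mu> q)"
  unfolding nikodym_def fand_def fall_def fimp_def by (simp only: imp_conjL)

lemma grothendieck_iff: "grothendieck TYPE('a::boolean_algebra) p \<longleftrightarrow> (\<forall>\<mu> :: nat \<Rightarrow> 'a \<Rightarrow> _. \<forall>q\<le>p.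
    (\<forall>n. is_measure (\<mu> n) q) \<longrightarrow> weak_star_null \<mu> q \<longrightarrow> weakly_null \<mu> q)"
  unfolding grothendieck_def fand_def fall_def fimp_def by (simp only: imp_conjL)

locale disjoint_signs = sign_name \<rho> U
  for \<rho> :: "(nat, 'p::preorder) nm" and U :: "nat \<Rightarrow> 'a::boolean_algebra set" +
  fixes A :: "nat \<Rightarrow> 'a" and p :: 'p
  assumes A_in_U: "\<And>i. A i \<in> U i" and disjoint: "\<And>i j. i \<noteq> j \<Longrightarrow> inf (A i) (A j) = bot"
    and random: "random_over_V \<rho> p"
begin

lemma A_in_U_iff: "A j \<in> U i \<longleftrightarrow> j = i"
  using A_in_U disjoint ultra_U[of i] unfolding ultra_def by metis

lemma radon_extension_nu: "radon_extension (\<lambda>a. nu w (blk k) (clop a)) (nu w (blk k)) q"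
  unfolding radon_extension_iff using is_radon_nu eq_by_refl by auto

text \<open>For a fixed \<open>a\<close>, the sequence \<open>b\<close> recording which
  \<open>U i\<close> contain \<open>a\<close> belongs to V and is bounded by 1, as
  \<open>random_null_sums\<close> requires.\<close>

lemma pointwise_null_nu:
  assumes "summable (\<lambda>n. (real_of_rat (w n))\<^sup>2 * 16 ^ n)"
  shows "pointwise_null (\<lambda>n a. nu (w n) (blk n) (clop a)) p"
  unfolding pointwise_null_def fall_def
proof (intro allI rlimI)
  fix a e q assume e: "(e::rat) > 0" and q: "q \<le> p"
  define b :: "nat \<Rightarrow> rat" where "b i = (if a \<in> U i then 1 else 0)" for i
  have rq: "random_over_V \<rho> q"
    using random order_trans[OF _ q] unfolding random_over_V_def fall_def fimp_def by blast
  have "\<exists>r\<le>q. \<exists>N. \<forall>n\<ge>N. \<forall>q\<le>r. \<forall>g. (\<forall>i\<in>blk n. sgnv i q (g i)) \<longrightarrow> \<bar>w n * (\<Sum>i\<in>blk n. g i * b i)\<bar> \<le> e"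
    by (rule random_null_sums[OF rq, of blk b 1]) (use assms e in \<open>auto simp: b_def\<close>)
  then obtain r N where r: "r \<le> q"
    "\<And>n q g. n \<ge> N \<Longrightarrow> q \<le> r \<Longrightarrow> \<forall>i\<in>blk n. sgnv i q (g i) \<Longrightarrow> \<bar>w n * (\<Sum>i\<in>blk n. g i * b i)\<bar> \<le> e"
    by blast
  have "rdist_le (nu (w n) (blk n) (clop a)) (rrat 0) e r" if n: "n \<ge> N" for n
  proof (rule reg_dense[OF reg_rdist_le])
    fix s assume s: "s \<le> r"
    obtain t g where t: "t \<le> s" "\<forall>i\<in>blk n. sgnv i t (g i)" using sgnv_finite[OF finite_blk] by blast
    have "(\<Sum>i\<in>blk n. if a \<in> U i then g i else 0) = (\<Sum>i\<in>blk n. g i * b i)"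
      by (intro sum.cong) (auto simp: b_def)
    then have "rdist_le (nu (w n) (blk n) (clop a)) (rrat 0) e t"
      using r(2)[OF n order_trans[OF t(1) s] t(2)]
      by (intro near_rdist_leI[OF near_nu_clop[OF t(2), of "w n" a] near_rrat]) simp
    then show "\<exists>t\<le>s. rdist_le (nu (w n) (blk n) (clop a)) (rrat 0) e t" using t(1) by blast
  qed
  then show "\<exists>r\<le>q. \<exists>N. \<forall>n\<ge>N. rdist_le (nu (w n) (blk n) (clop a)) (rrat 0) e r" using r(1) by blast
qed

subsection \<open>The Nikodym property\<close>

text \<open>The continuous function \<open>\<Sum>i. coef i * \<epsilon>\<^sub>i * 1\<^bsub>A i\<^esub>\<close>; the coefficients tend to \<open>0\<close>.\<close>

definition fval :: "('a, 'p) pnm \<Rightarrow> 'p \<Rightarrow> rat \<Rightarrow> bool"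
  where "fval x s v \<longleftrightarrow> is_ultrafilter x s \<and> ((\<exists>i g. (A i \<in>\<^sub>0 x) s \<and> sgnv i s g \<and> v = coef i * g) \<or>
    (\<forall>i. (\<^bold>\<not> A i \<in>\<^sub>0 x) s) \<and> v = 0)"

definition fn :: "('a, 'p) pnm \<Rightarrow> 'p rnm"
  where "fn x = pw (fval x)"

lemma A_unique: "is_ultrafilter x s \<Longrightarrow> (A i \<in>\<^sub>0 x) s \<Longrightarrow> (A j \<in>\<^sub>0 x) s \<Longrightarrow> i = j"
  using ultrafilter_inf[of x s "A i" "A j"] ultrafilter_bot[of x s] disjoint[of i j] by metis

lemma fval_unique: "fval x s v \<Longrightarrow> fval x s v' \<Longrightarrow> v = v'"
  unfolding fval_def using A_unique sgnv_unique fnotD[OF _ order_refl] by metis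

lemma fval_down: "fval x s v \<Longrightarrow> r \<le> s \<Longrightarrow> fval x r v"
  unfolding fval_def
  using is_ultrafilter_down[of x s r] regD[OF reg_mem_by, of _ "A _" x s r] sgnv_down[of _ s _ r]
    down_fnot[of "A _ \<in>\<^sub>0 x" s r] by metis

lemma near_fn: "fval x s v \<Longrightarrow> near (fn x) v 0 s"
  unfolding fn_def by (rule near_pw) (auto simp: down_def intro: fval_unique fval_down)

text \<open>Successive strengthenings decide whether \<open>x\<close> contains any
  \<open>A i\<close>, then which one, then its sign; if it contains none, the value is 0.\<close>

lemma fval_dense:
  assumes "is_ultrafilter x q" shows "\<exists>r\<le>q. \<exists>v. fval x r v"
proof -
  obtain r where r: "r \<le> q" "(\<^bold>\<exists>i. A i \<in>\<^sub>0 x) r \<or> (\<^bold>\<not> (\<^bold>\<exists>i. A i \<in>\<^sub>0 x)) r" using decide by blast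
  have ur: "is_ultrafilter x r" by (rule is_ultrafilter_down[OF assms r(1)])
  show ?thesis
  proof (cases "(\<^bold>\<exists>i. A i \<in>\<^sub>0 x) r")
    case True
    from dense_ex[OF True[unfolded fex_def]] obtain s i where s: "s \<le> r" "(A i \<in>\<^sub>0 x) s" by blast
    obtain t g where t: "t \<le> s" "sgnv i t g" using sgnv_dense by blast
    have "fval x t (coef i * g)"
      unfolding fval_def using is_ultrafilter_down[OF ur order_trans[OF t(1) s(1)]]
        regD[OF reg_mem_by s(2) t(1)] t(2) by blast
    then show ?thesis using order_trans[OF t(1) order_trans[OF s(1) r(1)]] by blast
  next
    case False
    then have no: "(\<^bold>\<not> (\<^bold>\<exists>i. A i \<in>\<^sub>0 x)) r" using r(2) by blast
    have "(\<^bold>\<not> A i \<in>\<^sub>0 x) r" for i unfolding fnot_def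
    proof (intro allI impI notI)
      fix s assume s: "s \<le> r" "(A i \<in>\<^sub>0 x) s"
      then have "(\<^bold>\<exists>i. A i \<in>\<^sub>0 x) s"
        unfolding fex_def using regD[OF reg_mem_by s(2)] order_refl by meson
      then show False using fnotD[OF no s(1)] by blast
    qed
    then show ?thesis unfolding fval_def using ur r(1) by blast
  qed
qed

lemma near_fn_A:
  assumes "is_ultrafilter x s" "(A i \<in>\<^sub>0 x) s" "sgnv i s g"
  shows "near (fn x) (coef i * g) 0 s"
  by (rule near_fn) (use assms in \<open>auto simp: fval_def\<close>)

lemma near_fn_small:
  assumes x: "is_ultrafilter x s" "(- joins (map A l) \<in>\<^sub>0 x) s" and l: "set l = (\<Union>k<K. blk k)"
  shows "near (fn x) 0 (1 / 2 ^ K) s"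
proof (rule reg_dense[OF reg_near])
  fix q assume q: "q \<le> s"
  obtain r v where r: "r \<le> q" "fval x r v" using fval_dense[OF is_ultrafilter_down[OF x(1) q]] by blast
  have rs: "r \<le> s" using order_trans[OF r(1) q] .
  have ur: "is_ultrafilter x r" by (rule is_ultrafilter_down[OF x(1) rs])
  have "\<bar>v\<bar> \<le> 1 / 2 ^ K"
  proof (cases "v = 0")
    case False
    then obtain i g where i: "(A i \<in>\<^sub>0 x) r" "sgnv i r g" "v = coef i * g"
      using r(2) unfolding fval_def by blast
    have "i \<notin> set l"
    proof
      assume "i \<in> set l"
      then have "A i \<le> joins (map A l)" by (intro joins_upper) simp
      then have "(joins (map A l) \<in>\<^sub>0 x) r" by (rule ultrafilter_up[OF ur i(1)])
      moreover have "(\<^bold>\<not> joins (map A l) \<in>\<^sub>0 x) s" using x by (simp add: fnot_mem_iff)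
      ultimately show False using fnotD rs by blast
    qed
    then show ?thesis using coef_small[of i K] i(2,3) l by (simp add: abs_mult sgnv_abs)
  qed simp
  then have "near (fn x) 0 (1 / 2 ^ K) r" by (intro near_mono[OF near_fn[OF r(2)]]) simp
  then show "\<exists>r\<le>q. near (fn x) 0 (1 / 2 ^ K) r" using r(1) by blast
qed

text \<open>The extra requirement \<open>K > k\<close> later ensures that block \<open>k\<close> is
  among the first \<open>K\<close> blocks.\<close>

lemma ex_power_le:
  assumes "(e::rat) > 0" shows "\<exists>K>k. 1 / 2 ^ K \<le> e"
proof -
  obtain n :: nat where n: "1 / e < of_nat n" using reals_Archimedean2 by blast
  define K where "K = max n (Suc k)"
  have "of_nat n \<le> (2::rat) ^ K"
  proof -
    have "n \<le> K" "K < 2 ^ K" by (auto simp: K_def)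
    then have "n \<le> 2 ^ K" by linarith
    then show ?thesis by (metis of_nat_le_iff of_nat_numeral of_nat_power)
  qed
  then have "1 / e \<le> 2 ^ K" using n by linarith
  then have "1 / 2 ^ K \<le> e" using assms by (simp add: field_simps)
  moreover have "K > k" by (simp add: K_def)
  ultimately show ?thesis by blast
qed

lemma block_list: "\<exists>l. set l = (\<Union>k<K. blk k) \<and> distinct l"
  by (intro finite_distinct_list) auto

text \<open>Inside some \<open>A i\<close> the function is constant. At a point in no
  \<open>A i\<close> it vanishes, and the complement of the finitely many \<open>A i\<close> from
  the first \<open>K\<close> blocks is a neighbourhood on which it is at most
  \<open>1 / 2 ^ K\<close> in absolute value.\<close>

lemma is_continuous_fn: "is_continuous fn q"
  unfolding is_continuous_iff
proof (intro conjI allI impI)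
  fix x :: "('a, 'p) pnm" and q assume x: "is_ultrafilter x q"
  show "is_real (fn x) q"
  proof (rule reg_dense[OF reg_is_real])
    fix r assume r: "r \<le> q"
    show "\<exists>s\<le>r. is_real (fn x) s"
      using fval_dense[OF is_ultrafilter_down[OF x r]] near_fn near_is_real by blast
  qed
next
  fix x y :: "('a, 'p) pnm" and q assume x: "is_ultrafilter x q" and e: "(x =\<^sub>0 y) q"
  show "(fn x =\<^sub>0 fn y) q"
  proof (rule reg_dense[OF reg_eq_by])
    fix r assume r: "r \<le> q"
    obtain s v where s: "s \<le> r" "fval x s v" using fval_dense[OF is_ultrafilter_down[OF x r]] by blast
    have es: "(x =\<^sub>0 y) s" by (rule regD[OF reg_eq_by e order_trans[OF s(1) r]])
    have "(a \<in>\<^sub>0 x) t \<longleftrightarrow> (a \<in>\<^sub>0 y) t" if "t \<le> s" for a t by (rule eq_by_mem[OF es that])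
    then have "fval y s v"
      using s(2) is_ultrafilter_cong[OF eq_by_sym[OF es]] unfolding fval_def fnot_def by auto
    then show "\<exists>s\<le>r. (fn x =\<^sub>0 fn y) s" using near_eq[OF near_fn near_fn] s by blast
  qed
next
  fix x :: "('a, 'p) pnm" and q r and e :: rat assume x: "is_ultrafilter x q" and e: "0 < e" and r: "r \<le> q"
  obtain s v where s: "s \<le> r" "fval x s v" using fval_dense[OF is_ultrafilter_down[OF x r]] by blast
  have us: "is_ultrafilter x s" using s(2) unfolding fval_def by blast
  have "\<exists>S. is_open S s \<and> (x \<in>\<^sub>1 S) s \<and> (\<forall>y. \<forall>t\<le>s. (y \<in>\<^sub>1 S) t \<longrightarrow> rdist_le (fn y) (fn x) e t)"
  proof (cases "\<exists>i g. (A i \<in>\<^sub>0 x) s \<and> sgnv i s g \<and> v = coef i * g")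
    case True
    then obtain i g where i: "(A i \<in>\<^sub>0 x) s" "sgnv i s g" "v = coef i * g" by blast
    have "rdist_le (fn y) (fn x) e t" if "t \<le> s" "(y \<in>\<^sub>1 clop (A i)) t" for y t
    proof (rule near_rdist_leI)
      show "near (fn y) v 0 t" using near_fn_A[of y t i g] that i(3) sgnv_down[OF i(2)] by simp
      show "near (fn x) v 0 t" by (rule near_down[OF near_fn[OF s(2)] that(1)])
    qed (use e in simp)
    then show ?thesis using i(1) us by (intro exI[of _ "clop (A i)"]) simp
  next
    case False
    then have no: "\<And>i. (\<^bold>\<not> A i \<in>\<^sub>0 x) s" "v = 0" using s(2) unfolding fval_def by blast+
    obtain K where K: "1 / 2 ^ K \<le> e" using ex_power_le[OF e] by blast
    obtain l where l: "set l = (\<Union>k<K. blk k)" using block_list by blast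
    have "(\<^bold>\<not> joins (map A l) \<in>\<^sub>0 x) s" unfolding fnot_def
    proof (intro allI impI notI)
      fix t assume t: "t \<le> s" "(joins (map A l) \<in>\<^sub>0 x) t"
      obtain t' a where "t' \<le> t" "a \<in> set (map A l)" "(a \<in>\<^sub>0 x) t'"
        using ultrafilter_joins[OF is_ultrafilter_down[OF us t(1)] t(2)] by blast
      then show False using fnotD[OF no(1)] order_trans[OF _ t(1)] by auto
    qed
    then have "(x \<in>\<^sub>1 clop (- joins (map A l))) s" using us by (simp add: fnot_mem_iff)
    moreover have "rdist_le (fn y) (fn x) e t" if "t \<le> s" "(y \<in>\<^sub>1 clop (- joins (map A l))) t" for y t
    proof (rule near_rdist_leI)
      show "near (fn y) 0 (1 / 2 ^ K) t" using that(2) near_fn_small[OF _ _ l] by simp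
      show "near (fn x) 0 0 t" using near_down[OF near_fn[OF s(2)] that(1)] no(2) by simp
    qed (use K in simp)
    ultimately show ?thesis by (intro exI[of _ "clop (- joins (map A l))"]) simp
  qed
  then show "\<exists>s\<le>r. \<exists>S. is_open S s \<and> (x \<in>\<^sub>1 S) s \<and> (\<forall>y. \<forall>t\<le>s. (y \<in>\<^sub>1 S) t \<longrightarrow> rdist_le (fn y) (fn x) e t)"
    using s(1) by blast
qed

lemma disj1_clop: "inf a b = bot \<Longrightarrow> disj1 (clop a) (clop b) q"
  unfolding disj1_iff mem_clop using ultrafilter_inf ultrafilter_bot by metis

text \<open>The simple functions take the exact value on each \<open>A i\<close> of the first
  \<open>K\<close> blocks and 0 on the remaining clopen set. Since block \<open>k\<close> carries
  the whole measure, their integrals equal 1 for every tolerance: each of the \<open>16 ^ k\<close>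
  indices contributes \<open>1 / 2 ^ k * (1 / 8 ^ k)\<close>.\<close>

lemma has_int_fn: "has_int (nu (1 / 8 ^ k) (blk k)) fn (rrat 1) q"
  unfolding has_int_iff
proof (intro conjI allI impI)
  show "is_real (rrat 1) q" by (rule near_is_real[OF near_rrat])
next
  fix e :: rat and q assume e: "0 < e"
  obtain K where K: "K > k" "1 / 2 ^ K \<le> e" using ex_power_le[OF e] by blast
  obtain l where l: "set l = (\<Union>k<K. blk k)" "distinct l" using block_list by blast
  obtain r g where r: "r \<le> q" "\<forall>i\<in>(\<Union>k<K. blk k). sgnv i r (g i)"
    using sgnv_finite[of "\<Union>k<K. blk k" q] by auto
  define es where "es = map A l @ [- joins (map A l)]"
  define vs where "vs = map (\<lambda>i. coef i * g i) l @ [0]"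
  define zs where "zs = zip vs (map clop es :: ('a, 'p) psnm list)"
  have len: "length zs = Suc (length l)" "length vs = Suc (length l)" "length es = Suc (length l)"
    by (simp_all add: zs_def vs_def es_def)
  have zs: "zs ! i = (vs ! i, clop (es ! i))" if "i < Suc (length l)" for i
    using that len by (simp add: zs_def)
  have es1: "es ! i = A (l ! i)" "vs ! i = coef (l ! i) * g (l ! i)" "l ! i \<in> (\<Union>k<K. blk k)" if "i < length l" for i
    using that nth_mem[OF that] l(1) by (auto simp: es_def vs_def nth_append)
  have es2: "es ! length l = - joins (map A l)" "vs ! length l = 0" by (simp_all add: es_def vs_def nth_append)
  have dj: "inf (es ! i) (es ! j) = bot" if "i < Suc (length l)" "j < i" for i j
  proof (cases "i = length l")
    case True
    then have "es ! j \<le> joins (map A l)" using that es1(1)[of j] by (intro joins_upper) simp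
    then have "inf (es ! i) (es ! j) \<le> inf (- joins (map A l)) (joins (map A l))"
      unfolding True es2 by (rule inf_mono[OF order_refl])
    then show ?thesis by (simp add: bot.extremum_unique)
  next
    case False
    then have "i < length l" "j < length l" using that by auto
    then show ?thesis using es1(1) disjoint that l(2) by (simp add: nth_eq_iff_index_eq)
  qed
  have fam: "borel_family (map snd zs) r"
    unfolding borel_family_iff using zs dj len by (auto intro!: disj1_clop)
  have cover: "\<forall>x. \<forall>s\<le>r. is_ultrafilter x s \<longrightarrow> (\<forall>t\<le>s. \<exists>t'\<le>t. \<exists>i<length zs. (x \<in>\<^sub>1 snd (zs ! i)) t')"
  proof (intro allI impI)
    fix x :: "('a, 'p) nm" and s t assume "is_ultrafilter x s" "t \<le> s"
    then have ut: "is_ultrafilter x t" by (rule is_ultrafilter_down)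
    have "joins es = top" by (simp add: es_def)
    then obtain t' a where t': "t' \<le> t" "a \<in> set es" "(a \<in>\<^sub>0 x) t'"
      using ultrafilter_joins[OF ut, of es] top_in_ultrafilter[OF ut] by auto
    then obtain i where "i < length zs" "es ! i = a" using len by (auto simp: in_set_conv_nth)
    then have "i < length zs" "(x \<in>\<^sub>1 snd (zs ! i)) t'"
      using t'(3) is_ultrafilter_down[OF ut t'(1)] zs len by auto
    then show "\<exists>t'\<le>t. \<exists>i<length zs. (x \<in>\<^sub>1 snd (zs ! i)) t'" using t'(1) by blast
  qed
  have approx: "\<forall>i x. \<forall>s\<le>r. i < length zs \<longrightarrow> (x \<in>\<^sub>1 snd (zs ! i)) s \<longrightarrow> rdist_le (fn x) (rrat (fst (zs ! i))) e s"
  proof (intro allI impI)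
    fix i :: nat and x s assume s: "s \<le> r" and i: "i < length zs" and x: "(x \<in>\<^sub>1 snd (zs ! i)) s"
    have x': "is_ultrafilter x s" "(es ! i \<in>\<^sub>0 x) s" using x zs i len by auto
    show "rdist_le (fn x) (rrat (fst (zs ! i))) e s"
    proof (cases "i = length l")
      case True
      then have "near (fn x) 0 (1 / 2 ^ K) s" using x' es2 near_fn_small[OF _ _ l(1)] by simp
      then show ?thesis using K(2) zs i len True es2 near_rrat[of 0 s]
        by (intro near_rdist_leI[of _ 0 "1 / 2 ^ K" _ _ 0 0]) auto
    next
      case False
      then have il: "i < length l" using i len by simp
      have "sgnv (l ! i) s (g (l ! i))" using r(2) es1(3)[OF il] sgnv_down[OF _ s] by blast
      then have "near (fn x) (vs ! i) 0 s" using near_fn_A[OF x'(1)] x'(2) es1[OF il] by simp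
      then show ?thesis using e zs i len by (intro near_rdist_leI[OF _ near_rrat]) auto
    qed
  qed
  have "rdist_le (rrat 1) (rsum (map (\<lambda>(c, B). rscale c (nu (1 / 8 ^ k) (blk k) B)) zs)) e r"
  proof -
    define c where "c i = vs ! i * (1 / 8 ^ k * (\<Sum>j\<in>blk k. if es ! i \<in> U j then g j else 0))" for i
    let ?xs = "map (\<lambda>(c, B). rscale c (nu (1 / 8 ^ k) (blk k) B)) zs"
    have gk: "\<forall>i\<in>blk k. sgnv i r (g i)" using r(2) K(1) by auto
    have "near (rsum ?xs) (\<Sum>i<length ?xs. c i) 0 r"
    proof (rule near_rsum)
      fix i assume "i < length ?xs"
      then show "near (?xs ! i) (c i) 0 r"
        using near_rscale[OF near_nu_clop[OF gk, of "1 / 8 ^ k" "es ! i"], of "vs ! i"] zs len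
        unfolding c_def by simp
    qed
    moreover have "(\<Sum>i<length ?xs. c i) = 1"
    proof -
      have ci: "c i = (if l ! i \<in> blk k then 1 / 16 ^ k else 0)" if "i < length l" for i
      proof -
        have "(\<Sum>j\<in>blk k. if es ! i \<in> U j then g j else 0) = (\<Sum>j\<in>blk k. if j = l ! i then g (l ! i) else 0)"
          using es1(1)[OF that] A_in_U_iff by (intro sum.cong) auto
        also have "\<dots> = (if l ! i \<in> blk k then g (l ! i) else 0)" by simp
        finally have c: "c i = coef (l ! i) * g (l ! i) * (1 / 8 ^ k * (if l ! i \<in> blk k then g (l ! i) else 0))"
          unfolding c_def using es1(2)[OF that] by simp
        \<comment> \<open>The sign in the function meets the same sign in the measure, so the
          randomness cancels and all contributions add up.\<close>
        have gg: "g (l ! i) * g (l ! i) = 1"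
          using sgnv_abs[OF bspec[OF r(2) es1(3)[OF that]]] by (simp add: abs_if split: if_splits)
        show ?thesis
        proof (cases "l ! i \<in> blk k")
          case True
          then have "c i = (1 / 2 ^ k) / 8 ^ k * (g (l ! i) * g (l ! i))"
            unfolding c coef_blk[OF True] by (simp only: if_True) (simp add: field_simps)
          then show ?thesis using True unfolding gg by (simp add: power_mult_distrib[symmetric])
        qed (simp add: c)
      qed
      have "(\<Sum>i<length ?xs. c i) = (\<Sum>i<length l. c i)" using len es2 by (simp add: c_def)
      also have "\<dots> = (\<Sum>i<length l. if l ! i \<in> blk k then 1 / 16 ^ k else 0)" using ci by (intro sum.cong) auto
      also have "\<dots> = (\<Sum>j\<in>set l. if j \<in> blk k then 1 / 16 ^ k else 0)"
        by (rule sum.reindex_bij_betw[OF bij_betw_nth]) (use l(2) in auto)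
      also have "\<dots> = (\<Sum>j\<in>blk k. 1 / 16 ^ k)"
        using l(1) K(1) by (intro sum.mono_neutral_cong_right) auto
      also have "\<dots> = 1" by simp
      finally show ?thesis .
    qed
    ultimately show ?thesis using e by (intro near_rdist_leI[OF near_rrat]) auto
  qed
  then show "\<exists>r\<le>q. \<exists>zs. borel_family (map snd zs) r \<and>
      (\<forall>x. \<forall>s\<le>r. is_ultrafilter x s \<longrightarrow> (\<forall>t\<le>s. \<exists>t'\<le>t. \<exists>i<length zs. (x \<in>\<^sub>1 snd (zs ! i)) t')) \<and>
      (\<forall>i x. \<forall>s\<le>r. i < length zs \<longrightarrow> (x \<in>\<^sub>1 snd (zs ! i)) s \<longrightarrow> rdist_le (fn x) (rrat (fst (zs ! i))) e s) \<and>
      rdist_le (rrat 1) (rsum (map (\<lambda>(c, B). rscale c (nu (1 / 8 ^ k) (blk k) B)) zs)) e r"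
    using r(1) fam cover approx by blast
qed

lemma not_nikodym: "\<not> nikodym TYPE('a) p"
proof
  assume nik: "nikodym TYPE('a) p"
  have pn: "pointwise_null (\<lambda>n a. nu (1 / 8 ^ n) (blk n) (clop a)) p"
  proof (rule pointwise_null_nu)
    have "(1 / 4 :: real) ^ n = (1 / 64) ^ n * 16 ^ n" for n
      unfolding power_mult_distrib[symmetric] by simp
    then have "(\<lambda>n. (real_of_rat (1 / 8 ^ n))\<^sup>2 * 16 ^ n) = (\<lambda>n. (1 / 4) ^ n)"
      by (simp add: of_rat_divide of_rat_power power_divide power2_eq_square power_mult_distrib[symmetric])
    then show "summable (\<lambda>n. (real_of_rat (1 / 8 ^ n))\<^sup>2 * 16 ^ n)" by (simp add: summable_geometric)
  qed
  have "is_measure (\<lambda>a. nu (1 / 8 ^ n) (blk n) (clop a)) p" for n by (rule is_measure_nu) auto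
  from nik[unfolded nikodym_iff, rule_format, OF order_refl this pn]
  have "weak_star_null (\<lambda>n a. nu (1 / 8 ^ n) (blk n) (clop a)) p" .
  from this[unfolded weak_star_null_iff, rule_format, OF order_refl radon_extension_nu is_continuous_fn has_int_fn]
  have "rlim (\<lambda>n. rrat 1) (rrat 0) p" .
  from rlimD[OF this, of "1/2" p] obtain r where "rdist_le (rrat 1 :: 'p rnm) (rrat 0) (1/2) r" by auto
  from rdist_leD[OF this near_rrat near_rrat] show False by simp
qed

subsection \<open>The Grothendieck property\<close>

text \<open>Near each point the function stays within \<open>e\<close> of some rational on a basic
  clopen set, spending \<open>e/2\<close> on its oscillation and \<open>e/2\<close> on approximating
  its value. Compactness reduces these sets to a finite list \<open>bs\<close>, which together with
  the rationals \<open>D\<close> lies in V. Choosing for every \<open>i\<close> a member of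
  \<open>bs\<close> in \<open>U i\<close> thus happens in V, and the resulting sequence has only
  finitely many values.\<close>

lemma continuous_approx:
  assumes "is_continuous f q" "e > 0"
  shows "\<exists>r\<le>q. \<exists>d C. (\<forall>i. \<bar>d i\<bar> \<le> C \<and> near (f (X i)) (d i) e r)"
proof -
  define j where "j b r \<longleftrightarrow> (\<exists>d. \<forall>s\<le>r. \<forall>y. (y \<in>\<^sub>1 clop b) s \<longrightarrow> near (f y) d e s)" for b r
  have "\<exists>r\<le>q. \<exists>bs. (\<forall>b\<in>set bs. j b r) \<and> joins bs = top"
  proof (rule stone_compact)
    show "down (j b)" for b unfolding down_def j_def by (meson order_trans)
  next
    fix x :: "('a, 'p) pnm" and q' assume q': "q' \<le> q" and x: "is_ultrafilter x q'"
    have "\<exists>s\<le>q'. \<exists>S. is_open S s \<and> (x \<in>\<^sub>1 S) s \<and> (\<forall>y. \<forall>t\<le>s. (y \<in>\<^sub>1 S) t \<longrightarrow> rdist_le (f y) (f x) (e/2) t)"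
      using conjunct2[OF conjunct2[OF assms(1)[unfolded is_continuous_iff]],
          rule_format, OF q' x half_gt_zero[OF assms(2)] order_refl] .
    then obtain s S where s: "s \<le> q'" "is_open S s" "(x \<in>\<^sub>1 S) s"
      "\<And>y t. t \<le> s \<Longrightarrow> (y \<in>\<^sub>1 S) t \<Longrightarrow> rdist_le (f y) (f x) (e/2) t" by blast
    have real: "is_real (f y) t" if "is_ultrafilter y t" "t \<le> q" for y :: "('a, 'p) pnm" and t
      using assms(1) that unfolding is_continuous_iff by blast
    have sq: "s \<le> q" using order_trans[OF s(1) q'] .
    obtain t d where t: "t \<le> s" "near (f x) d (e/2) t"
      using is_real_near[OF real[OF is_ultrafilter_down[OF x s(1)] sq], of "e/2"] assms(2) by auto
    obtain u a where u: "u \<le> t" "(a \<in>\<^sub>0 x) u" "(clop a \<subseteq>\<^sub>1 S) u"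
      using is_openD[OF regD[OF reg_is_open s(2) t(1)] regD[OF reg_mem_by s(3) t(1)]] by blast
    have "near (f y) d e v" if v: "v \<le> u" "(y \<in>\<^sub>1 clop a) v" for v y
    proof -
      have vs: "v \<le> t" "v \<le> s" using order_trans[OF v(1) u(1)] order_trans[OF _ t(1)] by blast+
      have "(y \<in>\<^sub>1 S) v" using u(3) v unfolding sub1_iff by blast
      then have "rdist_le (f y) (f x) (e/2) v" using s(4) vs(2) by blast
      moreover have "is_real (f y) v" using real order_trans[OF vs(2) sq] v(2) by simp
      ultimately have "near (f y) d (e/2 + e/2) v"
        using rdist_le_near near_down[OF t(2) vs(1)] by blast
      then show ?thesis by simp
    qed
    then have "j a u" unfolding j_def by blast
    then show "\<exists>r\<le>q'. \<exists>a. j a r \<and> (a \<in>\<^sub>0 x) r"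
      using u(2) order_trans[OF u(1) order_trans[OF t(1) s(1)]] by blast
  qed
  then obtain r bs where r: "r \<le> q" "\<forall>b\<in>set bs. j b r" "joins bs = top" by blast
  then have "\<forall>b\<in>set bs. \<exists>d. \<forall>s\<le>r. \<forall>y. (y \<in>\<^sub>1 clop b) s \<longrightarrow> near (f y) d e s" unfolding j_def by blast
  from bchoice[OF this] obtain D where
    D: "\<And>b s y. b \<in> set bs \<Longrightarrow> s \<le> r \<Longrightarrow> (y \<in>\<^sub>1 clop b) s \<Longrightarrow> near (f y) (D b) e s" by blast
  have "\<forall>i. \<exists>b. b \<in> set bs \<and> b \<in> U i" using ultra_joins[OF ultra_U] ultra_top[OF ultra_U] r(3) by metis
  from choice[OF this] obtain \<beta> where \<beta>: "\<And>i. \<beta> i \<in> set bs \<and> \<beta> i \<in> U i" by blast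
  have "\<bar>D (\<beta> i)\<bar> \<le> (\<Sum>b\<in>set bs. \<bar>D b\<bar>)" for i using \<beta> by (intro member_le_sum) auto
  moreover have "near (f (X i)) (D (\<beta> i)) e r" for i using D[of "\<beta> i" r "X i"] \<beta> by simp
  ultimately have "\<forall>i. \<bar>D (\<beta> i)\<bar> \<le> (\<Sum>b\<in>set bs. \<bar>D b\<bar>) \<and> near (f (X i)) (D (\<beta> i)) e r" by blast
  then show ?thesis using r(1)
    by (intro exI[of _ r] exI[of _ "\<lambda>i. D (\<beta> i)"] exI[of _ "\<Sum>b\<in>set bs. \<bar>D b\<bar>"] conjI)
qed

text \<open>Given an approximating simple function, a condition decides the signs on the block and
  the piece containing each point. The integral then becomes a weighted sum of signs times values
  \<open>c i\<close>; replacing these, which depend on \<open>n\<close>, by the fixed ground model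
  sequence \<open>d\<close> makes \<open>random_null_sums\<close> applicable.\<close>

lemma weak_star_null_nu: "weak_star_null (\<lambda>n a. nu (1 / 16 ^ n) (blk n) (clop a)) p"
  unfolding weak_star_null_iff
proof (intro allI impI rlimI)
  fix \<nu> :: "nat \<Rightarrow> ('a, 'p) psnm \<Rightarrow> 'p rnm" and f J q0 q and e' :: rat
  assume q0: "q0 \<le> p" and ext: "\<forall>n. radon_extension (\<lambda>a. nu (1 / 16 ^ n) (blk n) (clop a)) (\<nu> n) q0"
    and cont: "is_continuous f q0" and int: "\<forall>n. has_int (\<nu> n) f (J n) q0" and e': "0 < e'" and q: "q \<le> q0"
  \<comment> \<open>Four errors: one from the integral's approximation, two from comparing
    \<open>c i\<close> and \<open>d i\<close> through the value of \<open>f\<close>, one from the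
    random sum.\<close>
  define e where "e = e' / 4"
  have e: "e > 0" using e' by (simp add: e_def)
  obtain r1 d C where r1: "r1 \<le> q0" "r1 \<le> q" "\<And>i. \<bar>d i\<bar> \<le> C" "\<And>i. near (f (X i)) (d i) e r1"
  proof -
    have "is_continuous f q" using cont order_trans[OF _ q] unfolding is_continuous_iff by meson
    from continuous_approx[OF this e] show thesis using that order_trans[OF _ q] by blast
  qed
  have "random_over_V \<rho> r1"
    using random order_trans[OF _ order_trans[OF r1(1) q0]] unfolding random_over_V_def fall_def fimp_def by blast
  moreover have "summable (\<lambda>n. (real_of_rat (1 / 16 ^ n))\<^sup>2 * card (blk n))"
  proof -
    have "(\<lambda>n. (real_of_rat (1 / 16 ^ n))\<^sup>2 * card (blk n)) = (\<lambda>n. (1 / 16) ^ n)"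
      by (simp add: of_rat_divide of_rat_power power_divide power2_eq_square)
    then show ?thesis by (simp add: summable_geometric)
  qed
  ultimately have "\<exists>r\<le>r1. \<exists>N. \<forall>n\<ge>N. \<forall>q\<le>r. \<forall>g. (\<forall>i\<in>blk n. sgnv i q (g i)) \<longrightarrow>
      \<bar>1 / 16 ^ n * (\<Sum>i\<in>blk n. g i * d i)\<bar> \<le> e"
    using random_null_sums[of r1 blk d C "\<lambda>n. 1 / 16 ^ n" e] r1(3) e by simp
  then obtain r2 N where r2: "r2 \<le> r1" and small: "\<And>n q g. n \<ge> N \<Longrightarrow> q \<le> r2 \<Longrightarrow> \<forall>i\<in>blk n. sgnv i q (g i) \<Longrightarrow>
      \<bar>1 / 16 ^ n * (\<Sum>i\<in>blk n. g i * d i)\<bar> \<le> e" by blast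
  have r2q0: "r2 \<le> q0" using order_trans[OF r2 r1(1)] .
  have "rdist_le (J n) (rrat 0) e' r2" if n: "n \<ge> N" for n
  proof (rule reg_dense[OF reg_rdist_le])
    fix s0 assume s0: "s0 \<le> r2"
    define w :: rat where "w = 1 / 16 ^ n"
    have s0q: "s0 \<le> q0" using order_trans[OF s0 r2q0] .
    have hi: "has_int (\<nu> n) f (J n) q0" using int by blast
    have realJ: "is_real (J n) q0" using hi unfolding has_int_iff by blast
    have "\<exists>s\<le>s0. \<exists>zs. borel_family (map snd zs) s \<and>
      (\<forall>x. \<forall>t\<le>s. is_ultrafilter x t \<longrightarrow> (\<forall>u\<le>t. \<exists>t'\<le>u. \<exists>i<length zs. (x \<in>\<^sub>1 snd (zs ! i)) t')) \<and>
      (\<forall>i x. \<forall>t\<le>s. i < length zs \<longrightarrow> (x \<in>\<^sub>1 snd (zs ! i)) t \<longrightarrow> rdist_le (f x) (rrat (fst (zs ! i))) e t) \<and>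
      rdist_le (J n) (rsum (map (\<lambda>(c, B). rscale c (\<nu> n B)) zs)) e s"
      using conjunct2[OF hi[unfolded has_int_iff], rule_format, OF order_refl e s0q] .
    then obtain s zs where s: "s \<le> s0" and fam: "borel_family (map snd zs) s"
      and cover: "\<And>x t. t \<le> s \<Longrightarrow> is_ultrafilter x t \<Longrightarrow> (\<exists>t'\<le>t. \<exists>k<length zs. (x \<in>\<^sub>1 snd (zs ! k)) t')"
      and approx: "\<And>k x t. t \<le> s \<Longrightarrow> k < length zs \<Longrightarrow> (x \<in>\<^sub>1 snd (zs ! k)) t \<Longrightarrow> rdist_le (f x) (rrat (fst (zs ! k))) e t"
      and sum: "rdist_le (J n) (rsum (map (\<lambda>(c, B). rscale c (\<nu> n B)) zs)) e s"
      using order_refl by (elim exE conjE) (rule that, auto)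
    let ?P = "\<lambda>i t. (\<exists>v. sgnv i t v) \<and> (\<exists>k<length zs. (X i \<in>\<^sub>1 snd (zs ! k)) t)"
    have "\<exists>t\<le>s. \<forall>i\<in>blk n. ?P i t"
    proof (rule dense_finite)
      fix i q' assume q': "q' \<le> s"
      obtain t v where t: "t \<le> q'" "sgnv i t v" using sgnv_dense by blast
      obtain t' k where t': "t' \<le> t" "k < length zs" "(X i \<in>\<^sub>1 snd (zs ! k)) t'"
        using cover[OF order_trans[OF t(1) q'] is_ultrafilter_X] by blast
      then show "\<exists>r\<le>q'. ?P i r" using sgnv_down[OF t(2) t'(1)] order_trans[OF t'(1) t(1)] by blast
    next
      fix i show "down (?P i)" unfolding down_def
      proof (intro allI impI)
        fix p q assume "q \<le> p" "?P i p"
        then show "?P i q"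
          using sgnv_down[of i p _ q] regD[OF reg_mem_by, of "(=\<^sub>0)" "X i" _ p q] by blast
      qed
    qed simp
    then obtain t where t: "t \<le> s" "\<forall>i\<in>blk n. ?P i t" by blast
    then have "\<forall>i\<in>blk n. \<exists>v. sgnv i t v" "\<forall>i\<in>blk n. \<exists>k. k < length zs \<and> (X i \<in>\<^sub>1 snd (zs ! k)) t" by blast+
    from this[THEN bchoice] obtain g m where g: "\<forall>i\<in>blk n. sgnv i t (g i)"
      and m: "\<forall>i\<in>blk n. m i < length zs \<and> (X i \<in>\<^sub>1 snd (zs ! m i)) t" by blast
    have ts: "t \<le> s0" "t \<le> r2" "t \<le> r1" "t \<le> q0"
      using order_trans[OF t(1) s] order_trans[OF _ s0] order_trans[OF _ r2] order_trans[OF _ r1(1)] by blast+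
    define c where "c i = fst (zs ! m i)" for i
    have cd: "\<bar>d i - c i\<bar> \<le> 2 * e" if "i \<in> blk n" for i
    proof -
      have "rdist_le (f (X i)) (rrat (c i)) e t" using approx[OF t(1)] m that unfolding c_def by blast
      from rdist_leD[OF this near_down[OF r1(4) ts(3)] near_rrat] show ?thesis by simp
    qed
    have sv: "sval i (snd (zs ! k)) t (if m i = k then g i else 0)" if "i \<in> blk n" "k < length zs" for i k
    proof (cases "m i = k")
      case True
      then show ?thesis using m g that unfolding sval_def by auto
    next
      case False
      have mi: "m i < length zs" "(X i \<in>\<^sub>1 snd (zs ! m i)) t" using m that by auto
      have "\<not> (X i \<in>\<^sub>1 snd (zs ! k)) u" if u: "u \<le> t" for u
      proof
        assume k: "(X i \<in>\<^sub>1 snd (zs ! k)) u"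
        have "disj1 (snd (zs ! m i)) (snd (zs ! k)) s \<or> disj1 (snd (zs ! k)) (snd (zs ! m i)) s"
          using fam mi(1) \<open>k < length zs\<close> False unfolding borel_family_iff
          by (metis length_map linorder_neqE_nat nth_map)
        then show False
          using k regD[OF reg_mem_by mi(2) u] order_trans[OF u t(1)] unfolding disj1_iff by blast
      qed
      then show ?thesis using False unfolding sval_def fnot_def by auto
    qed
    define v where "v k = fst (zs ! k) * (w * (\<Sum>i\<in>blk n. if m i = k then g i else 0))" for k
    let ?xs = "map (\<lambda>(c, B). rscale c (\<nu> n B)) zs"
    have "near (rsum ?xs) (\<Sum>k<length ?xs. v k) 0 t"
    proof (rule near_rsum)
      fix k assume "k < length ?xs"
      then have k: "k < length zs" by simp
      have "near (nu w (blk n) (snd (zs ! k))) (w * (\<Sum>i\<in>blk n. if m i = k then g i else 0)) 0 t"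
        by (rule near_nu) (use sv k in blast)
      \<comment> \<open>\<open>\<nu> n\<close> is an arbitrary Radon extension and the pieces are
        arbitrary Borel sets; uniqueness brings back the explicit point masses.\<close>
      moreover have "(\<nu> n (snd (zs ! k)) =\<^sub>0 nu w (blk n) (snd (zs ! k))) t"
      proof (rule radon_unique)
        have ex: "is_radon (\<nu> n) q0" "\<And>a. (\<nu> n (clop a) =\<^sub>0 nu w (blk n) (clop a)) q0"
          using ext unfolding radon_extension_iff w_def by blast+
        show "is_radon (\<nu> n) t" by (rule regD[OF reg_is_radon ex(1) ts(4)])
        show "(\<nu> n (clop a) =\<^sub>0 nu w (blk n) (clop a)) t" for a by (rule regD[OF reg_eq_by ex(2) ts(4)])
        have "is_borel (snd (zs ! k)) s" using fam k unfolding borel_family_iff by auto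
        then show "is_borel (snd (zs ! k)) t" by (rule regD[OF reg_is_borel _ t(1)])
      qed simp
      ultimately have "near (\<nu> n (snd (zs ! k))) (w * (\<Sum>i\<in>blk n. if m i = k then g i else 0)) 0 t"
        using near_cong eq_by_sym by blast
      from near_rscale[OF this, of "fst (zs ! k)"] show "near (?xs ! k) (v k) 0 t"
        using k unfolding v_def by (simp add: case_prod_beta)
    qed
    moreover have "(\<Sum>k<length ?xs. v k) = w * (\<Sum>i\<in>blk n. g i * c i)"
    proof -
      have "(\<Sum>k<length zs. v k) = w * (\<Sum>k<length zs. \<Sum>i\<in>blk n. if m i = k then g i * c i else 0)"
        unfolding v_def sum_distrib_left c_def by (intro sum.cong) auto
      also have "\<dots> = w * (\<Sum>i\<in>blk n. \<Sum>k<length zs. if m i = k then g i * c i else 0)"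
        by (subst sum.swap) rule
      also have "\<dots> = w * (\<Sum>i\<in>blk n. g i * c i)"
        using m by (intro arg_cong[of _ _ "(*) w"] sum.cong) auto
      finally show ?thesis by simp
    qed
    ultimately have "near (rsum ?xs) (w * (\<Sum>i\<in>blk n. g i * c i)) 0 t" by simp
    from rdist_le_near[OF regD[OF reg_rdist_le sum t(1)] this regD[OF reg_is_real realJ ts(4)]]
    have "near (J n) (w * (\<Sum>i\<in>blk n. g i * c i)) (e + 0) t" .
    moreover have "\<bar>w * (\<Sum>i\<in>blk n. g i * c i)\<bar> \<le> 3 * e"
    proof -
      \<comment> \<open>The error is averaged with total weight 1, because \<open>w\<close> is the
        reciprocal of the block size; this is the use of bounded norms.\<close>
      have "\<bar>w * (\<Sum>i\<in>blk n. g i * (c i - d i))\<bar> \<le> w * (\<Sum>i\<in>blk n. 2 * e)"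
      proof -
        have "\<bar>\<Sum>i\<in>blk n. g i * (c i - d i)\<bar> \<le> (\<Sum>i\<in>blk n. 2 * e)"
        proof (rule order_trans[OF sum_abs sum_mono])
          fix i assume i: "i \<in> blk n"
          then have "\<bar>g i\<bar> = 1" using g sgnv_abs by blast
          then show "\<bar>g i * (c i - d i)\<bar> \<le> 2 * e" using cd[OF i] by (simp add: abs_mult abs_minus_commute)
        qed
        then show ?thesis unfolding abs_mult by (intro mult_mono) (auto simp: w_def)
      qed
      also have "\<dots> = 2 * e" by (simp add: w_def)
      finally have "\<bar>w * (\<Sum>i\<in>blk n. g i * (c i - d i))\<bar> \<le> 2 * e" .
      moreover have "\<bar>w * (\<Sum>i\<in>blk n. g i * d i)\<bar> \<le> e" unfolding w_def by (rule small[OF n ts(2) g])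
      moreover have "w * (\<Sum>i\<in>blk n. g i * c i) = w * (\<Sum>i\<in>blk n. g i * (c i - d i)) + w * (\<Sum>i\<in>blk n. g i * d i)"
        unfolding distrib_left[symmetric] sum.distrib[symmetric] by (simp add: algebra_simps)
      ultimately show ?thesis by linarith
    qed
    ultimately have "rdist_le (J n) (rrat 0) e' t"
      by (intro near_rdist_leI[OF _ near_rrat]) (auto simp: e_def)
    then show "\<exists>r\<le>s0. rdist_le (J n) (rrat 0) e' r" using ts(1) by blast
  qed
  then show "\<exists>r\<le>q. \<exists>N. \<forall>n\<ge>N. rdist_le (J n) (rrat 0) e' r"
    using order_trans[OF r2 r1(2)] by blast
qed

definition posset :: "('a, 'p) psnm"
  where "posset = compr (\<lambda>x. is_ultrafilter x \<^bold>\<and> (\<^bold>\<exists>i. i \<in>\<^sub>0 \<rho> \<^bold>\<and> A i \<in>\<^sub>0 x))"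

lemma mem_posset: "(x \<in>\<^sub>1 posset) q \<longleftrightarrow>
    is_ultrafilter x q \<and> (\<forall>r\<le>q. \<exists>s\<le>r. \<exists>i. (i \<in>\<^sub>0 \<rho>) s \<and> (A i \<in>\<^sub>0 x) s)"
proof -
  have "(x \<in>\<^sub>1 posset) q \<longleftrightarrow> (is_ultrafilter x \<^bold>\<and> (\<^bold>\<exists>i. i \<in>\<^sub>0 \<rho> \<^bold>\<and> A i \<in>\<^sub>0 x)) q"
    unfolding posset_def
  proof (rule mem_by_compr)
    fix y q assume e: "(x =\<^sub>0 y) q" and y: "(is_ultrafilter y \<^bold>\<and> (\<^bold>\<exists>i. i \<in>\<^sub>0 \<rho> \<^bold>\<and> A i \<in>\<^sub>0 y)) q"
    have "(a \<in>\<^sub>0 x) t \<longleftrightarrow> (a \<in>\<^sub>0 y) t" if "t \<le> q" for a t by (rule eq_by_mem[OF e that])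
    moreover have "is_ultrafilter x q" using y is_ultrafilter_cong[OF e] unfolding fand_def by blast
    ultimately show "(is_ultrafilter x \<^bold>\<and> (\<^bold>\<exists>i. i \<in>\<^sub>0 \<rho> \<^bold>\<and> A i \<in>\<^sub>0 x)) q"
      using y order_trans unfolding fand_def fex_def by meson
  qed (intro reg_intros)+
  then show ?thesis by (simp add: fand_def fex_def)
qed

lemma is_open_posset: "is_open posset q"
  unfolding is_open_iff
proof (intro conjI allI impI)
  show "(posset \<subseteq>\<^sub>1 stone) q" unfolding sub1_iff mem_posset by simp
next
  fix x q r assume x: "(x \<in>\<^sub>1 posset) q" and r: "r \<le> q"
  then obtain s i where s: "s \<le> r" "(i \<in>\<^sub>0 \<rho>) s" "(A i \<in>\<^sub>0 x) s" unfolding mem_posset by blast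
  have "(clop (A i) \<subseteq>\<^sub>1 posset) s" unfolding sub1_iff mem_posset mem_clop
  proof (intro allI impI conjI)
    fix y t u assume t: "t \<le> s" "is_ultrafilter y t \<and> (A i \<in>\<^sub>0 y) t" "u \<le> t"
    have "(i \<in>\<^sub>0 \<rho>) u" by (rule regD[OF reg_mem_by s(2) order_trans[OF t(3) t(1)]])
    moreover have "(A i \<in>\<^sub>0 y) u" by (rule regD[OF reg_mem_by conjunct2[OF t(2)] t(3)])
    ultimately show "\<exists>u'\<le>u. \<exists>i. (i \<in>\<^sub>0 \<rho>) u' \<and> (A i \<in>\<^sub>0 y) u'" using order_refl by blast
  qed blast
  moreover have "is_ultrafilter x s"
    using x is_ultrafilter_down order_trans[OF s(1) r] unfolding mem_posset by blast
  ultimately show "\<exists>s\<le>r. \<exists>a. is_ultrafilter x s \<and> (a \<in>\<^sub>0 x) s \<and> (clop a \<subseteq>\<^sub>1 posset) s"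
    using s by blast
qed

text \<open>A point lies in this set exactly when its sign is 1, so its signed mass there is 1 or 0.
  The expression affine in \<open>g\<close> lets the mass of a block be computed from the mean of
  its signs.\<close>

lemma sval_posset:
  assumes "sgnv i s g" shows "sval i posset s ((1 + g) / 2)"
proof -
  have "(X i \<in>\<^sub>1 posset) s" if "(i \<in>\<^sub>0 \<rho>) s"
    unfolding mem_posset using regD[OF reg_mem_by that] A_in_U order_refl by fastforce
  moreover have "(\<^bold>\<not> X i \<in>\<^sub>1 posset) s" if no: "(\<^bold>\<not> i \<in>\<^sub>0 \<rho>) s" unfolding fnot_def
  proof (intro allI impI notI)
    fix q assume q: "q \<le> s" "(X i \<in>\<^sub>1 posset) q"
    from dense_ex[OF conjunct2[OF q(2)[unfolded mem_posset mem_check]]]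
    obtain r j where "r \<le> q" "(j \<in>\<^sub>0 \<rho>) r" "A j \<in> U i" by blast
    then show False using A_in_U_iff fnotD[OF no] order_trans[OF _ q(1)] by metis
  qed
  ultimately show ?thesis using assms unfolding sval_def sgnv_def by auto
qed

lemma not_grothendieck: "\<not> grothendieck TYPE('a) p"
proof
  assume gro: "grothendieck TYPE('a) p"
  have "is_measure (\<lambda>a. nu (1 / 16 ^ n) (blk n) (clop a)) p" for n by (rule is_measure_nu) auto
  from gro[unfolded grothendieck_iff, rule_format, OF order_refl this weak_star_null_nu]
  have "weakly_null (\<lambda>n a. nu (1 / 16 ^ n) (blk n) (clop a)) p" .
  from this[unfolded weakly_null_iff, rule_format, OF order_refl radon_extension_nu borel_open[OF is_open_posset]]
  have "rlim (\<lambda>n. nu (1 / 16 ^ n) (blk n) posset) (rrat 0) p" .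
  \<comment> \<open>The masses will turn out to be \<open>(1 + x) / 2\<close> with
    \<open>\<bar>x\<bar> \<le> 1/8\<close>, hence at least \<open>7/16\<close>, which exceeds this
    tolerance.\<close>
  from rlimD[OF this, of "1/8" p] obtain r N where r: "r \<le> p"
    "\<forall>n\<ge>N. rdist_le (nu (1 / 16 ^ n) (blk n) posset) (rrat 0) (1/8) r" by auto
  have "random_over_V \<rho> r"
    using random order_trans[OF _ r(1)] unfolding random_over_V_def fall_def fimp_def by blast
  moreover have "summable (\<lambda>n. (real_of_rat (1 / 16 ^ n))\<^sup>2 * card (blk n))"
  proof -
    have "(\<lambda>n. (real_of_rat (1 / 16 ^ n))\<^sup>2 * card (blk n)) = (\<lambda>n. (1 / 16) ^ n)"
      by (simp add: of_rat_divide of_rat_power power_divide power2_eq_square)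
    then show ?thesis by (simp add: summable_geometric)
  qed
  \<comment> \<open>For the constant sequence 1 this is a law of large numbers: the mean
    \<open>x\<close> of the signs in a block becomes small.\<close>
  ultimately have "\<exists>s\<le>r. \<exists>M. \<forall>n\<ge>M. \<forall>q\<le>s. \<forall>g. (\<forall>i\<in>blk n. sgnv i q (g i)) \<longrightarrow>
      \<bar>1 / 16 ^ n * (\<Sum>i\<in>blk n. g i * 1)\<bar> \<le> 1/8"
    by (intro random_null_sums[of r blk "\<lambda>_. 1" 1]) auto
  then obtain s M where s: "s \<le> r" "\<And>n q g. n \<ge> M \<Longrightarrow> q \<le> s \<Longrightarrow> \<forall>i\<in>blk n. sgnv i q (g i) \<Longrightarrow>
      \<bar>1 / 16 ^ n * (\<Sum>i\<in>blk n. g i * 1)\<bar> \<le> 1/8" by blast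
  define n where "n = max N M"
  obtain t g where t: "t \<le> s" "\<forall>i\<in>blk n. sgnv i t (g i)" using sgnv_finite[OF finite_blk] by blast
  define x where "x = 1 / 16 ^ n * (\<Sum>i\<in>blk n. g i)"
  have "near (nu (1 / 16 ^ n) (blk n) posset) (1 / 16 ^ n * (\<Sum>i\<in>blk n. (1 + g i) / 2)) 0 t"
    by (rule near_nu) (use t(2) sval_posset in blast)
  moreover have "1 / 16 ^ n * (\<Sum>i\<in>blk n. (1 + g i) / 2) = (1 + x) / 2"
    unfolding x_def sum_divide_distrib[symmetric] sum.distrib by (simp add: field_simps)
  ultimately have "near (nu (1 / 16 ^ n) (blk n) posset) ((1 + x) / 2) 0 t" by (simp only:)
  moreover have "rdist_le (nu (1 / 16 ^ n) (blk n) posset) (rrat 0) (1/8) t"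
    using r(2) regD[OF reg_rdist_le _ order_trans[OF t(1) s(1)]] by (simp add: n_def)
  ultimately have "\<bar>(1 + x) / 2 - 0\<bar> \<le> 1/8 + 0 + 0" using rdist_leD near_rrat by blast
  moreover have "\<bar>x\<bar> \<le> 1/8" using s(2)[of n t g] t by (simp add: n_def x_def)
  ultimately show False by (simp add: abs_le_iff)
qed

end

theorem theorem4p5:
  assumes "adds_random_real TYPE('p::preorder)"
    and "infinite (UNIV :: 'a::boolean_algebra set)"
  shows "forced ((\<^bold>\<not> nikodym TYPE('a)) \<^bold>\<and> (\<^bold>\<not> grothendieck TYPE('a)) :: 'p fm)"
proof -
  obtain A :: "nat \<Rightarrow> 'a" where A: "\<And>i. A i \<noteq> bot" "\<And>i j. i \<noteq> j \<Longrightarrow> inf (A i) (A j) = bot"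
    using disjoint_sequence[OF assms(2)] by blast
  have "\<forall>i. \<exists>U. ultra U \<and> A i \<in> U" using ultra_exists[OF A(1)] by blast
  from choice[OF this] obtain U where U: "\<And>i. ultra (U i)" "\<And>i. A i \<in> U i" by blast
  \<comment> \<open>Forcing a negation means that no stronger condition forces the property. Both
    properties pass to stronger conditions, so it suffices to refute them at some condition below
    each \<open>q\<close>, namely one at which a name for a random real is available.\<close>
  have key: "\<exists>r\<le>q. \<not> nikodym TYPE('a) r \<and> \<not> grothendieck TYPE('a) r" for q :: 'p
  proof -
    obtain r and \<rho> :: "(nat, 'p) nm" where r: "r \<le> q" "random_over_V \<rho> r"
      using assms(1) order_refl[of q] unfolding adds_random_real_def forced_def fex_def by blast
    interpret disjoint_signs \<rho> U A r
      by unfold_locales (use U A(2) r(2) in auto)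
    show ?thesis using r(1) not_nikodym not_grothendieck by blast
  qed
  have nik: "nikodym TYPE('a) r" if "nikodym TYPE('a) q" "r \<le> q" for q r :: 'p
    using that order_trans[OF _ that(2)] unfolding nikodym_iff by simp
  have gro: "grothendieck TYPE('a) r" if "grothendieck TYPE('a) q" "r \<le> q" for q r :: 'p
    using that order_trans[OF _ that(2)] unfolding grothendieck_iff by simp
  show ?thesis
    unfolding forced_def fand_def fnot_def using key nik gro by blast
qed

end
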